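(* Let $u\colon\mathbb{R}^d\to\mathbb{R}$ satisfy: (i) $u\in C^6(\mathbb{R}^d)$ and $|D^ku|\in L^\infty(\mathbb{R}^d)$ for $3\le k\le 6$; (ii) there exist $\lambda>0$ and a point $x_*\in\mathbb{R}^d$ such that $u(x_* )=0$ and $u(x)\ge\frac{\lambda}{2}|x-x_*|^2$ for all $x\in\mathbb{R}^d$. Let $r\in C^4(\mathbb{R}^d)$. Then there exists $C>0$ such that for all $\varepsilon>0$, $$\int_{\mathbb{R}^d}\frac{e^{-u(x)/\varepsilon}}{(2\pi\varepsilon)^{d/2}}\,r(x)\,dx=\frac{1}{\sqrt{\det[u_{ij}]}}\bigg[r+\varepsilon\Big(\tfrac12u^{ij}\partial_{ij}r-\tfrac12u_{jk\ell}u^{ij}u^{k\ell}\partial_ir+\tfrac18r\,u_{ijk}u_{\ell mn}u^{ij}u^{k\ell}u^{mn}$$ $$+\tfrac1{12}r\,u_{ijk}u_{\ell mn}u^{i\ell}u^{jm}u^{kn}-\tfrac18r\,u_{ijk\ell}u^{ij}u^{k\ell}\Big)\bigg]+\varepsilon^2\mathcal{R}(\varepsilon),$$ where the right-hand side is evaluated at $x=x_*$, and where $$|\mathcal{R}(\varepsilon)|\le C\Big[|D^{\le2}r|(x_* )+\big(K_{\varepsilon/\lambda}*|D^{\le4}r|\big)(x_* )\Big].$$ The constant $C$ only depends on $d$, $\lambda$ and $\|D^ku\|_{L^\infty(\mathbb{R}^d)}$ for $3\le k\le 6$.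
   Context: Subscripts on $u$ denote partial derivatives ($u_{ij}=\partial_i\partial_ju$, etc.), $(u^{ij})$ is the inverse matrix of $(u_{ij})$, and repeated indices are summed from $1$ to $d$. For a function $f$ on $\mathbb{R}^d$, $|D^kf|=\sum_{|\alpha|=k}|\partial^\alpha f|$ (sum over multi-indices of length $k$) and $|D^{\le k}f|=\sum_{j=0}^k|D^jf|$. The kernel is $K_\tau(z)=\tau^{-d/2}K(z/\sqrt\tau)$ for $\tau>0$, where $K(z)=e^{-|z|^2/4}/|z|^{d-1}$; $*$ denotes convolution on $\mathbb{R}^d$ and $|\cdot|$ the Euclidean norm. *)

theory Defs
  imports "HOL-Analysis.Analysis" "HOL-Probability.Essential_Supremum"
begin

definition partial :: "'d \<Rightarrow> (real ^ 'd \<Rightarrow> real) \<Rightarrow> real ^ 'd \<Rightarrow> real" where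
  "partial i f x = deriv (\<lambda>t. f (x + t *\<^sub>R axis i 1)) 0"

(* pd [i, j, k] f is the mixed partial derivative d_i d_j d_k f *)
definition pd :: "'d list \<Rightarrow> (real ^ 'd \<Rightarrow> real) \<Rightarrow> real ^ 'd \<Rightarrow> real" where
  "pd is f = foldr partial is f"

(* Ck k f: f is k times continuously differentiable on the whole space *)
primrec Ck :: "nat \<Rightarrow> (real ^ 'd \<Rightarrow> real) \<Rightarrow> bool" where
  "Ck 0 f \<longleftrightarrow> continuous_on UNIV f"
| "Ck (Suc k) f \<longleftrightarrow> (\<forall>x. f differentiable (at x)) \<and> (\<forall>i. Ck k (partial i f))"

(* The index type is merely finite, so an enumeration of the coordinates is chosen.
   On functions of sufficient smoothness the choice is irrelevant, since partial
   derivatives commute. *)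
definition coords :: "'d::finite list" where
  "coords = (SOME is. distinct is \<and> set is = UNIV)"

definition multi_pd :: "('d::finite \<Rightarrow> nat) \<Rightarrow> (real ^ 'd \<Rightarrow> real) \<Rightarrow> real ^ 'd \<Rightarrow> real" where
  "multi_pd \<alpha> f = pd (concat (map (\<lambda>i. replicate (\<alpha> i) i) coords)) f"

definition multi_indices :: "nat \<Rightarrow> ('d::finite \<Rightarrow> nat) set" where
  "multi_indices k = {\<alpha>. (\<Sum>i\<in>UNIV. \<alpha> i) = k}"

(* sums over multi_indices k are genuine, not the default 0 of an infinite sum *)
lemma finite_multi_indices: "finite (multi_indices k :: ('d::finite \<Rightarrow> nat) set)"
proof (rule finite_subset)
  show "multi_indices k \<subseteq> (PiE UNIV (\<lambda>_. {..k}) :: ('d \<Rightarrow> nat) set)"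
    by (auto simp: multi_indices_def intro!: member_le_sum)
qed (simp add: finite_PiE)

definition D_abs :: "nat \<Rightarrow> (real ^ 'd \<Rightarrow> real) \<Rightarrow> real ^ 'd \<Rightarrow> real" where
  "D_abs k f x = (\<Sum>\<alpha>\<in>multi_indices k. \<bar>multi_pd \<alpha> f x\<bar>)"

definition D_abs_le :: "nat \<Rightarrow> (real ^ 'd \<Rightarrow> real) \<Rightarrow> real ^ 'd \<Rightarrow> real" where
  "D_abs_le k f x = (\<Sum>j\<le>k. D_abs j f x)"

definition Linf_norm :: "(real ^ 'd \<Rightarrow> real) \<Rightarrow> ennreal" where
  "Linf_norm f = esssup lborel (\<lambda>x. ennreal \<bar>f x\<bar>)"

definition hessian :: "(real ^ 'd \<Rightarrow> real) \<Rightarrow> real ^ 'd \<Rightarrow> real ^ 'd ^ 'd" where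
  "hessian u x = (\<chi> i j. pd [i, j] u x)"

(* K 0 carries a default value of division by zero when the dimension exceeds 1;
   the kernel only ever occurs under an integral *)
definition K :: "real ^ 'd \<Rightarrow> real" where
  "K z = exp (- (norm z)\<^sup>2 / 4) / norm z ^ (CARD('d) - 1)"

definition K_scaled :: "real \<Rightarrow> real ^ 'd \<Rightarrow> real" where
  "K_scaled \<tau> z = \<tau> powr (- real CARD('d) / 2) * K (z /\<^sub>R sqrt \<tau>)"

(* convolution of nonnegative functions, possibly infinite *)
definition conv :: "(real ^ 'd \<Rightarrow> real) \<Rightarrow> (real ^ 'd \<Rightarrow> real) \<Rightarrow> real ^ 'd \<Rightarrow> ennreal" where
  "conv f g x = (\<integral>\<^sup>+ y. ennreal (f (x - y)) * ennreal (g y) \<partial>lborel)"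

definition laplace_integrand ::
  "(real ^ 'd \<Rightarrow> real) \<Rightarrow> (real ^ 'd \<Rightarrow> real) \<Rightarrow> real \<Rightarrow> real ^ 'd \<Rightarrow> real" where
  "laplace_integrand u r \<epsilon> x =
     exp (- u x / \<epsilon>) / (2 * pi * \<epsilon>) powr (real CARD('d) / 2) * r x"

end

theory Submission
  imports Defs "HOL-Probability.Distributions"
begin

text \<open>
  Put \<open>\<epsilon> = s\<^sup>2\<close> and \<open>x = x\<^sub>* + s y\<close>. Since \<open>u\<close> and its gradient vanish at \<open>x\<^sub>*\<close>, the phase
  \<open>\<phi>(s, y) = u(x\<^sub>* + s y) / s\<^sup>2\<close> extends to a \<open>C\<^sup>4\<close> function of \<open>s\<close> (an average of the second derivatives of
  \<open>u\<close> over a segment), with \<open>\<phi>(0, y)\<close> the Gaussian phase and \<open>\<phi> \<ge> \<lambda>|y|\<^sup>2/2\<close>. Expand \<open>exp (- \<phi>) r(x\<^sub>* + s y)\<close> to fourth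
  order in \<open>s\<close>: odd coefficients are odd in \<open>y\<close> and integrate to zero, the coefficients of order 0 and 2
  are Gaussian moments, evaluated by Wick's formula. Every term of the fourth derivative carries at
  least four powers of \<open>|y|\<close> besides the Gaussian decay and derivatives of \<open>r\<close> at \<open>x\<^sub>* + t s y\<close>, \<open>0 \<le> t \<le> 1\<close>;
  substituting \<open>z = t s y\<close> and integrating over \<open>t\<close> produces the kernel with its singularity \<open>|z|\<^sup>1\<^sup>-\<^sup>d\<close>.
  The bound is uniform in \<open>\<epsilon>\<close>, so small and large \<open>\<epsilon>\<close> need no separate treatment.
\<close>

section \<open>Iterated partial derivatives\<close>

text \<open>No bound on the derivatives of r is available, so the Taylor remainder cannot be
  estimated by a supremum over the segment. It stays an average over t, which Tonelli exchanges with
  the integral over y. For fixed t the substitution has Jacobian (t s)^(-d), too singular at t = 0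
  by itself; but with a = |z|/s the Gaussian in y = z/(t s) effectively forces t to be at least of
  order a, and for d > 1 the integral of t^(-d) from a to 1 is of order a^(1-d), the singularity of
  K. Half of the Gaussian exponent survives as the exponential in K; the other half pays for all
  polynomial factors. The s-derivatives of phi of orders 1 to 4 involve exactly the third to sixth
  derivatives of u. The possibly unbounded second derivatives enter only through phi itself, where
  the quadratic lower bound controls exp (- phi). Since r may grow arbitrarily, integrability of the
  integrand is a consequence of the finiteness of the convolution.\<close>

lemma partial_eq_frechet:
  assumes "(f has_derivative F) (at x)"
  shows "partial i f x = F (axis i 1)"
proof -
  have "((\<lambda>t. x + t *\<^sub>R axis i 1) has_derivative (\<lambda>t. t *\<^sub>R axis i 1)) (at (0::real))"
    by (auto intro!: derivative_eq_intros)
  moreover have "(f has_derivative F) (at (x + 0 *\<^sub>R axis i 1))" using assms by simp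
  ultimately have "((\<lambda>t. f (x + t *\<^sub>R axis i 1)) has_derivative (\<lambda>t. F (t *\<^sub>R axis i 1))) (at (0::real))"
    by (rule has_derivative_compose)
  moreover have "F (t *\<^sub>R axis i 1) = F (axis i 1) * t" for t
    using has_derivative_linear[OF assms] by (simp add: linear_cmul)
  ultimately have "((\<lambda>t. f (x + t *\<^sub>R axis i 1)) has_real_derivative F (axis i 1)) (at 0)"
    by (simp add: has_field_derivative_def)
  then show ?thesis unfolding partial_def by (rule DERIV_imp_deriv)
qed

lemma DERIV_along_line:
  assumes "\<And>x. f differentiable (at x)"
  shows "((\<lambda>s. f (x + s *\<^sub>R y)) has_real_derivative (\<Sum>i\<in>UNIV. y $ i * partial i f (x + s *\<^sub>R y))) (at s)"
proof -
  obtain F where F: "(f has_derivative F) (at (x + s *\<^sub>R y))"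
    using assms by (auto simp: differentiable_def)
  have "((\<lambda>s. x + s *\<^sub>R y) has_derivative (\<lambda>t. t *\<^sub>R y)) (at s)"
    by (auto intro!: derivative_eq_intros)
  from has_derivative_compose[OF this F]
  have D: "((\<lambda>s. f (x + s *\<^sub>R y)) has_derivative (\<lambda>t. F (t *\<^sub>R y))) (at s)" .
  have lin: "linear F" using F by (rule has_derivative_linear)
  have "F y = F (\<Sum>i\<in>UNIV. y $ i *\<^sub>R axis i 1)"
    by (simp only: scalar_mult_eq_scaleR[symmetric] basis_expansion)
  also have "\<dots> = (\<Sum>i\<in>UNIV. y $ i * partial i f (x + s *\<^sub>R y))"
    by (simp add: linear_sum[OF lin] linear_cmul[OF lin] partial_eq_frechet[OF F])
  finally have "F y = \<dots>" .
  then have "F (t *\<^sub>R y) = (\<Sum>i\<in>UNIV. y $ i * partial i f (x + s *\<^sub>R y)) * t" for t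
    by (simp add: linear_cmul[OF lin])
  with D show ?thesis by (simp add: has_field_derivative_def)
qed

lemma DERIV_along_axis:
  assumes "\<And>x. f differentiable (at x)"
  shows "((\<lambda>s. f (x + s *\<^sub>R axis i 1)) has_real_derivative partial i f (x + s *\<^sub>R axis i 1)) (at s)"
proof -
  have "(\<Sum>j\<in>UNIV. axis i 1 $ j * partial j f (x + s *\<^sub>R axis i 1)) = partial i f (x + s *\<^sub>R axis i 1)"
    by (simp add: axis_def if_distrib[of "\<lambda>a. a * _"] cong: if_cong)
  then show ?thesis using DERIV_along_line[OF assms, of x "axis i 1" s] by simp
qed

lemma Ck_imp_continuous: "Ck k f \<Longrightarrow> continuous_on UNIV f"
  by (cases k) (auto intro!: continuous_at_imp_continuous_on differentiable_imp_continuous_within)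

lemma Ck_Suc_imp: "Ck (Suc k) f \<Longrightarrow> Ck k f"
proof (induction k arbitrary: f)
  case 0
  then show ?case using Ck_imp_continuous[of "Suc 0" f] by (simp only: Ck.simps(1))
qed auto

lemma Ck_antimono: "Ck n f \<Longrightarrow> m \<le> n \<Longrightarrow> Ck m f"
  by (induction n) (auto simp del: Ck.simps simp: le_Suc_eq dest: Ck_Suc_imp)

lemma pd_simps: "pd [] f = f" "pd (i # is) f = partial i (pd is f)" "pd (is @ js) f = pd is (pd js f)"
  by (simp_all add: pd_def)

lemma Ck_pd: "Ck (k + length is) f \<Longrightarrow> Ck k (pd is f)"
proof (induction "is" arbitrary: k)
  case (Cons a "is")
  then have "Ck (Suc k) (pd is f)" by (simp del: Ck.simps)
  then show ?case by (simp add: pd_simps)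
qed (simp add: pd_simps)

text \<open>The mean value theorem is applied first in direction i, then in direction j. The second
  difference is symmetric in i and j, so the same number is also expressed through the other mixed
  derivative; letting both intermediate points approach x then gives
  \<open>partial_commute\<close>.\<close>

lemma second_difference_mean_value:
  assumes f: "Ck 2 f" and "h > 0"
  shows "\<exists>s t. 0 < s \<and> s < h \<and> 0 < t \<and> t < h \<and>
    f (x + h *\<^sub>R axis i 1 + h *\<^sub>R axis j 1) - f (x + h *\<^sub>R axis i 1) - f (x + h *\<^sub>R axis j 1) + f x
     = h\<^sup>2 * partial j (partial i f) (x + s *\<^sub>R axis i 1 + t *\<^sub>R axis j 1)"
proof -
  let ?a = "axis i 1 :: real^'a" and ?b = "axis j 1 :: real^'a"
  have d: "\<And>x. f differentiable (at x)" "\<And>x. partial i f differentiable (at x)"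
    using f by (auto simp: numeral_2_eq_2)
  define \<phi> where "\<phi> s = f (x + h *\<^sub>R ?b + s *\<^sub>R ?a) - f (x + s *\<^sub>R ?a)" for s
  have d\<phi>: "(\<phi> has_real_derivative (partial i f (x + h *\<^sub>R ?b + s *\<^sub>R ?a) - partial i f (x + s *\<^sub>R ?a))) (at s)" for s
    unfolding \<phi>_def by (intro DERIV_diff DERIV_along_axis d)
  obtain s where s: "0 < s" "s < h" "\<phi> h - \<phi> 0 = (h - 0) * (partial i f (x + h *\<^sub>R ?b + s *\<^sub>R ?a) - partial i f (x + s *\<^sub>R ?a))"
    using MVT2[OF \<open>h > 0\<close>, of \<phi>, OF d\<phi>] by blast
  obtain t where t: "0 < t" "t < h"
     "partial i f (x + s *\<^sub>R ?a + h *\<^sub>R ?b) - partial i f (x + s *\<^sub>R ?a + 0 *\<^sub>R ?b) = (h - 0) * partial j (partial i f) (x + s *\<^sub>R ?a + t *\<^sub>R ?b)"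
    using MVT2[OF \<open>h > 0\<close>, of "\<lambda>t. partial i f (x + s *\<^sub>R ?a + t *\<^sub>R ?b)", OF DERIV_along_axis[OF d(2)]] by blast
  show ?thesis
    using s t by (intro exI[of _ s] exI[of _ t]) (simp add: \<phi>_def power2_eq_square algebra_simps)
qed

theorem partial_commute:
  assumes f: "Ck 2 (f :: real^'d \<Rightarrow> real)"
  shows "partial i (partial j f) = partial j (partial i f)"
proof (rule ccontr)
  assume "partial i (partial j f) \<noteq> partial j (partial i f)"
  then obtain x where ne: "partial i (partial j f) x \<noteq> partial j (partial i f) x" by auto
  define e where "e = dist (partial i (partial j f) x) (partial j (partial i f) x) / 2"
  have e: "e > 0" using ne by (simp add: e_def)
  have c: "isCont (partial i (partial j f)) x" "isCont (partial j (partial i f)) x"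
    using f by (auto simp: numeral_2_eq_2 continuous_on_eq_continuous_at)
  obtain d1 where d1: "d1 > 0" "\<And>y. dist y x < d1 \<Longrightarrow> dist (partial i (partial j f) y) (partial i (partial j f) x) < e"
    using c(1) e unfolding continuous_at_eps_delta by blast
  obtain d2 where d2: "d2 > 0" "\<And>y. dist y x < d2 \<Longrightarrow> dist (partial j (partial i f) y) (partial j (partial i f) x) < e"
    using c(2) e unfolding continuous_at_eps_delta by blast
  define h where "h = min d1 d2 / 2"
  have h: "h > 0" using d1 d2 by (simp add: h_def)
  have near: "dist (x + s *\<^sub>R axis a 1 + t *\<^sub>R axis b 1) x < min d1 d2" if "0 < s" "s < h" "0 < t" "t < h" for s t a b
  proof -
    have "norm (s *\<^sub>R axis a (1::real) + t *\<^sub>R axis b 1) \<le> norm (s *\<^sub>R axis a (1::real) :: real^'d) + norm (t *\<^sub>R axis b (1::real) :: real^'d)"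
      by (rule norm_triangle_ineq)
    also have "\<dots> < min d1 d2" using that by (simp add: norm_axis_1 h_def)
    finally show ?thesis by (simp add: dist_norm add.assoc)
  qed
  obtain s t where st: "0 < s" "s < h" "0 < t" "t < h"
    "f (x + h *\<^sub>R axis i 1 + h *\<^sub>R axis j 1) - f (x + h *\<^sub>R axis i 1) - f (x + h *\<^sub>R axis j 1) + f x
     = h\<^sup>2 * partial j (partial i f) (x + s *\<^sub>R axis i 1 + t *\<^sub>R axis j 1)"
    using second_difference_mean_value[OF f h, of x i j] by auto
  obtain s' t' where st': "0 < s'" "s' < h" "0 < t'" "t' < h"
    "f (x + h *\<^sub>R axis j 1 + h *\<^sub>R axis i 1) - f (x + h *\<^sub>R axis j 1) - f (x + h *\<^sub>R axis i 1) + f x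
     = h\<^sup>2 * partial i (partial j f) (x + s' *\<^sub>R axis j 1 + t' *\<^sub>R axis i 1)"
    using second_difference_mean_value[OF f h, of x j i] by auto
  have "h\<^sup>2 * partial j (partial i f) (x + s *\<^sub>R axis i 1 + t *\<^sub>R axis j 1) = h\<^sup>2 * partial i (partial j f) (x + s' *\<^sub>R axis j 1 + t' *\<^sub>R axis i 1)"
    unfolding st(5)[symmetric] st'(5)[symmetric] by (simp add: algebra_simps)
  then have eq: "partial j (partial i f) (x + s *\<^sub>R axis i 1 + t *\<^sub>R axis j 1) = partial i (partial j f) (x + s' *\<^sub>R axis j 1 + t' *\<^sub>R axis i 1)"
    using h by simp
  have "dist (partial i (partial j f) x) (partial j (partial i f) x) < e + e"
    using d1(2)[of "x + s' *\<^sub>R axis j 1 + t' *\<^sub>R axis i 1"] d2(2)[of "x + s *\<^sub>R axis i 1 + t *\<^sub>R axis j 1"]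
      near[OF st(1-4)] near[OF st'(1-4)] eq
    by (smt (verit) dist_commute dist_triangle min_less_iff_conj)
  then show False by (simp add: e_def)
qed

section \<open>Symmetry of higher derivatives and multi-indices\<close>

lemma pd_move_front:
  "Ck (Suc (length xs + length ys)) f \<Longrightarrow> pd (xs @ a # ys) f = pd (a # xs @ ys) f"
proof (induction xs)
  case (Cons b xs)
  have "Ck 2 (pd (xs @ ys) f)"
    using Cons.prems by (intro Ck_pd) (simp del: Ck.simps)
  moreover have "pd (xs @ a # ys) f = pd (a # xs @ ys) f"
    using Cons.prems by (intro Cons.IH, rule_tac Ck_Suc_imp) (simp del: Ck.simps)
  ultimately show ?case
    by (simp add: pd_simps(2) partial_commute del: pd_simps(3))
qed simp

text \<open>The head of the first list occurs somewhere in the second one and is commuted to its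
  front; the tails then agree as multisets. On sufficiently smooth functions the order chosen in
  \<open>coords\<close> is thereby immaterial.\<close>

lemma pd_cong_mset: "mset is = mset js \<Longrightarrow> Ck (length is) f \<Longrightarrow> pd is f = pd js f"
proof (induction "is" arbitrary: js)
  case (Cons a "is")
  then obtain xs ys where js: "js = xs @ a # ys"
    by (metis list.set_intros(1) set_mset_mset split_list)
  then have "mset is = mset (xs @ ys)" using Cons.prems by simp
  moreover from this have len: "length is = length xs + length ys" by (metis size_mset length_append)
  moreover have "Ck (length is) f" using Cons.prems by (rule_tac Ck_Suc_imp) (simp del: Ck.simps)
  ultimately have "pd is f = pd (xs @ ys) f" using Cons.IH by blast
  moreover have "pd (xs @ a # ys) f = pd (a # xs @ ys) f"
    using Cons.prems len by (intro pd_move_front) (simp del: Ck.simps)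
  ultimately show ?case by (simp only: js pd_simps(2))
qed simp

lemma coords: "distinct (coords :: 'd::finite list)" "set (coords :: 'd list) = UNIV"
  using someI_ex[of "\<lambda>is. distinct is \<and> set is = (UNIV :: 'd set)"] finite_distinct_list[of "UNIV :: 'd set"]
  unfolding coords_def by auto

lemma sum_list_coords: "(\<Sum>i\<leftarrow>coords. h i) = (\<Sum>i\<in>UNIV. h i)"
  using coords by (metis sum_list_distinct_conv_sum_set)

lemma length_multi_index_list: "length (concat (map (\<lambda>i. replicate (\<alpha> i) i) coords)) = (\<Sum>i\<in>UNIV. \<alpha> i)"
  by (simp add: length_concat comp_def sum_list_coords)

lemma mset_multi_index_list: "mset (concat (map (\<lambda>i. replicate (count_list is i) i) coords)) = mset is"
proof (rule multiset_eqI)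
  fix a
  have "count (mset (concat (map (\<lambda>i. replicate (count_list is i) i) cs))) a
     = (\<Sum>i\<leftarrow>cs. count (mset (replicate (count_list is i) i)) a)"
    for cs :: "'a list"
    by (induction cs) auto
  then have "count (mset (concat (map (\<lambda>i. replicate (count_list is i) i) coords))) a
     = (\<Sum>i\<leftarrow>coords. count (mset (replicate (count_list is i) i)) a)" .
  also have "\<dots> = (\<Sum>i\<in>UNIV. if i = a then count_list is i else 0)"
    unfolding sum_list_coords by (intro sum.cong) auto
  finally show "count (mset (concat (map (\<lambda>i. replicate (count_list is i) i) coords))) a = count (mset is) a"
    by (simp add: count_mset)
qed

text \<open>The counts of the entries of a list form a multi-index with the same derivative, so the
  left side is one of the summands of \<open>D_abs\<close>.\<close>

lemma abs_pd_le_D_abs: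
  assumes "Ck (length is) f"
  shows "\<bar>pd is f x\<bar> \<le> D_abs (length is) f x"
proof -
  have 1: "pd is f = multi_pd (count_list is) f"
    unfolding multi_pd_def by (rule pd_cong_mset[OF _ assms]) (simp add: mset_multi_index_list)
  have "count_list is \<in> multi_indices (length is)"
    using length_multi_index_list[of "count_list is"] mset_multi_index_list[of "is"]
    unfolding multi_indices_def by (metis (mono_tags, lifting) mem_Collect_eq size_mset)
  then show ?thesis
    unfolding 1 D_abs_def by (intro member_le_sum) (auto simp: finite_multi_indices)
qed

section \<open>Pointwise bounds for derivatives\<close>

lemma D_abs_nonneg: "0 \<le> D_abs k f x"
  by (simp add: D_abs_def sum_nonneg)

lemma D_abs_le_nonneg: "0 \<le> D_abs_le k f x"
  by (simp add: D_abs_le_def D_abs_nonneg sum_nonneg)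

lemma D_abs_le_D_abs_le: "j \<le> k \<Longrightarrow> D_abs j f x \<le> D_abs_le k f x"
  unfolding D_abs_le_def by (rule member_le_sum) (auto simp: D_abs_nonneg)

lemma continuous_on_D_abs: "Ck k f \<Longrightarrow> continuous_on UNIV (D_abs k f)"
  unfolding D_abs_def multi_pd_def multi_indices_def
  by (intro continuous_intros Ck_imp_continuous[of 0] Ck_pd)
     (auto simp: length_multi_index_list simp del: Ck.simps)

lemma continuous_on_D_abs_le: "Ck k f \<Longrightarrow> continuous_on UNIV (D_abs_le k f)"
  unfolding D_abs_le_def by (intro continuous_on_sum continuous_on_D_abs) (auto intro: Ck_antimono)

text \<open>By continuity the set where the bound holds is closed. It has full measure, and a closed
  set of full measure is the whole space, so the essential bound holds at every point.\<close>

lemma D_abs_le_Linf_norm: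
  assumes "Ck k f" "Linf_norm (D_abs k f) < \<infinity>"
  shows "D_abs k f x \<le> enn2real (Linf_norm (D_abs k f))"
proof -
  let ?M = "enn2real (Linf_norm (D_abs k f))"
  have "AE x in lborel. ennreal \<bar>D_abs k f x\<bar> \<le> Linf_norm (D_abs k f)"
    unfolding Linf_norm_def by (rule esssup_AE)
  then have "AE x in lborel. D_abs k f x \<le> ?M"
  proof (rule AE_mp, intro AE_I2 impI)
    fix x assume "ennreal \<bar>D_abs k f x\<bar> \<le> Linf_norm (D_abs k f)"
    then have "ennreal (D_abs k f x) \<le> ennreal ?M"
      using assms(2) by (simp add: D_abs_nonneg)
    then show "D_abs k f x \<le> ?M" by simp
  qed
  then have "AE x in lebesgue. x \<in> {x. D_abs k f x \<le> ?M}"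
    by (auto intro: AE_completion)
  moreover have "closed {x. D_abs k f x \<le> ?M}"
    using continuous_on_D_abs[OF assms(1)] by (intro closed_Collect_le) auto
  ultimately have "x \<in> {x. D_abs k f x \<le> ?M}"
    using mem_closed_if_AE_lebesgue_open[of UNIV "{x. D_abs k f x \<le> ?M}" x] by auto
  then show ?thesis by simp
qed

text \<open>This is the k-linear form D^k f(x) evaluated at (y, ..., y), the k-th derivative of f
  along the line through x in direction y. The recursion differentiates f first, so inductions
  generalize over f, and the indices come out in reversed order; the formulas for k = 2, 3, 4
  therefore use the symmetry of the derivatives.\<close>

primrec dirD :: "nat \<Rightarrow> (real^'d \<Rightarrow> real) \<Rightarrow> real^'d \<Rightarrow> real^'d \<Rightarrow> real" where
  "dirD 0 f y x = f x"
| "dirD (Suc k) f y x = (\<Sum>i\<in>UNIV. y $ i * dirD k (partial i f) y x)"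

lemma continuous_on_dirD:
  fixes f :: "real^'d \<Rightarrow> real"
  assumes "Ck k f" "continuous_on S a" "continuous_on S b"
  shows "continuous_on S (\<lambda>z. dirD k f (a z) (b z))"
  using assms(1)
proof (induction k arbitrary: f)
  case 0
  then show ?case using continuous_on_compose2[of UNIV f S b] assms by simp
next
  case (Suc k)
  then show ?case by (auto intro!: continuous_intros assms)
qed

lemma DERIV_dirD:
  "Ck (Suc k) f \<Longrightarrow> ((\<lambda>s. dirD k f y (x + s *\<^sub>R y)) has_real_derivative dirD (Suc k) f y (x + s *\<^sub>R y)) (at s)"
proof (induction k arbitrary: f)
  case 0
  then show ?case using DERIV_along_line[of f x y s] by simp
next
  case (Suc k)
  have "Ck (Suc k) (partial i f)" for i
    using Suc.prems unfolding Ck.simps(2)[of "Suc k"] by blast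
  then have "((\<lambda>s. \<Sum>i\<in>UNIV. y $ i * dirD k (partial i f) y (x + s *\<^sub>R y)) has_real_derivative
      (\<Sum>i\<in>UNIV. y $ i * dirD (Suc k) (partial i f) y (x + s *\<^sub>R y))) (at s)"
    by (intro DERIV_sum DERIV_cmult Suc.IH)
  then show ?case by simp
qed

lemma dirD_uminus: "dirD k f (- y) x = (-1) ^ k * dirD k f y x"
  by (induction k arbitrary: f) (simp_all add: sum_negf sum_distrib_left mult_ac)

text \<open>The form has d^k terms, and each coordinate of y is at most its norm.\<close>

lemma abs_dirD_le:
  fixes f :: "real^'d \<Rightarrow> real"
  assumes "\<And>is. length is = k \<Longrightarrow> \<bar>pd is f x\<bar> \<le> b"
  shows "\<bar>dirD k f y x\<bar> \<le> (real CARD('d) * norm y) ^ k * b"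
  using assms
proof (induction k arbitrary: f)
  case 0
  from 0[of "[]"] show ?case by (simp add: pd_simps)
next
  case (Suc k)
  have "\<bar>dirD k (partial i f) y x\<bar> \<le> (real CARD('d) * norm y) ^ k * b" for i
  proof (rule Suc.IH)
    fix "is" :: "'d list" assume "length is = k"
    then show "\<bar>pd is (partial i f) x\<bar> \<le> b"
      using Suc.prems[of "is @ [i]"] by (simp add: pd_simps)
  qed
  then have "\<bar>y $ i * dirD k (partial i f) y x\<bar> \<le> norm y * ((real CARD('d) * norm y) ^ k * b)" for i
    unfolding abs_mult by (intro mult_mono component_le_norm_cart) auto
  then have "\<bar>dirD (Suc k) f y x\<bar> \<le> (\<Sum>i\<in>(UNIV::'d set). norm y * ((real CARD('d) * norm y) ^ k * b))"
    unfolding dirD.simps by (intro order_trans[OF sum_abs] sum_mono)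
  then show ?case by (simp add: mult_ac)
qed

lemma abs_dirD_le_D_abs:
  "Ck k f \<Longrightarrow> \<bar>dirD k f y x\<bar> \<le> (real CARD('d) * norm y) ^ k * D_abs k (f :: real^'d \<Rightarrow> real) x"
  using abs_pd_le_D_abs by (intro abs_dirD_le) blast

lemma dirD_1: "dirD 1 f y x = (\<Sum>i\<in>UNIV. y $ i * pd [i] f x)"
  by (simp add: pd_simps)

lemma dirD_2: "Ck 2 f \<Longrightarrow> dirD 2 f y x = (\<Sum>i\<in>UNIV. \<Sum>j\<in>UNIV. pd [i, j] f x * (y $ i * y $ j))"
proof -
  assume "Ck 2 f"
  then have "partial j (partial i f) = pd [i, j] f" for i j
    by (simp add: pd_simps(1,2) partial_commute[of f j i])
  then show ?thesis by (simp add: numeral_eq_Suc sum_distrib_left mult_ac)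
qed

lemma dirD_3:
  assumes "Ck 3 f"
  shows "dirD 3 f y x = (\<Sum>i\<in>UNIV. \<Sum>j\<in>UNIV. \<Sum>k\<in>UNIV. pd [i, j, k] f x * (y $ i * y $ j * y $ k))"
proof -
  have "pd [k, j, i] f = pd [i, j, k] f" for i j k
    by (rule pd_cong_mset) (use assms in \<open>simp_all add: numeral_eq_Suc del: Ck.simps\<close>)
  then have "partial k (partial j (partial i f)) = pd [i, j, k] f" for i j k
    by (simp add: pd_simps)
  then show ?thesis by (simp add: numeral_eq_Suc sum_distrib_left mult_ac)
qed

lemma dirD_4:
  assumes "Ck 4 f"
  shows "dirD 4 f y x = (\<Sum>i\<in>UNIV. \<Sum>j\<in>UNIV. \<Sum>k\<in>UNIV. \<Sum>l\<in>UNIV. pd [i, j, k, l] f x * (y $ i * y $ j * y $ k * y $ l))"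
proof -
  have "pd [l, k, j, i] f = pd [i, j, k, l] f" for i j k l
    by (rule pd_cong_mset) (use assms in \<open>simp_all add: numeral_eq_Suc del: Ck.simps\<close>)
  then have "partial l (partial k (partial j (partial i f))) = pd [i, j, k, l] f" for i j k l
    by (simp add: pd_simps)
  then show ?thesis by (simp add: numeral_eq_Suc sum_distrib_left mult_ac)
qed

lemma dirD_2_hessian: "Ck 2 f \<Longrightarrow> dirD 2 f y x = y \<bullet> (hessian f x *v y)"
  by (simp add: dirD_2 hessian_def matrix_vector_mult_def inner_vec_def sum_distrib_left mult_ac)

lemma transpose_hessian: "Ck 2 f \<Longrightarrow> transpose (hessian f x) = hessian f x"
proof -
  assume "Ck 2 f"
  then have "pd [j, i] f = pd [i, j] f" for i j
    by (simp only: pd_simps(1,2) partial_commute[of f j i])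
  then show ?thesis by (simp add: hessian_def transpose_def vec_eq_iff)
qed

section \<open>Linear changes of variables\<close>

text \<open>The change of variables formula of the library requires a well-ordered index type; here the index
  type is merely finite.\<close>

lemma nn_integral_linear_scale:
  fixes c :: "'d::finite \<Rightarrow> real" and g :: "real^'d \<Rightarrow> ennreal"
  assumes c: "\<And>i. c i \<noteq> 0" and [measurable]: "g \<in> borel_measurable borel"
  shows "(\<integral>\<^sup>+x. g x \<partial>lborel) = \<bar>\<Prod>i\<in>UNIV. c i\<bar> * (\<integral>\<^sup>+x. g (\<chi> i. c i * x $ i) \<partial>lborel)"
proof -
  \<comment> \<open>The scaling factors are carried from the index type to the basis vectors along i
    -> \<open>axis i 1\<close>, since \<open>lborel_affine_euclidean\<close> takes one factor per
    basis vector.\<close>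
  define c' where "c' = (\<lambda>b::real^'d. \<Prod>i\<in>UNIV. if b = axis i 1 then c i else 1)"
  have c'a: "c' (axis j 1) = c j" for j
    unfolding c'_def by (simp add: axis_eq_axis prod.delta)
  have T: "0 + (\<Sum>j\<in>Basis. (c' j * (x \<bullet> j)) *\<^sub>R j) = (\<chi> i. c i * x $ i)" for x
  proof -
    have "(\<Sum>j\<in>Basis. (c' j * (x \<bullet> j)) *\<^sub>R j) = (\<Sum>i\<in>UNIV. (c' (axis i 1) * (x \<bullet> axis i 1)) *\<^sub>R axis i 1)"
      unfolding Basis_vec_def by (simp add: UNION_singleton_eq_range sum.reindex inj_on_def axis_eq_axis)
    also have "\<dots> = (\<Sum>i\<in>UNIV. (c i * x $ i) *\<^sub>R axis i 1)"
      by (simp add: c'a inner_axis)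
    also have "\<dots> = (\<chi> i. c i * x $ i)"
      by (simp add: vec_eq_iff axis_def if_distrib cong: if_cong)
    finally show ?thesis by simp
  qed
  have P: "(\<Prod>j\<in>Basis. \<bar>c' j\<bar>) = \<bar>\<Prod>i\<in>UNIV. c i\<bar>"
    unfolding Basis_vec_def
    by (simp add: UNION_singleton_eq_range prod.reindex inj_on_def axis_eq_axis c'a abs_prod)
  have c'0: "\<And>j. j \<in> Basis \<Longrightarrow> c' j \<noteq> 0"
    unfolding Basis_vec_def using c by (auto simp: c'a)
  have lb: "lborel = density (distr lborel borel (\<lambda>x. \<chi> i. c i * x $ i)) (\<lambda>_. ennreal \<bar>\<Prod>i\<in>UNIV. c i\<bar>)"
    using lborel_affine_euclidean[of c' 0, OF c'0] unfolding T P .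
  have [measurable]: "(\<lambda>x::real^'d. \<chi> i. c i * x $ i) \<in> borel_measurable borel"
    by (intro borel_measurable_continuous_onI continuous_on_vec_lambda continuous_intros)
  show ?thesis
    by (subst (1) lb) (simp add: nn_integral_density nn_integral_distr nn_integral_cmult)
qed

text \<open>A permutation of the coordinates maps boxes to boxes of the same volume, and the volumes
  of boxes determine Lebesgue measure.\<close>

lemma nn_integral_linear_swap:
  fixes m n :: "'d::finite" and g :: "real^'d \<Rightarrow> ennreal"
  assumes [measurable]: "g \<in> borel_measurable borel"
  shows "(\<integral>\<^sup>+x. g x \<partial>lborel) = (\<integral>\<^sup>+x. g (\<chi> i. x $ Transposition.transpose m n i) \<partial>lborel)"
proof -
  let ?t = "Transposition.transpose m n"
  let ?h = "\<lambda>x::real^'d. \<chi> i. x $ ?t i"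
  have [measurable]: "?h \<in> borel_measurable borel"
    by (intro borel_measurable_continuous_onI continuous_on_vec_lambda continuous_intros)
  have "lborel = distr lborel borel ?h"
  proof (rule lborel_eqI)
    fix l u :: "real^'d" assume le: "\<And>b. b \<in> Basis \<Longrightarrow> l \<bullet> b \<le> u \<bullet> b"
    have eq: "?h -` box l u = box (?h l) (?h u)"
      unfolding set_eq_iff mem_box_cart vimage_eq
      by (metis (no_types, lifting) transpose_involutory vec_lambda_beta)
    have le': "l $ i \<le> u $ i" for i
      using le[of "axis i 1"] by (simp add: inner_axis)
    have B: "(\<Prod>b\<in>Basis. (x::real^'d) \<bullet> b) = (\<Prod>i\<in>UNIV. x $ i)" for x
      unfolding Basis_vec_def
      by (simp add: UNION_singleton_eq_range prod.reindex inj_on_def axis_eq_axis inner_axis)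
    have "emeasure (distr lborel borel ?h) (box l u) = emeasure lborel (box (?h l) (?h u))"
      by (simp add: emeasure_distr eq)
    also have "\<dots> = (\<Prod>b\<in>Basis. (?h u - ?h l) \<bullet> b)"
      by (rule emeasure_lborel_box) (auto simp: Basis_vec_def inner_axis le')
    also have "(\<Prod>b\<in>Basis. (?h u - ?h l) \<bullet> b) = (\<Prod>i\<in>UNIV. (u - l) $ ?t i)"
      by (simp add: B)
    also have "\<dots> = (\<Prod>i\<in>UNIV. (u - l) $ i)"
      using prod.permute[OF permutes_swap_id[of m UNIV n], of "\<lambda>i. (u-l)$i"] by (simp add: comp_def)
    finally show "emeasure (distr lborel borel ?h) (box l u) = ennreal (\<Prod>b\<in>Basis. (u - l) \<bullet> b)"
      by (simp add: B)
  qed simp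
  then have "(\<integral>\<^sup>+x. g x \<partial>lborel) = (\<integral>\<^sup>+x. g x \<partial>distr lborel borel ?h)" by simp
  also have "\<dots> = (\<integral>\<^sup>+x. g (?h x) \<partial>lborel)" by (rule nn_integral_distr) auto
  finally show ?thesis .
qed

text \<open>With coordinate m integrated innermost and the others fixed, the shear is a translation
  in that one variable, because n differs from m.\<close>

lemma nn_integral_linear_shear:
  fixes m n :: "'d::finite" and g :: "real^'d \<Rightarrow> ennreal"
  assumes mn: "m \<noteq> n" and [measurable]: "g \<in> borel_measurable borel"
  shows "(\<integral>\<^sup>+x. g x \<partial>lborel) = (\<integral>\<^sup>+x. g (\<chi> i. if i = m then x $ m + x $ n else x $ i) \<partial>lborel)"
proof -
  let ?h = "\<lambda>x::real^'d. \<chi> i. if i = m then x $ m + x $ n else x $ i"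
  have heq: "?h x = x + (x $ n) *\<^sub>R axis m 1" for x
    by (auto simp: vec_eq_iff axis_def)
  have [measurable]: "?h \<in> borel_measurable borel"
    unfolding heq by (intro borel_measurable_continuous_onI continuous_intros)
  interpret product_sigma_finite "\<lambda>_::real^'d. lborel :: real measure" ..
  let ?B = "Basis :: (real^'d) set"
  let ?I = "?B - {axis m 1}"
  have B: "?B = insert (axis m 1) ?I" by (auto simp: Basis_vec_def)
  have fI: "finite ?I" "axis m 1 \<notin> ?I" by auto
  let ?s = "\<lambda>f. \<Sum>b\<in>?B. f b *\<^sub>R b"
  have sm[measurable]: "?s \<in> (\<Pi>\<^sub>M b\<in>?B. lborel) \<rightarrow>\<^sub>M borel" by measurable
  have lb: "(\<integral>\<^sup>+x. f x \<partial>lborel) = (\<integral>\<^sup>+x. (\<integral>\<^sup>+y. f (?s (x(axis m 1 := y))) \<partial>lborel) \<partial>(\<Pi>\<^sub>M b\<in>?I. lborel))"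
    if [measurable]: "f \<in> borel_measurable borel" for f :: "real^'d \<Rightarrow> ennreal"
  proof -
    have "(\<integral>\<^sup>+x. f x \<partial>lborel) = (\<integral>\<^sup>+x. f (?s x) \<partial>(\<Pi>\<^sub>M b\<in>?B. lborel))"
      by (subst lborel_eq[where 'a="real^'d"]) (simp add: nn_integral_distr)
    also have "\<dots> = (\<integral>\<^sup>+x. (\<integral>\<^sup>+y. f (?s (x(axis m 1 := y))) \<partial>lborel) \<partial>(\<Pi>\<^sub>M b\<in>?I. lborel))"
      using product_nn_integral_insert[OF fI, of "\<lambda>x. f (?s x)"]
      unfolding B[symmetric] by simp
    finally show ?thesis .
  qed
  have sI: "?s (x(axis m 1 := y)) = (\<Sum>b\<in>?I. x b *\<^sub>R b) + y *\<^sub>R axis m 1" for x y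
    by (subst B, subst sum.insert) (use fI in \<open>auto intro!: sum.cong\<close>)
  have inner: "(\<integral>\<^sup>+y. g (?h (?s (x(axis m 1 := y)))) \<partial>lborel) = (\<integral>\<^sup>+y. g (?s (x(axis m 1 := y))) \<partial>lborel)" for x
  proof -
    define v where "v = (\<Sum>b\<in>?I. x b *\<^sub>R b)"
    have "?h (v + y *\<^sub>R axis m 1) = v + (v $ n + y) *\<^sub>R axis m 1" for y
      using mn unfolding heq by (auto simp: axis_def algebra_simps)
    moreover have "(\<integral>\<^sup>+y. g (v + y *\<^sub>R axis m 1) \<partial>lborel) = (\<integral>\<^sup>+y. g (v + (v $ n + y) *\<^sub>R axis m 1) \<partial>lborel)"
      using nn_integral_real_affine[of "\<lambda>y. g (v + y *\<^sub>R axis m 1)" 1 "v $ n"] by simp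
    ultimately show ?thesis unfolding sI v_def[symmetric] by simp
  qed
  show ?thesis
    unfolding lb[OF assms(2)] using lb[of "\<lambda>x. g (?h x)"] inner by simp
qed

text \<open>Linear maps are generated by the elementary ones: scalings, swaps, shears and maps with
  a vanishing coordinate. Determinants multiply under composition.\<close>

lemma nn_integral_linear_image:
  fixes f :: "real^'d::finite \<Rightarrow> real^'d"
  assumes "linear f" "det (matrix f) \<noteq> 0" "g \<in> borel_measurable borel"
  shows "(\<integral>\<^sup>+x. g x \<partial>lborel) = \<bar>det (matrix f)\<bar> * (\<integral>\<^sup>+x. g (f x) \<partial>lborel)"
proof -
  \<comment> \<open>The integrand is quantified inside the induction, because a composition needs
    the hypothesis for \<open>f2\<close> at the integrand g o \<open>f1\<close>.\<close>
  have "\<forall>g\<in>borel_measurable borel. det (matrix f) \<noteq> 0 \<longrightarrow>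
     (\<integral>\<^sup>+x. g x \<partial>lborel) = \<bar>det (matrix f)\<bar> * (\<integral>\<^sup>+x. g (f x) \<partial>lborel)" (is "?P f")
  proof (rule induct_linear_elementary[OF \<open>linear f\<close>])
    fix f1 f2 :: "real^'d \<Rightarrow> real^'d"
    assume l: "linear f1" "linear f2" and P: "?P f1" "?P f2"
    show "?P (f1 \<circ> f2)"
    proof (intro ballI impI)
      fix g :: "real^'d \<Rightarrow> ennreal" assume g[measurable]: "g \<in> borel_measurable borel"
        and d: "det (matrix (f1 \<circ> f2)) \<noteq> 0"
      have m: "det (matrix (f1 \<circ> f2)) = det (matrix f1) * det (matrix f2)"
        using matrix_compose[OF l(2) l(1)] by (simp add: det_mul)
      have [measurable]: "f1 \<in> borel_measurable borel"
        using l(1) by (intro borel_measurable_continuous_onI linear_continuous_on linear_conv_bounded_linear[THEN iffD1])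
      have "(\<integral>\<^sup>+x. g x \<partial>lborel) = \<bar>det (matrix f1)\<bar> * (\<integral>\<^sup>+x. g (f1 x) \<partial>lborel)"
        using P(1) d m g by (metis mult_zero_left)
      also have "(\<integral>\<^sup>+x. g (f1 x) \<partial>lborel) = \<bar>det (matrix f2)\<bar> * (\<integral>\<^sup>+x. g (f1 (f2 x)) \<partial>lborel)"
        using P(2)[rule_format, of "\<lambda>x. g (f1 x)"] d m by force
      finally show "(\<integral>\<^sup>+x. g x \<partial>lborel) = \<bar>det (matrix (f1 \<circ> f2))\<bar> * (\<integral>\<^sup>+x. g ((f1 \<circ> f2) x) \<partial>lborel)"
        by (simp add: m abs_mult ennreal_mult mult.assoc)
    qed
  next
    \<comment> \<open>A vanishing coordinate gives a zero row, so this case contradicts the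
      determinant condition.\<close>
    fix f :: "real^'d \<Rightarrow> real^'d" and i assume "linear f" "\<And>x. f x $ i = 0"
    then have "det (matrix f) = 0"
      by (intro det_zero_row(1)[of i]) (simp add: row_def matrix_def vec_eq_iff)
    then show "?P f" by simp
  next
    fix c :: "'d \<Rightarrow> real"
    have "det (matrix (\<lambda>x. \<chi> i. c i * x $ i)) = (\<Prod>i\<in>UNIV. c i)"
      by (subst det_diagonal) (auto simp: matrix_def axis_def)
    then show "?P (\<lambda>x. \<chi> i. c i * x $ i)"
      using nn_integral_linear_scale[of c] by auto
  next
    fix m n :: 'd
    have "matrix (\<lambda>x::real^'d. \<chi> i. x $ Transposition.transpose m n i) = (\<chi> i. mat 1 $ Transposition.transpose m n i)"
      by (auto simp: matrix_def mat_def axis_def vec_eq_iff)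
    then have "\<bar>det (matrix (\<lambda>x::real^'d. \<chi> i. x $ Transposition.transpose m n i))\<bar> = 1"
      by (simp add: det_permute_rows permutes_swap_id sign_swap_id abs_mult)
    then show "?P (\<lambda>x. \<chi> i. x $ Transposition.transpose m n i)"
      using nn_integral_linear_swap[of _ m n] by auto
  next
    fix m n :: 'd assume mn: "m \<noteq> n"
    have "matrix (\<lambda>x::real^'d. \<chi> i. if i = m then x $ m + x $ n else x $ i)
      = (\<chi> k. if k = m then row m (mat 1) + 1 *s row n (mat 1) else row k (mat 1))"
      by (auto simp: matrix_def mat_def axis_def vec_eq_iff row_def)
    then have "det (matrix (\<lambda>x::real^'d. \<chi> i. if i = m then x $ m + x $ n else x $ i)) = 1"
      using det_row_operation[OF mn, of "mat 1" "1::real"] by simp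
    then show "?P (\<lambda>x. \<chi> i. if i = m then x $ m + x $ n else x $ i)"
      using nn_integral_linear_shear[OF mn] by auto
  qed
  then show ?thesis using assms by auto
qed

text \<open>An identity of measures, obtained from indicator functions, lets the substitution rule
  be used for signed integrands too.\<close>

lemma lborel_eq_distr_linear:
  fixes f :: "real^'d::finite \<Rightarrow> real^'d"
  assumes "linear f" "det (matrix f) \<noteq> 0"
  shows "lborel = density (distr lborel borel f) (\<lambda>_. ennreal \<bar>det (matrix f)\<bar>)"
proof (rule measure_eqI)
  fix X :: "(real^'d) set" assume X: "X \<in> sets lborel"
  have [measurable]: "f \<in> borel_measurable borel"
    using assms(1) by (intro borel_measurable_continuous_onI linear_continuous_on linear_conv_bounded_linear[THEN iffD1])
  have [measurable]: "X \<in> sets borel" using X by simp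
  have "emeasure lborel X = (\<integral>\<^sup>+x. indicator X x \<partial>lborel)" using X by simp
  also have "\<dots> = \<bar>det (matrix f)\<bar> * (\<integral>\<^sup>+x. indicator X (f x) \<partial>lborel)"
    by (rule nn_integral_linear_image[OF assms]) simp
  also have "\<dots> = \<bar>det (matrix f)\<bar> * (\<integral>\<^sup>+x. indicator X x \<partial>distr lborel borel f)"
    by (subst nn_integral_distr) auto
  also have "\<dots> = emeasure (density (distr lborel borel f) (\<lambda>_. ennreal \<bar>det (matrix f)\<bar>)) X"
    by (subst emeasure_density) (auto simp: nn_integral_cmult)
  finally show "emeasure lborel X = \<dots>" .
qed simp

lemma has_bochner_integral_linear_image:
  fixes f :: "real^'d::finite \<Rightarrow> real^'d" and g :: "real^'d \<Rightarrow> real"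
  assumes f: "linear f" "det (matrix f) \<noteq> 0" and [measurable]: "g \<in> borel_measurable borel"
    and "has_bochner_integral lborel (\<lambda>x. g (f x)) I"
  shows "has_bochner_integral lborel g (\<bar>det (matrix f)\<bar> * I)"
proof -
  have [measurable]: "f \<in> borel_measurable borel"
    using f(1) by (intro borel_measurable_continuous_onI linear_continuous_on linear_conv_bounded_linear[THEN iffD1])
  have "has_bochner_integral (density (distr lborel borel f) (\<lambda>_. ennreal \<bar>det (matrix f)\<bar>)) g (\<bar>det (matrix f)\<bar> * I)"
    by (rule has_bochner_integral_density)
       (use assms in \<open>auto intro!: has_bochner_integral_distr has_bochner_integral_mult_right\<close>)
  then show ?thesis
    using lborel_eq_distr_linear[OF f] by simp
qed

section \<open>Gaussian moments\<close>

definition std_gauss :: "real^'d::finite \<Rightarrow> real" where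
  "std_gauss z = (\<Prod>i\<in>UNIV. std_normal_density (z $ i))"

lemma std_gauss_eq: "std_gauss (z::real^'d::finite) = exp (- (z \<bullet> z) / 2) / (2 * pi) powr (real CARD('d) / 2)"
proof -
  have "std_gauss z = (\<Prod>i\<in>(UNIV::'d set). 1 / sqrt (2 * pi)) * exp (\<Sum>i\<in>UNIV. - (z $ i)\<^sup>2 / 2)"
    unfolding std_gauss_def std_normal_density_def by (simp only: exp_sum[OF finite] prod.distrib)
  also have "(\<Sum>i\<in>UNIV. - (z $ i)\<^sup>2 / 2) = - (z \<bullet> z) / 2"
    by (simp add: inner_vec_def power2_eq_square sum_negf sum_divide_distrib)
  also have "(\<Prod>i\<in>(UNIV::'d set). 1 / sqrt (2 * pi)) = 1 / (2 * pi) powr (real CARD('d) / 2)"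
    by (simp add: powr_half_sqrt[symmetric] powr_realpow[symmetric] powr_powr power_divide)
  finally show ?thesis by simp
qed

definition std_moment :: "nat \<Rightarrow> real" where
  "std_moment n = (\<integral>x. std_normal_density x * x ^ n \<partial>lborel)"

lemma std_moment_0: "std_moment 0 = 1"
  using integral_std_normal_moment_even[of 0] by (simp add: std_moment_def)

text \<open>Gaussian integration by parts in one variable, read off from the closed formulas for the
  moments. For n = 0 the truncated \<open>n - 1\<close> is harmless, since the factor n vanishes and
  the first moment is zero.\<close>

lemma std_moment_Suc: "std_moment (Suc n) = real n * std_moment (n - 1)"
proof (cases "even n")
  case True
  then obtain k where n: "n = 2 * k" by (elim evenE)
  have "std_moment (Suc n) = 0"
    using integral_std_normal_moment_odd[of k] by (simp add: std_moment_def n)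
  moreover have "k = 0 \<or> std_moment (n - 1) = 0"
    using integral_std_normal_moment_odd[of "k - 1"]
    by (cases k) (auto simp: std_moment_def n)
  ultimately show ?thesis by (auto simp: n)
next
  case False
  then obtain k where n: "n = 2 * k + 1" by (elim oddE)
  have "std_moment (Suc n) = fact (2 * Suc k) / (2 ^ Suc k * fact (Suc k))"
    using integral_std_normal_moment_even[of "Suc k"] by (simp add: std_moment_def n)
  moreover have "std_moment (n - 1) = fact (2 * k) / (2 ^ k * fact k)"
    using integral_std_normal_moment_even[of k] by (simp add: std_moment_def n)
  moreover have "fact (2 * Suc k) = (2 * (1 + real k)) * (real n * fact (2 * k))"
    by (simp add: n algebra_simps)
  moreover have "2 ^ Suc k * fact (Suc k) = (2 * (1 + real k)) * (2 ^ k * fact k)"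
    by simp
  ultimately have "std_moment (Suc n) = ((2 * (1 + real k)) * (real n * fact (2 * k))) / ((2 * (1 + real k)) * (2 ^ k * fact k))"
    by (simp only:)
  also have "\<dots> = real n * (fact (2 * k) / (2 ^ k * fact k))"
    by (subst mult_divide_mult_cancel_left) auto
  finally show ?thesis
    by (simp only: \<open>std_moment (n - 1) = _\<close>)
qed

definition monom_fun :: "('d::finite \<Rightarrow> nat) \<Rightarrow> real^'d \<Rightarrow> real" where
  "monom_fun \<alpha> z = (\<Prod>i\<in>UNIV. z $ i ^ \<alpha> i)"

text \<open>The integrand is a product of one-variable functions, so the integral factorizes over
  the product measure underlying \<open>lborel\<close>; \<beta> is \<alpha> indexed by basis
  vectors.\<close>

lemma has_bochner_integral_std_gauss_monom:
  "has_bochner_integral lborel (\<lambda>z::real^'d::finite. std_gauss z * monom_fun \<alpha> z) (\<Prod>i\<in>UNIV. std_moment (\<alpha> i))"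
proof -
  interpret product_sigma_finite "\<lambda>_::real^'d. lborel :: real measure" ..
  let ?B = "Basis :: (real^'d) set"
  let ?s = "\<lambda>f. \<Sum>b\<in>?B. f b *\<^sub>R b"
  define \<beta> where "\<beta> = (\<lambda>b::real^'d. \<Sum>i\<in>UNIV. if b = axis i 1 then \<alpha> i else 0)"
  have \<beta>a: "\<beta> (axis j 1) = \<alpha> j" for j
    unfolding \<beta>_def by (simp add: axis_eq_axis)
  have P: "(\<Prod>b\<in>?B. h b) = (\<Prod>i\<in>UNIV. h (axis i 1))" for h :: "real^'d \<Rightarrow> real"
    unfolding Basis_vec_def
    by (simp add: UNION_singleton_eq_range prod.reindex inj_on_def axis_eq_axis)
  let ?f = "\<lambda>b x. std_normal_density x * x ^ \<beta> b"
  have int: "integrable lborel (?f b)" for b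
    by (rule integrable_std_normal_moment)
  have comp: "?s x \<bullet> b = x b" if "b \<in> ?B" for x b
    using that by (simp add: inner_sum_left inner_Basis if_distrib cong: if_cong)
  have eq: "std_gauss (?s x) * monom_fun \<alpha> (?s x) = (\<Prod>b\<in>?B. ?f b (x b))" for x
  proof -
    have "?s x $ i = x (axis i 1)" for i
      using comp[of "axis i 1" x] by (simp add: inner_axis axis_in_Basis_iff)
    then show ?thesis
      unfolding P std_gauss_def monom_fun_def \<beta>a by (simp add: prod.distrib)
  qed
  have meas: "(\<lambda>z::real^'d. std_gauss z * monom_fun \<alpha> z) \<in> borel_measurable borel"
    unfolding std_gauss_def monom_fun_def std_normal_density_def
    by (intro borel_measurable_continuous_onI continuous_intros) auto
  have "has_bochner_integral (\<Pi>\<^sub>M b\<in>?B. lborel) (\<lambda>x. std_gauss (?s x) * monom_fun \<alpha> (?s x)) (\<Prod>b\<in>?B. integral\<^sup>L lborel (?f b))"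
    unfolding eq has_bochner_integral_iff
    using product_integrable_prod[of ?B ?f] product_integral_prod[of ?B ?f] int by simp
  moreover have "(\<Prod>b\<in>?B. integral\<^sup>L lborel (?f b)) = (\<Prod>i\<in>UNIV. std_moment (\<alpha> i))"
    unfolding P \<beta>a std_moment_def ..
  ultimately show ?thesis
    by (subst lborel_eq[where 'a="real^'d"]) (auto intro!: has_bochner_integral_distr meas)
qed

section \<open>Integration by parts and Wick's formula for the standard Gaussian\<close>

lemma monom_fun_Suc: "z $ a * monom_fun \<alpha> z = monom_fun (\<alpha>(a := Suc (\<alpha> a))) z"
  unfolding monom_fun_def by (subst (1 2) prod.remove[of UNIV a]) auto

text \<open>Linear forms rather than coordinates: the substitution y = S z that normalizes a general
  Gaussian turns each coordinate of y into a linear form in z.\<close>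

definition lin_prod :: "(real^'d::finite) list \<Rightarrow> real^'d \<Rightarrow> real" where
  "lin_prod ws z = (\<Prod>w\<leftarrow>ws. w \<bullet> z)"

lemma lin_prod_simps [simp]: "lin_prod [] z = 1" "lin_prod (w # ws) z = (w \<bullet> z) * lin_prod ws z"
  "lin_prod (us @ ws) z = lin_prod us z * lin_prod ws z"
  by (simp_all add: lin_prod_def)

lemma inner_eq_sum: "(w::real^'d::finite) \<bullet> z = (\<Sum>b\<in>UNIV. w $ b * z $ b)"
  by (simp add: inner_vec_def)

text \<open>The monomial serves as an accumulator. Expanding one linear form multiplies it by a
  coordinate, so the induction ends at pure monomials.\<close>

lemma integrable_std_gauss_lin_prod_monom:
  "integrable lborel (\<lambda>z. std_gauss z * (lin_prod ws z * monom_fun \<alpha> z))"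
proof (induction ws arbitrary: \<alpha>)
  case Nil
  show ?case using has_bochner_integral_std_gauss_monom[of \<alpha>]
    by (simp add: has_bochner_integral_iff)
next
  case (Cons w ws)
  have "std_gauss z * (lin_prod (w # ws) z * monom_fun \<alpha> z) =
    (\<Sum>b\<in>UNIV. w $ b * (std_gauss z * (lin_prod ws z * monom_fun (\<alpha>(b := Suc (\<alpha> b))) z)))" for z
    unfolding monom_fun_Suc[symmetric] by (simp add: inner_eq_sum sum_distrib_left sum_distrib_right mult_ac)
  then show ?case using Cons.IH by simp
qed

text \<open>The directional derivative of \<open>lin_prod ws\<close> along v, written out by the
  product rule.\<close>

primrec lin_prod_deriv :: "real^'d::finite \<Rightarrow> (real^'d) list \<Rightarrow> real^'d \<Rightarrow> real" where
  "lin_prod_deriv v [] z = 0"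
| "lin_prod_deriv v (w # ws) z = (v \<bullet> w) * lin_prod ws z + (w \<bullet> z) * lin_prod_deriv v ws z"

lemma integrable_std_gauss_lin_prod_deriv_monom:
  "integrable lborel (\<lambda>z. std_gauss z * (lin_prod_deriv v ws z * monom_fun \<alpha> z))"
proof (induction ws arbitrary: \<alpha>)
  case Nil
  show ?case by simp
next
  case (Cons w ws)
  have eq: "std_gauss z * (lin_prod_deriv v (w # ws) z * monom_fun \<alpha> z) =
    (v \<bullet> w) * (std_gauss z * (lin_prod ws z * monom_fun \<alpha> z)) +
    (\<Sum>b\<in>UNIV. w $ b * (std_gauss z * (lin_prod_deriv v ws z * monom_fun (\<alpha>(b := Suc (\<alpha> b))) z)))" for z
    unfolding monom_fun_Suc[symmetric] by (simp add: inner_eq_sum sum_distrib_left sum_distrib_right algebra_simps)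
  show ?case
    unfolding eq by (intro Bochner_Integration.integrable_add Bochner_Integration.integrable_sum integrable_mult_right Cons.IH integrable_std_gauss_lin_prod_monom)
qed

text \<open>Stein's identity E[z_a f] = E[d_a f] for f a product of linear forms and a monomial. No
  limit or boundary term is involved: for monomials it is the moment recursion, and expanding the
  forms one at a time reduces the general case to it.\<close>

lemma stein_std_gauss_monom:
  "(\<integral>z. std_gauss z * (z $ a * (lin_prod ws z * monom_fun \<alpha> z)) \<partial>lborel) =
   (\<integral>z. std_gauss z * (lin_prod_deriv (axis a 1) ws z * monom_fun \<alpha> z) \<partial>lborel) +
   real (\<alpha> a) * (\<integral>z. std_gauss z * (lin_prod ws z * monom_fun (\<alpha>(a := \<alpha> a - 1)) z) \<partial>lborel)"
proof (induction ws arbitrary: \<alpha>)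
  case Nil
  have "(\<Prod>i\<in>UNIV. std_moment ((\<alpha>(a := Suc (\<alpha> a))) i)) = real (\<alpha> a) * (\<Prod>i\<in>UNIV. std_moment ((\<alpha>(a := \<alpha> a - 1)) i))"
    by (subst (1 2) prod.remove[of UNIV a]) (auto simp: std_moment_Suc)
  then show ?case
    unfolding has_bochner_integral_std_gauss_monom[THEN has_bochner_integral_integral_eq, symmetric]
    by (simp add: monom_fun_Suc fun_upd_def)
next
  case (Cons w ws)
  note int = integrable_std_gauss_lin_prod_monom integrable_std_gauss_lin_prod_deriv_monom
  let ?up = "\<lambda>b. \<alpha>(b := Suc (\<alpha> b))"
  have int': "integrable lborel (\<lambda>z. std_gauss z * (z $ a * (lin_prod ws z * monom_fun \<beta> z)))" for \<beta>
    using int(1)[of ws "\<beta>(a := Suc (\<beta> a))"] unfolding monom_fun_Suc[symmetric] by (simp add: mult_ac)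
  have "(\<integral>z. std_gauss z * (z $ a * (lin_prod (w # ws) z * monom_fun \<alpha> z)) \<partial>lborel) =
    (\<integral>z. (\<Sum>b\<in>UNIV. w $ b * (std_gauss z * (z $ a * (lin_prod ws z * monom_fun (?up b) z)))) \<partial>lborel)"
    unfolding monom_fun_Suc[symmetric]
    by (simp add: inner_eq_sum sum_distrib_left sum_distrib_right mult_ac)
  also have "\<dots> = (\<Sum>b\<in>UNIV. w $ b * (\<integral>z. std_gauss z * (z $ a * (lin_prod ws z * monom_fun (?up b) z)) \<partial>lborel))"
    using int' by simp
  also have "\<dots> = (\<Sum>b\<in>UNIV. w $ b * ((\<integral>z. std_gauss z * (lin_prod_deriv (axis a 1) ws z * monom_fun (?up b) z) \<partial>lborel) +
      real (?up b a) * (\<integral>z. std_gauss z * (lin_prod ws z * monom_fun ((?up b)(a := ?up b a - 1)) z) \<partial>lborel)))"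
    unfolding Cons.IH ..
  also have "\<dots> = (\<Sum>b\<in>UNIV. w $ b * (\<integral>z. std_gauss z * (lin_prod_deriv (axis a 1) ws z * monom_fun (?up b) z) \<partial>lborel))
     + (\<Sum>b\<in>UNIV. w $ b * (real (?up b a) * (\<integral>z. std_gauss z * (lin_prod ws z * monom_fun ((?up b)(a := ?up b a - 1)) z) \<partial>lborel)))"
    by (simp add: algebra_simps sum.distrib)
  \<comment> \<open>In the raised monomial the exponent at a is \<open>\<alpha> a\<close>, plus one
    if b = a. The extra unit gives the term in which the derivative hits the form w; the rest is the
    derivative of the original monomial.\<close>
  also have "(\<Sum>b\<in>UNIV. w $ b * (real (?up b a) * (\<integral>z. std_gauss z * (lin_prod ws z * monom_fun ((?up b)(a := ?up b a - 1)) z) \<partial>lborel)))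
     = (\<Sum>b\<in>UNIV. (if b = a then w $ a * (\<integral>z. std_gauss z * (lin_prod ws z * monom_fun \<alpha> z) \<partial>lborel) else 0)
         + real (\<alpha> a) * (w $ b * (\<integral>z. std_gauss z * (lin_prod ws z * (z $ b * monom_fun (\<alpha>(a := \<alpha> a - 1)) z)) \<partial>lborel)))"
  proof (intro sum.cong refl)
    fix b
    let ?J = "\<integral>z. std_gauss z * (lin_prod ws z * monom_fun \<alpha> z) \<partial>lborel"
    show "w $ b * (real (?up b a) * (\<integral>z. std_gauss z * (lin_prod ws z * monom_fun ((?up b)(a := ?up b a - 1)) z) \<partial>lborel))
      = (if b = a then w $ a * ?J else 0)
         + real (\<alpha> a) * (w $ b * (\<integral>z. std_gauss z * (lin_prod ws z * (z $ b * monom_fun (\<alpha>(a := \<alpha> a - 1)) z)) \<partial>lborel))"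
    proof (cases "b = a")
      case True
      have "real (\<alpha> a) * (\<integral>z. std_gauss z * (lin_prod ws z * (z $ a * monom_fun (\<alpha>(a := \<alpha> a - 1)) z)) \<partial>lborel) = real (\<alpha> a) * ?J"
        by (cases "\<alpha> a = 0") (simp_all add: monom_fun_Suc)
      then show ?thesis using True by (auto simp add: algebra_simps)
    next
      case False
      then have "(?up b)(a := ?up b a - 1) = (\<alpha>(a := \<alpha> a - 1))(b := Suc ((\<alpha>(a := \<alpha> a - 1)) b))"
        by auto
      then show ?thesis using False unfolding monom_fun_Suc by simp
    qed
  qed
  also have "\<dots> = w $ a * (\<integral>z. std_gauss z * (lin_prod ws z * monom_fun \<alpha> z) \<partial>lborel)
         + real (\<alpha> a) * (\<Sum>b\<in>UNIV. w $ b * (\<integral>z. std_gauss z * (lin_prod ws z * (z $ b * monom_fun (\<alpha>(a := \<alpha> a - 1)) z)) \<partial>lborel))"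
    by (simp add: sum.distrib sum_distrib_left)
  also have "(\<Sum>b\<in>UNIV. w $ b * (\<integral>z. std_gauss z * (lin_prod ws z * (z $ b * monom_fun (\<alpha>(a := \<alpha> a - 1)) z)) \<partial>lborel))
      = (\<integral>z. (\<Sum>b\<in>UNIV. w $ b * (std_gauss z * (lin_prod ws z * (z $ b * monom_fun (\<alpha>(a := \<alpha> a - 1)) z)))) \<partial>lborel)"
    unfolding monom_fun_Suc by (subst Bochner_Integration.integral_sum) (auto intro!: integrable_mult_right int(1))
  also have "\<dots> = (\<integral>z. std_gauss z * (lin_prod (w # ws) z * monom_fun (\<alpha>(a := \<alpha> a - 1)) z) \<partial>lborel)"
    by (simp add: inner_eq_sum sum_distrib_left sum_distrib_right mult_ac)
  finally have 1: "(\<integral>z. std_gauss z * (z $ a * (lin_prod (w # ws) z * monom_fun \<alpha> z)) \<partial>lborel) =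
     (\<Sum>b\<in>UNIV. w $ b * (\<integral>z. std_gauss z * (lin_prod_deriv (axis a 1) ws z * monom_fun (?up b) z) \<partial>lborel))
     + w $ a * (\<integral>z. std_gauss z * (lin_prod ws z * monom_fun \<alpha> z) \<partial>lborel)
     + real (\<alpha> a) * (\<integral>z. std_gauss z * (lin_prod (w # ws) z * monom_fun (\<alpha>(a := \<alpha> a - 1)) z) \<partial>lborel)"
    by (simp only: add.assoc)
  have "(\<integral>z. std_gauss z * (lin_prod_deriv (axis a 1) (w # ws) z * monom_fun \<alpha> z) \<partial>lborel)
     = (\<integral>z. w $ a * (std_gauss z * (lin_prod ws z * monom_fun \<alpha> z))
        + (\<Sum>b\<in>UNIV. w $ b * (std_gauss z * (lin_prod_deriv (axis a 1) ws z * monom_fun (?up b) z))) \<partial>lborel)"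
    unfolding monom_fun_Suc[symmetric]
    by (simp add: inner_axis' inner_eq_sum[of w] sum_distrib_left sum_distrib_right algebra_simps)
  also have "\<dots> = w $ a * (\<integral>z. std_gauss z * (lin_prod ws z * monom_fun \<alpha> z) \<partial>lborel)
        + (\<Sum>b\<in>UNIV. w $ b * (\<integral>z. std_gauss z * (lin_prod_deriv (axis a 1) ws z * monom_fun (?up b) z) \<partial>lborel))"
    (is "integral\<^sup>L lborel (\<lambda>z. ?F z + (\<Sum>b\<in>UNIV. ?G b z)) = _")
  proof -
    have "integrable lborel ?F" "\<And>b. integrable lborel (?G b)"
      by (rule integrable_mult_right, rule int)+
    then have "integral\<^sup>L lborel (\<lambda>z. ?F z + (\<Sum>b\<in>UNIV. ?G b z)) = integral\<^sup>L lborel ?F + (\<Sum>b\<in>UNIV. integral\<^sup>L lborel (?G b))"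
      by (subst Bochner_Integration.integral_add) (simp_all add: Bochner_Integration.integral_sum del: integrable_mult_right_iff integral_mult_right_zero)
    then show ?thesis by (simp only: integral_mult_right_zero)
  qed
  finally show ?case unfolding 1 by (simp only: add_ac)
qed

lemma monom_fun_0 [simp]: "monom_fun (\<lambda>_. 0) z = 1"
  by (simp add: monom_fun_def)

definition gauss_ex :: "(real^'d::finite) list \<Rightarrow> real" where
  "gauss_ex ws = (\<integral>z. std_gauss z * lin_prod ws z \<partial>lborel)"

text \<open>Contractions of v with each entry of the last list in turn. The argument
  \<open>us\<close> keeps the entries already passed, so that the uncontracted factors can be
  reassembled in their order.\<close>

primrec wick_sum :: "real^'d::finite \<Rightarrow> (real^'d) list \<Rightarrow> (real^'d) list \<Rightarrow> real" where
  "wick_sum v us [] = 0"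
| "wick_sum v us (w # ws) = (v \<bullet> w) * gauss_ex (us @ ws) + wick_sum v (us @ [w]) ws"

lemma lin_prod_deriv_axis: "lin_prod_deriv v ws z = (\<Sum>a\<in>UNIV. v $ a * lin_prod_deriv (axis a 1) ws z)"
  by (induction ws)
     (simp_all add: inner_axis' inner_eq_sum[of v] sum.distrib sum_distrib_left sum_distrib_right algebra_simps)

lemma integrable_std_gauss_lin_prod: "integrable lborel (\<lambda>z. std_gauss z * lin_prod ws z)"
  using integrable_std_gauss_lin_prod_monom[of ws "\<lambda>_. 0"] by simp

lemma integrable_std_gauss_lin_prod_deriv:
  "integrable lborel (\<lambda>z. std_gauss z * (lin_prod us z * lin_prod_deriv v ws z))"
proof (induction ws arbitrary: us)
  case (Cons w ws)
  have eq: "std_gauss z * (lin_prod us z * lin_prod_deriv v (w # ws) z) =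
    (v \<bullet> w) * (std_gauss z * lin_prod (us @ ws) z) + std_gauss z * (lin_prod (us @ [w]) z * lin_prod_deriv v ws z)" for z
    by (simp add: algebra_simps)
  show ?case
    unfolding eq by (intro Bochner_Integration.integrable_add integrable_mult_right Cons.IH integrable_std_gauss_lin_prod)
qed simp

lemma integral_lin_prod_deriv:
  "(\<integral>z. std_gauss z * (lin_prod us z * lin_prod_deriv v ws z) \<partial>lborel) = wick_sum v us ws"
proof (induction ws arbitrary: us)
  case (Cons w ws)
  have eq: "std_gauss z * (lin_prod us z * lin_prod_deriv v (w # ws) z) =
    (v \<bullet> w) * (std_gauss z * lin_prod (us @ ws) z) + std_gauss z * (lin_prod (us @ [w]) z * lin_prod_deriv v ws z)" for z
    by (simp add: algebra_simps)
  then show ?case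
    using Cons.IH[of "us @ [w]"] integrable_std_gauss_lin_prod[of "us @ ws"] integrable_std_gauss_lin_prod_deriv[of "us @ [w]" v ws]
    by (simp add: gauss_ex_def)
qed simp

lemma gauss_ex_Nil: "gauss_ex ([] :: (real^'d::finite) list) = 1"
  using has_bochner_integral_std_gauss_monom[of "\<lambda>_::'d. 0", THEN has_bochner_integral_integral_eq]
  by (simp add: gauss_ex_def std_moment_0)

text \<open>Stein's identity for the coordinates extends by linearity to the form given by v; its
  derivative term is the sum of all contractions with v. Iterating this is Wick's formula.\<close>

lemma gauss_ex_Cons: "gauss_ex (v # ws) = wick_sum v [] ws"
proof -
  have int: "integrable lborel (\<lambda>z. std_gauss z * (z $ a * lin_prod ws z))" for a
    using integrable_std_gauss_lin_prod[of "axis a 1 # ws"] by (simp add: inner_axis')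
  have int': "integrable lborel (\<lambda>z. std_gauss z * (lin_prod_deriv (axis a 1) ws z))" for a
    using integrable_std_gauss_lin_prod_deriv[of "[]"] by simp
  have "gauss_ex (v # ws) = (\<integral>z. (\<Sum>a\<in>UNIV. v $ a * (std_gauss z * (z $ a * lin_prod ws z))) \<partial>lborel)"
    unfolding gauss_ex_def by (simp add: inner_eq_sum sum_distrib_left sum_distrib_right mult_ac)
  also have "\<dots> = (\<Sum>a\<in>UNIV. v $ a * (\<integral>z. std_gauss z * (z $ a * lin_prod ws z) \<partial>lborel))"
    using int by simp
  also have "\<dots> = (\<Sum>a\<in>UNIV. v $ a * (\<integral>z. std_gauss z * lin_prod_deriv (axis a 1) ws z \<partial>lborel))"
    using stein_std_gauss_monom[of _ ws "\<lambda>_. 0"] by simp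
  also have "\<dots> = (\<integral>z. (\<Sum>a\<in>UNIV. v $ a * (std_gauss z * lin_prod_deriv (axis a 1) ws z)) \<partial>lborel)"
    using int' by simp
  also have "\<dots> = (\<integral>z. std_gauss z * (lin_prod [] z * lin_prod_deriv v ws z) \<partial>lborel)"
    unfolding lin_prod_deriv_axis[of v] by (simp add: sum_distrib_left mult_ac)
  finally show ?thesis by (simp only: integral_lin_prod_deriv)
qed


text \<open>Each induction step is one Gram-Schmidt step for the inner product given by A. The
  family is a set of prescribed size; a bijection with the index type later makes its members the
  columns of a matrix.\<close>

lemma ex_orthonormal_family:
  fixes A :: "real^'d::finite^'d"
  assumes sym: "\<And>x y. x \<bullet> (A *v y) = y \<bullet> (A *v x)" and pos: "\<And>x. x \<noteq> 0 \<Longrightarrow> x \<bullet> (A *v x) > 0"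
    and "k \<le> CARD('d)"
  shows "\<exists>B. finite B \<and> card B = k \<and> (\<forall>x\<in>B. \<forall>y\<in>B. x \<bullet> (A *v y) = (if x = y then 1 else 0))"
  using assms(3)
proof (induction k)
  case 0
  then show ?case by (intro exI[of _ "{}"]) simp
next
  case (Suc k)
  then obtain B where B: "finite B" "card B = k"
    and on: "\<And>x y. x \<in> B \<Longrightarrow> y \<in> B \<Longrightarrow> x \<bullet> (A *v y) = (if x = y then 1 else 0)"
    by auto
  have "dim (span B) \<le> card B"
    using B(1) by (simp add: dim_le_card')
  also have "\<dots> < dim (UNIV :: (real^'d) set)"
    using B Suc.prems by simp
  finally have "span B \<noteq> UNIV" by (metis less_irrefl)
  then obtain w where w: "w \<notin> span B" by auto
  define v where "v = w - (\<Sum>b\<in>B. (b \<bullet> (A *v w)) *\<^sub>R b)"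
  have "v \<noteq> 0"
    using w span_sum[of B "\<lambda>b. (b \<bullet> (A *v w)) *\<^sub>R b" B] by (auto simp: v_def span_base span_scale)
  then have q: "v \<bullet> (A *v v) > 0" by (rule pos)
  have bv: "b \<bullet> (A *v v) = 0" if "b \<in> B" for b
  proof -
    have "b \<bullet> (A *v v) = v \<bullet> (A *v b)" by (rule sym)
    also have "\<dots> = w \<bullet> (A *v b) - (\<Sum>c\<in>B. (c \<bullet> (A *v w)) * (c \<bullet> (A *v b)))"
      by (simp add: v_def inner_diff_left inner_sum_left)
    also have "(\<Sum>c\<in>B. (c \<bullet> (A *v w)) * (c \<bullet> (A *v b))) = (\<Sum>c\<in>B. if c = b then b \<bullet> (A *v w) else 0)"
      using that by (intro sum.cong) (auto simp: on)
    also have "\<dots> = b \<bullet> (A *v w)"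
      using that B by simp
    finally show ?thesis using sym[of b w] by simp
  qed
  define e where "e = v /\<^sub>R sqrt (v \<bullet> (A *v v))"
  have "sqrt (v \<bullet> (A *v v)) * sqrt (v \<bullet> (A *v v)) = v \<bullet> (A *v v)" "sqrt (v \<bullet> (A *v v)) > 0"
    using q by simp_all
  then have ee: "e \<bullet> (A *v e) = 1"
    by (simp add: e_def matrix_vector_mult_scaleR field_simps)
  have be: "b \<bullet> (A *v e) = 0" "e \<bullet> (A *v b) = 0" if "b \<in> B" for b
    using bv[OF that] sym[of e b] by (simp_all add: e_def matrix_vector_mult_scaleR)
  have "e \<notin> B" using be ee by fastforce
  then show ?case
    using B on ee be by (intro exI[of _ "insert e B"]) (auto simp: card_insert_if)
qed

lemma ex_congruent_to_identity:
  fixes A :: "real^'d::finite^'d"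
  assumes sym: "transpose A = A" and pos: "\<And>x. x \<noteq> 0 \<Longrightarrow> x \<bullet> (A *v x) > 0"
  obtains S :: "real^'d^'d" where "transpose S ** A ** S = mat 1"
proof -
  have s: "x \<bullet> (A *v y) = y \<bullet> (A *v x)" for x y
    by (metis dot_lmul_matrix inner_commute sym transpose_matrix_vector)
  obtain B where B: "finite B" "card B = CARD('d)"
    and on: "\<And>x y. x \<in> B \<Longrightarrow> y \<in> B \<Longrightarrow> x \<bullet> (A *v y) = (if x = y then 1 else 0)"
    using ex_orthonormal_family[OF s pos, of "CARD('d)"] by auto
  obtain h where h: "bij_betw h (UNIV :: 'd set) B"
    using finite_same_card_bij[of "UNIV :: 'd set" B] B by auto
  define S where "S = (\<chi> i j. h j $ i)"
  have "(transpose S ** A ** S) $ j $ k = mat 1 $ j $ k" for j k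
  proof -
    have "(transpose S ** A ** S) $ j $ k = (transpose S ** (A ** S)) $ j $ k"
      by (simp add: matrix_mul_assoc)
    also have "\<dots> = h j \<bullet> (A *v h k)"
      by (simp add: matrix_matrix_mult_def matrix_vector_mult_def inner_vec_def transpose_def S_def)
    also have "\<dots> = (if h j = h k then 1 else 0)"
      using h by (intro on) (auto simp: bij_betw_def)
    also have "\<dots> = mat 1 $ j $ k"
      using h by (auto simp: bij_betw_def mat_def inj_on_def)
    finally show ?thesis .
  qed
  then have "transpose S ** A ** S = mat 1" by (simp add: vec_eq_iff)
  then show thesis by (rule that)
qed

section \<open>Moments of a general Gaussian\<close>

definition quad_gauss :: "real^'d::finite^'d \<Rightarrow> real^'d \<Rightarrow> real" where
  "quad_gauss A y = exp (- (y \<bullet> (A *v y)) / 2) / (2 * pi) powr (real CARD('d) / 2)"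

definition coord_prod :: "'d::finite list \<Rightarrow> real^'d \<Rightarrow> real" where
  "coord_prod is y = (\<Prod>i\<leftarrow>is. y $ i)"

text \<open>The analogue of \<open>wick_sum\<close> in which inner products are replaced by
  covariances and the lists contain coordinate indices.\<close>

primrec wick_pairing :: "('d \<Rightarrow> 'd \<Rightarrow> real) \<Rightarrow> ('d list \<Rightarrow> real) \<Rightarrow> 'd \<Rightarrow> 'd list \<Rightarrow> 'd list \<Rightarrow> real" where
  "wick_pairing g E i us [] = 0"
| "wick_pairing g E i us (j # js) = g i j * E (us @ js) + wick_pairing g E i (us @ [j]) js"

text \<open>If S^T A S is the identity, then y = S z turns the weight into the standard Gaussian
  with Jacobian |det S| = 1/sqrt(det A). Moreover the inverse of A is S S^T, so covariances are
  inner products of rows of S and the Wick recursion carries over. Only this recursion is exported;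
  the moments themselves remain abstract.\<close>

theorem isserlis:
  fixes A :: "real^'d::finite^'d"
  assumes sym: "transpose A = A" and pos: "\<And>x. x \<noteq> 0 \<Longrightarrow> x \<bullet> (A *v x) > 0"
  defines "g \<equiv> (\<lambda>i j. matrix_inv A $ i $ j)"
  shows "\<exists>E. E [] = 1 \<and> (\<forall>i js. E (i # js) = wick_pairing g E i [] js) \<and>
      (\<forall>js. has_bochner_integral lborel (\<lambda>y. quad_gauss A y * coord_prod js y) (E js / sqrt (det A)))"
    and "det A > 0" and "g i j = g j i"
proof -
  obtain S :: "real^'d^'d" where S: "transpose S ** A ** S = mat 1"
    using ex_congruent_to_identity[OF sym pos] by blast
  have "det (transpose S) * det A * det S = 1"
    using arg_cong[OF S, of det] by (simp add: det_mul)
  then have dS: "(det S)\<^sup>2 * det A = 1" by (simp add: power2_eq_square mult_ac)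
  then have "det S \<noteq> 0" by auto
  then have dA: "det A > 0"
    using dS by (metis mult_less_0_iff not_less_iff_gr_or_eq zero_less_one zero_less_power2 mult_zero_right)
  have adS: "\<bar>det S\<bar> = 1 / sqrt (det A)"
  proof -
    have "(\<bar>det S\<bar> * sqrt (det A))\<^sup>2 = 1"
      using dS dA by (simp add: power_mult_distrib)
    then have "\<bar>det S\<bar> * sqrt (det A) = 1"
      using dA by (smt (verit) mult_nonneg_nonneg power2_eq_1_iff real_sqrt_ge_zero)
    then show ?thesis using dA by (simp add: field_simps)
  qed
  have inv: "S ** transpose S ** A = mat 1"
    using S by (metis matrix_left_right_inverse matrix_mul_assoc)
  have "A ** (S ** transpose S) = mat 1"
    using inv matrix_left_right_inverse by blast
  \<comment> \<open>\<open>matrix_inv\<close> chooses a two-sided inverse, so one must be exhibited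
    before the choice has any property; S S^T is one.\<close>
  have "A ** matrix_inv A = mat 1"
    unfolding matrix_inv_def
    by (rule someI2[of _ "S ** transpose S"]) (use inv \<open>A ** (S ** transpose S) = mat 1\<close> in auto)
  then have Ainv: "matrix_inv A = S ** transpose S"
    using inv by (metis matrix_mul_assoc matrix_mul_lid matrix_mul_rid)
  define s where "s i = row i S" for i
  have gs: "g i j = s i \<bullet> s j" for i j
    unfolding g_def Ainv s_def by (simp add: matrix_matrix_mult_def transpose_def row_def inner_vec_def)
  have Si: "(S *v z) $ i = s i \<bullet> z" for z i
    by (simp add: matrix_vector_mult_def s_def row_def inner_vec_def)
  define E where "E js = gauss_ex (map s js)" for js
  have qS: "(S *v z) \<bullet> (A *v (S *v z)) = z \<bullet> z" for z
  proof -
    have "(S *v z) \<bullet> (A *v (S *v z)) = z \<bullet> ((transpose S ** A ** S) *v z)"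
    proof -
      have "z \<bullet> ((transpose S ** A ** S) *v z) = ((A *v (S *v z)) v* S) \<bullet> z"
        unfolding matrix_vector_mul_assoc[symmetric] transpose_matrix_vector by (rule inner_commute)
      also have "\<dots> = (A *v (S *v z)) \<bullet> (S *v z)" by (rule dot_lmul_matrix)
      finally show ?thesis by (simp only: inner_commute)
    qed
    then show ?thesis by (simp add: S)
  qed
  have int: "has_bochner_integral lborel (\<lambda>y. quad_gauss A y * coord_prod js y) (E js / sqrt (det A))" for js
  proof -
    have ms: "matrix (\<lambda>z. S *v z) = S" by (rule matrix_of_matrix_vector_mul)
    have "has_bochner_integral lborel (\<lambda>z. std_gauss z * lin_prod (map s js) z) (E js)"
      unfolding E_def gauss_ex_def has_bochner_integral_iff using integrable_std_gauss_lin_prod by blast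
    moreover have "std_gauss z * lin_prod (map s js) z = quad_gauss A (S *v z) * coord_prod js (S *v z)" for z
      by (simp add: std_gauss_eq quad_gauss_def qS lin_prod_def coord_prod_def Si comp_def)
    ultimately have "has_bochner_integral lborel (\<lambda>z. quad_gauss A (S *v z) * coord_prod js (S *v z)) (E js)"
      by simp
    moreover have "(\<lambda>y. quad_gauss A y * coord_prod js y) \<in> borel_measurable borel"
    proof -
      have "continuous_on UNIV (coord_prod js)"
        unfolding coord_prod_def by (induction js) (auto intro!: continuous_intros)
      then show ?thesis
        unfolding quad_gauss_def
        by (intro borel_measurable_continuous_onI continuous_intros matrix_vector_mult_linear_continuous_on) auto
    qed
    ultimately have "has_bochner_integral lborel (\<lambda>y. quad_gauss A y * coord_prod js y) (\<bar>det S\<bar> * E js)"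
      using has_bochner_integral_linear_image[of "\<lambda>z. S *v z", OF matrix_vector_mul_linear, unfolded ms] \<open>det S \<noteq> 0\<close>
      by blast
    then show ?thesis unfolding adS by simp
  qed
  have "wick_sum (s i) (map s us) (map s js) = wick_pairing g E i us js" for i us js
  proof (induction js arbitrary: us)
    case (Cons j js)
    show ?case using Cons.IH[of "us @ [j]"] by (simp add: gs E_def)
  qed simp
  from this[of _ "[]"] have "E (i # js) = wick_pairing g E i [] js" for i js
    by (simp add: E_def gauss_ex_Cons)
  moreover have "E [] = 1" by (simp add: E_def gauss_ex_Nil)
  ultimately show "\<exists>E. E [] = 1 \<and> (\<forall>i js. E (i # js) = wick_pairing g E i [] js) \<and>
      (\<forall>js. has_bochner_integral lborel (\<lambda>y. quad_gauss A y * coord_prod js y) (E js / sqrt (det A)))"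
    using int by blast
  show "det A > 0" "g i j = g j i" using dA by (simp_all add: gs inner_commute)
qed

section \<open>Taylor expansion of the phase along a ray\<close>

text \<open>If \<open>f\<close> and \<open>f'\<close> vanish at 0 and \<open>h\<close> is the derivative of order \<open>k + 2\<close> of \<open>f\<close>, this is the \<open>k\<close>-th
  derivative of \<open>f s / s\<^sup>2\<close>.\<close>

definition hat_integral :: "nat \<Rightarrow> (real \<Rightarrow> real) \<Rightarrow> real \<Rightarrow> real" where
  "hat_integral k h s = integral {0..1} (\<lambda>t. (1 - t) * t ^ k * h (t * s))"

text \<open>Differentiation under the integral sign; the inner derivative of
  \<open>h (t * s)\<close> is the factor t that raises k.\<close>

lemma DERIV_hat_integral:
  assumes h: "\<And>s. (h has_real_derivative h' s) (at s)" and h': "continuous_on UNIV h'"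
  shows "(hat_integral k h has_real_derivative hat_integral (Suc k) h' s) (at s)"
proof -
  have ch: "continuous_on UNIV h"
    using h by (meson DERIV_isCont continuous_at_imp_continuous_on)
  have "((\<lambda>s. integral (cbox 0 1) (\<lambda>t. (1 - t) * t ^ k * h (t * s))) has_field_derivative
         integral (cbox 0 1) (\<lambda>t. (1 - t) * t ^ k * (h' (t * s) * t))) (at s within UNIV)"
  proof (rule leibniz_rule_field_derivative)
    fix s t :: real
    show "((\<lambda>s. (1 - t) * t ^ k * h (t * s)) has_real_derivative (1 - t) * t ^ k * (h' (t * s) * t)) (at s within UNIV)"
      by (intro DERIV_cmult DERIV_chain2[of h]) (auto intro!: h derivative_eq_intros)
    show "(\<lambda>t. (1 - t) * t ^ k * h (t * s)) integrable_on cbox 0 1"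
      by (intro integrable_continuous continuous_intros continuous_on_compose2[OF ch]) auto
    show "continuous_on (UNIV \<times> cbox 0 1) (\<lambda>(s, t). (1 - t) * t ^ k * (h' (t * s) * t))"
      unfolding case_prod_beta by (intro continuous_intros continuous_on_compose2[OF h']) auto
  qed auto
  then show ?thesis
    unfolding hat_integral_def by (simp add: mult_ac)
qed

lemma abs_hat_integral_le:
  assumes h: "continuous_on UNIV h" and b: "\<And>s. \<bar>h s\<bar> \<le> b"
  shows "\<bar>hat_integral k h s\<bar> \<le> b"
proof -
  have "norm (integral {0..1} (\<lambda>t. (1 - t) * t ^ k * h (t * s))) \<le> b * (1 - 0)"
  proof (rule integral_bound)
    show "continuous_on {0..1} (\<lambda>t. (1 - t) * t ^ k * h (t * s))"
      by (intro continuous_intros continuous_on_compose2[OF h]) auto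
    fix t :: real assume t: "t \<in> {0..1}"
    then have "\<bar>(1 - t) * t ^ k\<bar> \<le> 1 * 1"
      unfolding abs_mult by (intro mult_mono) (auto simp: power_le_one)
    then show "norm ((1 - t) * t ^ k * h (t * s)) \<le> b"
      using mult_mono[of "\<bar>(1 - t) * t ^ k\<bar>" 1 "\<bar>h (t * s)\<bar>" b] b by (simp add: abs_mult)
  qed simp
  then show ?thesis by (simp add: hat_integral_def)
qed

lemma hat_integral_0: "hat_integral k h 0 = h 0 / (real (k + 1) * real (k + 2))"
proof -
  have "((\<lambda>t. (1 - t) * t ^ k) has_integral (1 / real (k + 1) - 1 / real (k + 2)) - 0) {0..1::real}"
  proof -
    have "((\<lambda>t. (1 - t) * t ^ k) has_integral
        ((1::real) ^ (k + 1) / real (k + 1) - 1 ^ (k + 2) / real (k + 2)) - (0 ^ (k + 1) / real (k + 1) - 0 ^ (k + 2) / real (k + 2))) {0..1}"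
    proof (rule fundamental_theorem_of_calculus)
      fix x :: real
      have D: "((\<lambda>x. x ^ (n + 1) / real (n + 1)) has_real_derivative x ^ n) (at x within {0..1})" for n
        by (rule derivative_eq_intros refl | simp)+
      show "((\<lambda>x. x ^ (k + 1) / real (k + 1) - x ^ (k + 2) / real (k + 2)) has_vector_derivative (1 - x) * x ^ k) (at x within {0..1})"
        using DERIV_diff[OF D[of k] D[of "k + 1"]]
        by (simp add: has_real_derivative_iff_has_vector_derivative[symmetric] algebra_simps)
    qed simp
    then show ?thesis by simp
  qed
  then have "integral {0..1} (\<lambda>t. (1 - t) * t ^ k * h 0) = (1 / real (k + 1) - 1 / real (k + 2)) * h 0"
    by (intro integral_unique has_integral_mult_left) simp
  then show ?thesis by (simp add: hat_integral_def field_simps)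
qed

section \<open>Taylor formulas with integral remainder\<close>

lemma DERIV_rescale:
  assumes "\<And>s. (h has_real_derivative h' s) (at s)"
  shows "((\<lambda>t. h (t * s)) has_real_derivative s * h' (t * s)) (at t)"
proof -
  have "((\<lambda>t. t * s) has_real_derivative s) (at t)"
    using DERIV_cmult_right[OF DERIV_ident, of s t] by simp
  from DERIV_chain2[OF assms this] show ?thesis by (simp add: mult.commute)
qed

lemma taylor_hat_integral:
  assumes "\<And>s. (f has_real_derivative f1 s) (at s)" "\<And>s. (f1 has_real_derivative f2 s) (at s)"
  shows "f s = f 0 + s * f1 0 + s\<^sup>2 * hat_integral 0 f2 s"
proof -
  define Df where "Df = (\<lambda>(m::nat) t. if m = 0 then f (t * s) else if m = 1 then s * f1 (t * s) else s\<^sup>2 * f2 (t * s))"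
  have "(Df m has_vector_derivative Df (Suc m) t) (at t within {0..1})" if "m < 2" for m :: nat and t
  proof -
    have "(Df m has_real_derivative Df (Suc m) t) (at t)"
      using that DERIV_rescale[OF assms(1)] DERIV_cmult[OF DERIV_rescale[OF assms(2)], of s]
      by (auto simp: Df_def less_2_cases_iff power2_eq_square mult.assoc)
    then show ?thesis
      by (simp add: has_real_derivative_iff_has_vector_derivative has_vector_derivative_at_within)
  qed
  from Taylor_has_integral[of 2 Df "\<lambda>t. f (t * s)" 0 1, OF _ _ this]
  have "((\<lambda>t. (1 - t) ^ 1 / fact 1 * (s\<^sup>2 * f2 (t * s))) has_integral f s - (f 0 + s * f1 0)) {0..1}"
    by (simp add: Df_def numeral_2_eq_2)
  then have "((\<lambda>t. s\<^sup>2 * ((1 - t) * t ^ 0 * f2 (t * s))) has_integral f s - (f 0 + s * f1 0)) {0..1}"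
    by (simp add: mult_ac)
  from integral_unique[OF this] show ?thesis
    by (simp add: hat_integral_def)
qed

text \<open>The bound b may vary with t and is integrated, not maximized, because it will contain
  the derivatives of r at a point moving with t. The kernel (1 - t)^3 / 3! is estimated by 1. The
  right side is a nonnegative integral, ready for Tonelli.\<close>

lemma taylor4_bound:
  fixes G :: "nat \<Rightarrow> real \<Rightarrow> real"
  assumes G: "\<And>m s. m < 4 \<Longrightarrow> (G m has_real_derivative G (Suc m) s) (at s)"
    and b: "\<And>t. 0 \<le> t \<Longrightarrow> t \<le> 1 \<Longrightarrow> \<bar>G 4 (t * s)\<bar> \<le> b t" "continuous_on {0..1} b"
  shows "ennreal \<bar>G 0 s - (\<Sum>m<4. s ^ m / fact m * G m 0)\<bar> \<le> ennreal (s ^ 4) * (\<integral>\<^sup>+t. ennreal (b t) * indicator {0..1} t \<partial>lborel)"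
proof -
  define Df where "Df = (\<lambda>m t. s ^ m * G m (t * s))"
  have "(Df m has_vector_derivative Df (Suc m) t) (at t within {0..1})" if "m < 4" for m :: nat and t
  proof -
    have "(Df m has_real_derivative Df (Suc m) t) (at t)"
      unfolding Df_def
      using DERIV_cmult[OF DERIV_rescale[OF G[OF that]], of "s ^ m"]
      by (simp add: mult.assoc power_Suc2 del: power_Suc)
    then show ?thesis
      by (simp add: has_real_derivative_iff_has_vector_derivative has_vector_derivative_at_within)
  qed
  from Taylor_has_integral[of 4 Df "Df 0" 0 1, OF _ _ this]
  have I: "((\<lambda>t. (1 - t) ^ 3 / fact 3 * Df 4 t) has_integral Df 0 1 - (\<Sum>m<4. 1 / fact m * Df m 0)) {0..1}"
    by simp
  have bi: "set_integrable lborel {0..1} b"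
    by (rule borel_integrable_atLeastAtMost') (rule b)
  have "(b has_integral integral {0..1} b) {0..1}"
    using b(2) by (intro integrable_integral integrable_continuous_real)
  then have B: "((\<lambda>t. s ^ 4 * b t) has_integral s ^ 4 * integral {0..1} b) {0..1}"
    by (rule has_integral_mult_right)
  have "norm (Df 0 1 - (\<Sum>m<4. 1 / fact m * Df m 0)) \<le> s ^ 4 * integral {0..1} b"
  proof -
    have "norm ((1 - t) ^ 3 / fact 3 * Df 4 t) \<le> s ^ 4 * b t" if t: "t \<in> {0..1}" for t
    proof -
      have "\<bar>(1 - t) ^ 3 / fact 3\<bar> \<le> 1"
        using t power_le_one[of "1 - t" 3] by (simp add: fact_numeral)
      moreover have "\<bar>Df 4 t\<bar> \<le> s ^ 4 * b t"
        using b(1)[of t] t by (simp add: Df_def abs_mult mult_left_mono)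
      ultimately have "\<bar>(1 - t) ^ 3 / fact 3\<bar> * \<bar>Df 4 t\<bar> \<le> 1 * (s ^ 4 * b t)"
        by (intro mult_mono) auto
      then show ?thesis by (simp only: real_norm_def abs_mult mult_1)
    qed
    then have "norm (integral {0..1} (\<lambda>t. (1 - t) ^ 3 / fact 3 * Df 4 t)) \<le> integral {0..1} (\<lambda>t. s ^ 4 * b t)"
      using I B by (intro integral_norm_bound_integral) blast+
    then show ?thesis unfolding integral_unique[OF I] integral_unique[OF B] .
  qed
  moreover have "ennreal (integral {0..1} b) = (\<integral>\<^sup>+t. ennreal (b t) * indicator {0..1} t \<partial>lborel)"
  proof -
    have b0: "0 \<le> b t" if "t \<in> {0..1}" for t
      using b(1)[of t] that by (auto intro: order_trans[OF abs_ge_zero])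
    then have "(\<integral>\<^sup>+t. ennreal (b t) * indicator {0..1} t \<partial>lborel) = (\<integral>\<^sup>+t. ennreal (indicator {0..1} t *\<^sub>R b t) \<partial>lborel)"
      using b0 by (intro nn_integral_cong) (auto simp: indicator_def)
    also have "\<dots> = ennreal (\<integral>t. indicator {0..1} t *\<^sub>R b t \<partial>lborel)"
      using b0
      by (intro nn_integral_eq_integral bi[unfolded set_integrable_def]) (auto simp: indicator_def)
    also have "(\<integral>t. indicator {0..1} t *\<^sub>R b t \<partial>lborel) = integral {0..1} b"
      using set_borel_integral_eq_integral(2)[OF bi] by (simp add: set_lebesgue_integral_def)
    finally show ?thesis by simp
  qed
  moreover have "Df 0 1 - (\<Sum>m<4. 1 / fact m * Df m 0) = G 0 s - (\<Sum>m<4. s ^ m / fact m * G m 0)"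
    by (simp add: Df_def)
  ultimately have "ennreal \<bar>G 0 s - (\<Sum>m<4. s ^ m / fact m * G m 0)\<bar> \<le> ennreal (s ^ 4 * integral {0..1} b)"
    by (intro ennreal_leI) (simp only: real_norm_def)
  also have "\<dots> = ennreal (s ^ 4) * (\<integral>\<^sup>+t. ennreal (b t) * indicator {0..1} t \<partial>lborel)"
    unfolding \<open>ennreal (integral {0..1} b) = _\<close>[symmetric] by (rule ennreal_mult') simp
  finally show ?thesis .
qed

text \<open>With \<open>p k\<close> and \<open>r k\<close> the \<open>k\<close>-th derivatives of \<open>\<phi>\<close> and \<open>\<rho>\<close>, the \<open>m\<close>-th derivatives of \<open>exp (- \<phi>)\<close> and
  \<open>exp (- \<phi>) \<rho>\<close> are \<open>exp (- \<phi>)\<close> times \<open>bell m p\<close> and \<open>phase_poly m p r\<close>, for \<open>m \<le> 4\<close>.\<close>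

definition bell :: "nat \<Rightarrow> (nat \<Rightarrow> real) \<Rightarrow> real" where
  "bell m p = [1, - p 1, (p 1)\<^sup>2 - p 2, - ((p 1) ^ 3) + 3 * p 1 * p 2 - p 3,
     p 1 ^ 4 - 6 * (p 1)\<^sup>2 * p 2 + 3 * (p 2)\<^sup>2 + 4 * p 1 * p 3 - p 4] ! m"

definition phase_poly :: "nat \<Rightarrow> (nat \<Rightarrow> real) \<Rightarrow> (nat \<Rightarrow> real) \<Rightarrow> real" where
  "phase_poly m p r = (\<Sum>j\<le>m. real (m choose j) * r (m - j) * bell j p)"

lemma phase_poly_simps:
  "phase_poly 0 p r = r 0"
  "phase_poly 1 p r = r 1 - p 1 * r 0"
  "phase_poly 2 p r = r 2 - 2 * p 1 * r 1 + ((p 1)\<^sup>2 - p 2) * r 0"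
  "phase_poly 3 p r = r 3 - 3 * p 1 * r 2 + 3 * ((p 1)\<^sup>2 - p 2) * r 1 + (- ((p 1) ^ 3) + 3 * p 1 * p 2 - p 3) * r 0"
  "phase_poly 4 p r = r 4 - 4 * p 1 * r 3 + 6 * ((p 1)\<^sup>2 - p 2) * r 2 + 4 * (- ((p 1) ^ 3) + 3 * p 1 * p 2 - p 3) * r 1
     + (p 1 ^ 4 - 6 * (p 1)\<^sup>2 * p 2 + 3 * (p 2)\<^sup>2 + 4 * p 1 * p 3 - p 4) * r 0"
  by (simp_all add: phase_poly_def bell_def numeral_eq_Suc atMost_Suc binomial_Suc_Suc algebra_simps)

text \<open>Since \<open>bell\<close> is a table up to order 4, the product rule is checked for each
  order separately.\<close>

lemma DERIV_exp_phase_poly: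
  assumes p: "\<And>k. k < 4 \<Longrightarrow> (p k has_real_derivative p (Suc k) s) (at s)"
    and r: "\<And>k. k < 4 \<Longrightarrow> (r k has_real_derivative r (Suc k) s) (at s)" and "m < 4"
  shows "((\<lambda>s. exp (- p 0 s) * phase_poly m (\<lambda>k. p k s) (\<lambda>k. r k s)) has_real_derivative
     exp (- p 0 s) * phase_poly (Suc m) (\<lambda>k. p k s) (\<lambda>k. r k s)) (at s)"
proof -
  have S: "Suc 0 = 1" "Suc 1 = 2" "Suc 2 = 3" "Suc 3 = 4" by simp_all
  note [derivative_intros] =
    p[of 0, unfolded S] p[of 1, unfolded S] p[of 2, unfolded S] p[of 3, unfolded S]
    r[of 0, unfolded S] r[of 1, unfolded S] r[of 2, unfolded S] r[of 3, unfolded S]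
  consider "m = 0" | "m = 1" | "m = 2" | "m = 3" using \<open>m < 4\<close> by linarith
  then show ?thesis
  proof cases
    case 1
    show ?thesis unfolding 1 S phase_poly_simps
      by (rule derivative_eq_intros refl | simp)+ (simp add: algebra_simps)
  next
    case 2
    show ?thesis unfolding 2 S phase_poly_simps
      by (rule derivative_eq_intros refl | simp)+ (simp add: algebra_simps power2_eq_square)
  next
    case 3
    show ?thesis unfolding 3 S phase_poly_simps
      by (rule derivative_eq_intros refl | simp)+ (simp add: algebra_simps power2_eq_square power3_eq_cube)
  next
    case 4
    show ?thesis unfolding 4 S phase_poly_simps
      by (rule derivative_eq_intros refl | simp)+ (simp add: algebra_simps power2_eq_square power3_eq_cube power4_eq_xxxx)
  qed
qed


text \<open>The orders of the factors in each monomial add up to 4, which gives n^4; every factor p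
  contributes B and two further powers of n, and at most four of them occur. Hence B^4 and (1 +
  n)^8. The number 52 is the sum of the absolute values of the coefficients of the twelve
  monomials.\<close>

lemma abs_phase_poly_4_le:
  assumes p: "\<And>k. 1 \<le> k \<Longrightarrow> k \<le> 4 \<Longrightarrow> \<bar>p k\<bar> \<le> B * n ^ (k + 2)"
    and r: "\<And>k. k \<le> 4 \<Longrightarrow> \<bar>r k\<bar> \<le> F * n ^ k" and "1 \<le> B" "0 \<le> n" "0 \<le> F"
  shows "\<bar>phase_poly 4 p r\<bar> \<le> 52 * (B ^ 4 * (n ^ 4 * (1 + n) ^ 8) * F)"
proof -
  let ?W = "B ^ 4 * (n ^ 4 * (1 + n) ^ 8) * F"
  have W: "\<bar>x\<bar> \<le> ?W" if "\<bar>x\<bar> \<le> B ^ i * n ^ (4 + j) * F" "i \<le> 4" "j \<le> 8" for x i j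
  proof -
    have "n ^ j \<le> (1 + n) ^ j" using assms by (intro power_mono) auto
    also have "\<dots> \<le> (1 + n) ^ 8" using assms that by (intro power_increasing) auto
    finally have "n ^ j \<le> (1 + n) ^ 8" .
    moreover have "B ^ i \<le> B ^ 4" using assms that by (intro power_increasing) auto
    ultimately have "B ^ i * (n ^ 4 * n ^ j) * F \<le> B ^ 4 * (n ^ 4 * (1 + n) ^ 8) * F"
      using assms by (intro mult_mono order_refl) auto
    then show ?thesis using that(1) by (simp add: power_add)
  qed
  have m: "\<bar>x * y\<bar> \<le> B ^ I * n ^ K * G"
    if "\<bar>x\<bar> \<le> B ^ i * n ^ k" "\<bar>y\<bar> \<le> B ^ i' * n ^ k' * G" "i + i' = I" "k + k' = K" for x y i i' k k' I K G
    using mult_mono[OF that(1,2)] assms unfolding that(3,4)[symmetric] by (simp add: abs_mult power_add mult_ac)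
  have P: "\<bar>p 1\<bar> \<le> B ^ 1 * n ^ 3" "\<bar>p 2\<bar> \<le> B ^ 1 * n ^ 4" "\<bar>p 3\<bar> \<le> B ^ 1 * n ^ 5" "\<bar>p 4\<bar> \<le> B ^ 1 * n ^ 6"
    using p[of 1] p[of 2] p[of 3] p[of 4] by (simp_all add: numeral_eq_Suc)
  have R: "\<bar>r 0\<bar> \<le> B ^ 0 * n ^ 0 * F" "\<bar>r 1\<bar> \<le> B ^ 0 * n ^ 1 * F" "\<bar>r 2\<bar> \<le> B ^ 0 * n ^ 2 * F"
     "\<bar>r 3\<bar> \<le> B ^ 0 * n ^ 3 * F" "\<bar>r 4\<bar> \<le> B ^ 0 * n ^ 4 * F"
    using r[of 0] r[of 1] r[of 2] r[of 3] r[of 4] by (simp_all add: mult_ac)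
  note T =
    W[of "r 4" 0 0]
    W[of "p 1 * r 3" 1 2] W[of "p 1 * (p 1 * r 2)" 2 4] W[of "p 2 * r 2" 1 2]
    W[of "p 1 * (p 1 * (p 1 * r 1))" 3 6] W[of "p 1 * (p 2 * r 1)" 2 4] W[of "p 3 * r 1" 1 2]
    W[of "p 1 * (p 1 * (p 1 * (p 1 * r 0)))" 4 8] W[of "p 1 * (p 1 * (p 2 * r 0))" 3 6]
    W[of "p 2 * (p 2 * r 0)" 2 4] W[of "p 1 * (p 3 * r 0)" 2 4] W[of "p 4 * r 0" 1 2]
  have t1: "\<bar>r 4\<bar> \<le> ?W" using T(1) R by simp
  have t2: "\<bar>p 1 * r 3\<bar> \<le> ?W" by (intro T(2) m[OF P(1) R(4)]) simp_all
  have t3: "\<bar>p 1 * (p 1 * r 2)\<bar> \<le> ?W" by (intro T(3) m[OF P(1) m[OF P(1) R(3) refl refl]]) simp_all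
  have t4: "\<bar>p 2 * r 2\<bar> \<le> ?W" by (intro T(4) m[OF P(2) R(3)]) simp_all
  have t5: "\<bar>p 1 * (p 1 * (p 1 * r 1))\<bar> \<le> ?W" by (intro T(5) m[OF P(1) m[OF P(1) m[OF P(1) R(2) refl refl] refl refl]]) simp_all
  have t6: "\<bar>p 1 * (p 2 * r 1)\<bar> \<le> ?W" by (intro T(6) m[OF P(1) m[OF P(2) R(2) refl refl]]) simp_all
  have t7: "\<bar>p 3 * r 1\<bar> \<le> ?W" by (intro T(7) m[OF P(3) R(2)]) simp_all
  have t8: "\<bar>p 1 * (p 1 * (p 1 * (p 1 * r 0)))\<bar> \<le> ?W" by (intro T(8) m[OF P(1) m[OF P(1) m[OF P(1) m[OF P(1) R(1) refl refl] refl refl] refl refl]]) simp_all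
  have t9: "\<bar>p 1 * (p 1 * (p 2 * r 0))\<bar> \<le> ?W" by (intro T(9) m[OF P(1) m[OF P(1) m[OF P(2) R(1) refl refl] refl refl]]) simp_all
  have t10: "\<bar>p 2 * (p 2 * r 0)\<bar> \<le> ?W" by (intro T(10) m[OF P(2) m[OF P(2) R(1) refl refl]]) simp_all
  have t11: "\<bar>p 1 * (p 3 * r 0)\<bar> \<le> ?W" by (intro T(11) m[OF P(1) m[OF P(3) R(1) refl refl]]) simp_all
  have t12: "\<bar>p 4 * r 0\<bar> \<le> ?W" by (intro T(12) m[OF P(4) R(1)]) simp_all
  have eq: "phase_poly 4 p r = r 4 - 4 * (p 1 * r 3) + 6 * (p 1 * (p 1 * r 2)) - 6 * (p 2 * r 2)
     - 4 * (p 1 * (p 1 * (p 1 * r 1))) + 12 * (p 1 * (p 2 * r 1)) - 4 * (p 3 * r 1)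
     + p 1 * (p 1 * (p 1 * (p 1 * r 0))) - 6 * (p 1 * (p 1 * (p 2 * r 0))) + 3 * (p 2 * (p 2 * r 0))
     + 4 * (p 1 * (p 3 * r 0)) - p 4 * r 0"
    unfolding phase_poly_simps by (simp add: algebra_simps power2_eq_square power3_eq_cube power4_eq_xxxx)
  show ?thesis
    unfolding eq using t1 t2 t3 t4 t5 t6 t7 t8 t9 t10 t11 t12
    unfolding abs_le_iff by (intro conjI; linarith)
qed

section \<open>The convolution kernel\<close>

text \<open>Use 1 + b <= exp b and complete the square: N b - l b^2/4 has its maximum N^2/l at b = 2
  N/l.\<close>

lemma power_exp_bound:
  fixes l :: real
  assumes "l > 0" "0 \<le> b"
  shows "(1 + b) ^ N * exp (- l * b\<^sup>2 / 4) \<le> exp ((real N)\<^sup>2 / l)"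
proof -
  have "(1 + b) ^ N \<le> exp b ^ N"
    using assms exp_ge_add_one_self[of b] by (intro power_mono) auto
  also have "\<dots> = exp (real N * b)" by (simp add: exp_of_nat_mult)
  finally have "(1 + b) ^ N * exp (- l * b\<^sup>2 / 4) \<le> exp (real N * b) * exp (- l * b\<^sup>2 / 4)"
    by (intro mult_right_mono) auto
  also have "\<dots> = exp (real N * b - l * b\<^sup>2 / 4)" by (simp flip: exp_add)
  also have "real N * b - l * b\<^sup>2 / 4 \<le> (real N)\<^sup>2 / l"
  proof -
    have "0 \<le> (real N - l * b / 2)\<^sup>2" by simp
    then have "l * (real N * b - l * b\<^sup>2 / 4) \<le> (real N)\<^sup>2"
      by (simp add: power2_eq_square algebra_simps)
    then show ?thesis using assms by (simp add: field_simps)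
  qed
  finally show ?thesis by simp
qed

text \<open>The dependence on b = |y| in the bound for the fourth s-derivative: the powers counted
  in \<open>abs_phase_poly_4_le\<close> times the Gaussian from \<open>phase_ge\<close>.\<close>

definition radial_weight :: "real \<Rightarrow> real \<Rightarrow> real" where
  "radial_weight l b = b ^ 4 * (1 + b) ^ 8 * exp (- l * b\<^sup>2 / 2)"

text \<open>The last factor is what keeps the integral over \<open>t\<close> bounded uniformly in \<open>a\<close>: a bound by the power
  \<open>a / t\<close> to the \<open>1 - d\<close> alone would leave the divergent \<open>1 / t\<close>.\<close>

lemma radial_weight_dilation:
  fixes l a t :: real
  assumes l: "l > 0" and a: "a > 0" and t: "0 < t" "t \<le> 1" and d: "d > 0"
  shows "radial_weight l (a / t) / t ^ d
     \<le> exp ((real (d + 14))\<^sup>2 / l) * (exp (- l * a\<^sup>2 / 4) / a ^ (d - 1)) * (a / (t\<^sup>2 + a\<^sup>2))"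
proof -
  define b where "b = a / t"
  have b: "b > 0" "a \<le> b" using a t by (auto simp: b_def field_simps)
  \<comment> \<open>As t <= 1 means a <= b, half of the exponent can be moved to a, where it no
    longer depends on t; the other half absorbs the powers of b.\<close>
  have E: "exp (- l * b\<^sup>2 / 2) \<le> exp (- l * b\<^sup>2 / 4) * exp (- l * a\<^sup>2 / 4)"
  proof -
    have "l * a\<^sup>2 \<le> l * b\<^sup>2" using a b l by (intro mult_left_mono power_mono) auto
    then show ?thesis by (simp flip: exp_add)
  qed
  \<comment> \<open>The factor b^4 allows b^2/(1 + b^2) to be split off. What is left has degree d +
    12, below the rounded exponent d + 14.\<close>
  have "b ^ d * b ^ 4 * (1 + b) ^ 8 * (1 + b\<^sup>2) / b\<^sup>2 \<le> (1 + b) ^ (d + 14)"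
  proof -
    have "b ^ d * b ^ 4 / b\<^sup>2 = b ^ d * b ^ 2"
      using b by (simp add: power2_eq_square power4_eq_xxxx)
    then have "b ^ d * b ^ 4 * (1 + b) ^ 8 * (1 + b\<^sup>2) / b\<^sup>2 = b ^ d * b ^ 2 * (1 + b) ^ 8 * (1 + b\<^sup>2)"
      by (simp only: times_divide_eq_left[symmetric])
    also have "\<dots> \<le> (1 + b) ^ d * (1 + b) ^ 2 * (1 + b) ^ 8 * (1 + b) ^ 2"
      using b by (intro mult_mono power_mono) (auto simp: power2_eq_square algebra_simps)
    also have "\<dots> = (1 + b) ^ (d + 2 + 8 + 2)" by (simp only: power_add)
    also have "\<dots> \<le> (1 + b) ^ (d + 14)" using b by (intro power_increasing) auto
    finally show ?thesis .
  qed
  then have "b ^ d * b ^ 4 * (1 + b) ^ 8 * (1 + b\<^sup>2) / b\<^sup>2 * exp (- l * b\<^sup>2 / 4) \<le> (1 + b) ^ (d + 14) * exp (- l * b\<^sup>2 / 4)"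
    by (intro mult_right_mono) auto
  also have "\<dots> \<le> exp ((real (d + 14))\<^sup>2 / l)" using l b by (intro power_exp_bound) auto
  finally have M: "b ^ d * b ^ 4 * (1 + b) ^ 8 * exp (- l * b\<^sup>2 / 4) \<le> exp ((real (d + 14))\<^sup>2 / l) * (b\<^sup>2 / (1 + b\<^sup>2))"
    using b by (simp add: field_simps add_pos_nonneg)
  have "radial_weight l b / t ^ d = (b ^ d * b ^ 4 * (1 + b) ^ 8 * exp (- l * b\<^sup>2 / 2)) / a ^ d"
    using a t by (simp add: radial_weight_def b_def power_divide mult_ac)
  also have "\<dots> \<le> (b ^ d * b ^ 4 * (1 + b) ^ 8 * (exp (- l * b\<^sup>2 / 4) * exp (- l * a\<^sup>2 / 4))) / a ^ d"
    using E a b by (intro divide_right_mono mult_left_mono) auto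
  also have "\<dots> \<le> (exp ((real (d + 14))\<^sup>2 / l) * (b\<^sup>2 / (1 + b\<^sup>2)) * exp (- l * a\<^sup>2 / 4)) / a ^ d"
  proof (rule divide_right_mono)
    show "b ^ d * b ^ 4 * (1 + b) ^ 8 * (exp (- l * b\<^sup>2 / 4) * exp (- l * a\<^sup>2 / 4))
       \<le> exp ((real (d + 14))\<^sup>2 / l) * (b\<^sup>2 / (1 + b\<^sup>2)) * exp (- l * a\<^sup>2 / 4)"
      using mult_right_mono[OF M, of "exp (- l * a\<^sup>2 / 4)"] by (simp only: mult.assoc exp_ge_zero)
  qed (use a in simp)
  also have "b\<^sup>2 / (1 + b\<^sup>2) = a * (a / (t\<^sup>2 + a\<^sup>2))"
  proof -
    have "1 + b\<^sup>2 = (t\<^sup>2 + a\<^sup>2) / t\<^sup>2" using t by (simp add: b_def power_divide add_divide_distrib)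
    then have "b\<^sup>2 / (1 + b\<^sup>2) = a\<^sup>2 / (t\<^sup>2 + a\<^sup>2)"
      using t by (simp add: b_def power_divide)
    then show ?thesis by (simp only: power2_eq_square times_divide_eq_right)
  qed
  also have "a ^ d = a * a ^ (d - 1)" using d by (simp flip: power_Suc)
  finally have "radial_weight l b / t ^ d \<le> (exp ((real (d + 14))\<^sup>2 / l) * (a * (a / (t\<^sup>2 + a\<^sup>2))) * exp (- l * a\<^sup>2 / 4)) / (a * a ^ (d - 1))" .
  moreover have "(x * (a * y) * e) / (a * A) = x * (e / A) * y" for x y e A :: real
    using a by simp
  ultimately show ?thesis unfolding b_def by (simp only:)
qed

text \<open>The antiderivative arctan (t/a) is bounded independently of a, which is the uniformity
  needed here.\<close>

lemma nn_integral_arctan_kernel: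
  assumes "(a::real) > 0"
  shows "(\<integral>\<^sup>+t. ennreal (a / (t\<^sup>2 + a\<^sup>2)) * indicator {0..1} t \<partial>lborel) \<le> ennreal (pi / 2)"
proof -
  have "(\<integral>\<^sup>+t. ennreal (a / (t\<^sup>2 + a\<^sup>2)) * indicator {0..1} t \<partial>lborel) = ennreal (arctan (1 / a) - arctan (0 / a))"
  proof (rule nn_integral_FTC_Icc)
    fix t :: real
    show "((\<lambda>t. arctan (t / a)) has_real_derivative a / (t\<^sup>2 + a\<^sup>2)) (at t)"
    proof -
      have "((\<lambda>t. arctan (t / a)) has_real_derivative inverse (1 + (t / a)\<^sup>2) * (1 / a)) (at t)"
        using assms by (auto intro!: derivative_eq_intros)
      moreover have "inverse (1 + (t / a)\<^sup>2) * (1 / a) = a / (t\<^sup>2 + a\<^sup>2)"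
      proof -
        have "1 + (t / a)\<^sup>2 = (t\<^sup>2 + a\<^sup>2) / a\<^sup>2" using assms by (simp add: power_divide add_divide_distrib)
        then show ?thesis using assms by (simp add: power2_eq_square)
      qed
      ultimately show ?thesis by simp
    qed
  qed (use assms in auto)
  also have "\<dots> \<le> ennreal (pi / 2)"
    using arctan_ubound[of "1 / a"] by (intro ennreal_leI) auto
  finally show ?thesis .
qed

text \<open>The powers l^(d/2) from the prefactor and l^(-(d-1)/2) from the singularity leave a
  single sqrt l. The origin is excluded because \<open>K\<close> has only a default value there when
  d > 1.\<close>

lemma K_scaled_eq:
  fixes z :: "real^'d"
  assumes s: "s > 0" and l: "l > 0" and z: "z \<noteq> 0"
  shows "K_scaled (s\<^sup>2 / l) z =
    sqrt l / s ^ CARD('d) * (exp (- l * (norm z / s)\<^sup>2 / 4) / (norm z / s) ^ (CARD('d) - 1))"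
proof -
  define q where "q = norm z / s"
  have q: "q > 0" using s z by (simp add: q_def)
  have sq: "sqrt (s\<^sup>2 / l) = s / sqrt l" using s by (simp add: real_sqrt_divide)
  have nz: "norm (z /\<^sub>R sqrt (s\<^sup>2 / l)) = sqrt l * q"
    unfolding sq using s l by (simp add: q_def field_simps)
  have "(s\<^sup>2 / l) powr (- real CARD('d) / 2) = ((s / sqrt l) powr 2) powr (- real CARD('d) / 2)"
    using s l by (simp add: powr_numeral power_divide)
  also have "\<dots> = (s / sqrt l) powr (- real CARD('d))"
    by (simp only: powr_powr) simp
  also have "\<dots> = sqrt l ^ CARD('d) / s ^ CARD('d)"
    using s l by (simp add: powr_minus powr_realpow power_divide)
  finally have 1: "(s\<^sup>2 / l) powr (- real CARD('d) / 2) = sqrt l ^ CARD('d) / s ^ CARD('d)" .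
  have 2: "sqrt l ^ CARD('d) = sqrt l * sqrt l ^ (CARD('d) - 1)"
    by (simp flip: power_Suc)
  have 3: "(norm (z /\<^sub>R sqrt (s\<^sup>2 / l)))\<^sup>2 = l * q\<^sup>2"
    unfolding nz using l by (simp only: power_mult_distrib) simp
  show ?thesis
    unfolding K_scaled_def K_def 3 unfolding nz 1 2 q_def[symmetric] using s l q
    by (simp add: power_mult_distrib)
qed

lemma nn_integral_lborel_dilation:
  fixes h :: "real^'d \<Rightarrow> ennreal"
  assumes [measurable]: "h \<in> borel_measurable borel" and c: "c > 0"
  shows "ennreal (c ^ CARD('d)) * (\<integral>\<^sup>+y. h (x + c *\<^sub>R y) \<partial>lborel) = (\<integral>\<^sup>+v. h v \<partial>lborel)"
proof -
  have lb: "(lborel :: (real^'d) measure) = density (distr lborel borel (\<lambda>y. x + c *\<^sub>R y)) (\<lambda>_. ennreal (c ^ CARD('d)))"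
    using lborel_affine[of c x] c by simp
  show ?thesis
    by (subst (2) lb) (use c in \<open>simp add: nn_integral_density nn_integral_distr nn_integral_cmult\<close>)
qed

text \<open>In the constant, the exponential comes from the polynomial factors of the weight, pi/2
  from the t-integral of a/(t^2 + a^2), and 1/sqrt l compensates the sqrt l in
  \<open>K_scaled_eq\<close>.\<close>

theorem dilation_average_le_conv:
  fixes F :: "real^'d \<Rightarrow> real"
  assumes F: "continuous_on UNIV F" "\<And>x. 0 \<le> F x" and s: "s > 0" and l: "l > 0"
  shows "(\<integral>\<^sup>+y. (\<integral>\<^sup>+t. ennreal (radial_weight l (norm y) * F (x + (t * s) *\<^sub>R y)) * indicator {0..1} t \<partial>lborel) \<partial>lborel)
    \<le> ennreal (exp ((real (CARD('d) + 14))\<^sup>2 / l) * (pi / 2) / sqrt l) * conv (K_scaled (s\<^sup>2 / l)) F x"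
proof -
  let ?d = "CARD('d)"
  have [measurable]: "F \<in> borel_measurable borel" using F by (intro borel_measurable_continuous_onI)
  have w0: "0 \<le> radial_weight l (norm y)" for y :: "real^'d" by (simp add: radial_weight_def)
  have [measurable]: "radial_weight l \<in> borel_measurable borel"
    unfolding radial_weight_def by measurable
  let ?g = "\<lambda>t v. ennreal (radial_weight l (norm (v - x) / (t * s)) / (t * s) ^ ?d * F v) * indicator {0<..1} t"
  define C where "C = exp ((real (?d + 14))\<^sup>2 / l)"
  have "(\<integral>\<^sup>+y. (\<integral>\<^sup>+t. ennreal (radial_weight l (norm y) * F (x + (t * s) *\<^sub>R y)) * indicator {0..1} t \<partial>lborel) \<partial>lborel)
      = (\<integral>\<^sup>+t. (\<integral>\<^sup>+y. ennreal (radial_weight l (norm y) * F (x + (t * s) *\<^sub>R y)) * indicator {0..1} t \<partial>lborel) \<partial>lborel)"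
    by (rule lborel_pair.Fubini') measurable
  also have "\<dots> = (\<integral>\<^sup>+t. (\<integral>\<^sup>+v. ?g t v \<partial>lborel) \<partial>lborel)"
  proof (rule nn_integral_cong_AE)
    show "AE t in lborel. (\<integral>\<^sup>+y. ennreal (radial_weight l (norm y) * F (x + (t * s) *\<^sub>R y)) * indicator {0..1} t \<partial>lborel) = (\<integral>\<^sup>+v. ?g t v \<partial>lborel)"
      \<comment> \<open>At t = 0 the dilation degenerates; this null set is dropped, and the
        indicator becomes that of {0<..1}.\<close>
      using AE_lborel_singleton[of "0::real"]
    proof eventually_elim
      fix t :: real assume "t \<noteq> 0"
      show "(\<integral>\<^sup>+y. ennreal (radial_weight l (norm y) * F (x + (t * s) *\<^sub>R y)) * indicator {0..1} t \<partial>lborel) = (\<integral>\<^sup>+v. ?g t v \<partial>lborel)"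
      proof (cases "t \<in> {0<..1}")
        case True
        then have c: "t * s > 0" using s by simp
        have "(\<integral>\<^sup>+v. ?g t v \<partial>lborel) = ennreal ((t * s) ^ ?d) * (\<integral>\<^sup>+y. ?g t (x + (t * s) *\<^sub>R y) \<partial>lborel)"
          by (rule nn_integral_lborel_dilation[symmetric, OF _ c]) measurable
        also have "\<dots> = (\<integral>\<^sup>+y. ennreal ((t * s) ^ ?d) * ?g t (x + (t * s) *\<^sub>R y) \<partial>lborel)"
          by (rule nn_integral_cmult[symmetric]) measurable
        also have "\<dots> = (\<integral>\<^sup>+y. ennreal (radial_weight l (norm y) * F (x + (t * s) *\<^sub>R y)) * indicator {0..1} t \<partial>lborel)"
        proof (rule nn_integral_cong)
          fix y :: "real^'d"
          have "norm (x + (t * s) *\<^sub>R y - x) / (t * s) = norm y" using True s by simp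
          then show "ennreal ((t * s) ^ ?d) * ?g t (x + (t * s) *\<^sub>R y) = ennreal (radial_weight l (norm y) * F (x + (t * s) *\<^sub>R y)) * indicator {0..1} t"
            using True c s by (simp flip: ennreal_mult')
        qed
        finally show ?thesis by simp
      qed (use \<open>t \<noteq> 0\<close> in \<open>auto simp: indicator_def\<close>)
    qed
  qed
  also have "\<dots> = (\<integral>\<^sup>+v. (\<integral>\<^sup>+t. ?g t v \<partial>lborel) \<partial>lborel)"
    by (rule lborel_pair.Fubini') measurable
  also have "\<dots> \<le> (\<integral>\<^sup>+v. ennreal (C * (pi / 2) / sqrt l) * (ennreal (K_scaled (s\<^sup>2 / l) (x - v)) * ennreal (F v)) \<partial>lborel)"
  proof (rule nn_integral_mono_AE)
    show "AE v in lborel. (\<integral>\<^sup>+t. ?g t v \<partial>lborel) \<le> ennreal (C * (pi / 2) / sqrt l) * (ennreal (K_scaled (s\<^sup>2 / l) (x - v)) * ennreal (F v))"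
      \<comment> \<open>At v = x the distance a vanishes and the kernel has a default value; a
        single point is negligible.\<close>
      using AE_lborel_singleton[of x]
    proof eventually_elim
      fix v assume "v \<noteq> x"
      define a where "a = norm (v - x) / s"
      have a: "a > 0" using \<open>v \<noteq> x\<close> s by (simp add: a_def)
      define c where "c = C * (exp (- l * a\<^sup>2 / 4) / a ^ (?d - 1)) / s ^ ?d * F v"
      have c0: "0 \<le> c" using a s F by (simp add: c_def C_def)
      have "(\<integral>\<^sup>+t. ?g t v \<partial>lborel) \<le> (\<integral>\<^sup>+t. ennreal c * (ennreal (a / (t\<^sup>2 + a\<^sup>2)) * indicator {0..1} t) \<partial>lborel)"
      proof (rule nn_integral_mono)
        fix t :: real
        show "?g t v \<le> ennreal c * (ennreal (a / (t\<^sup>2 + a\<^sup>2)) * indicator {0..1} t)"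
        proof (cases "t \<in> {0<..1}")
          case True
          then have t: "0 < t" "t \<le> 1" by auto
          have "radial_weight l (norm (v - x) / (t * s)) / (t * s) ^ ?d * F v = (radial_weight l (a / t) / t ^ ?d) * (F v / s ^ ?d)"
            by (simp add: a_def power_mult_distrib mult.commute)
          also have "\<dots> \<le> (C * (exp (- l * a\<^sup>2 / 4) / a ^ (?d - 1)) * (a / (t\<^sup>2 + a\<^sup>2))) * (F v / s ^ ?d)"
            unfolding C_def using s F by (intro mult_right_mono radial_weight_dilation l a t) auto
          also have "\<dots> = c * (a / (t\<^sup>2 + a\<^sup>2))" by (simp add: c_def mult_ac)
          finally show ?thesis using True c0 a by (simp add: ennreal_leI flip: ennreal_mult')
        qed (auto simp: indicator_def)
      qed
      also have "\<dots> = ennreal c * (\<integral>\<^sup>+t. ennreal (a / (t\<^sup>2 + a\<^sup>2)) * indicator {0..1} t \<partial>lborel)"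
        by (rule nn_integral_cmult) measurable
      also have "\<dots> \<le> ennreal c * ennreal (pi / 2)"
        by (intro mult_left_mono nn_integral_arctan_kernel a) auto
      also have "\<dots> = ennreal (C * (pi / 2) / sqrt l * (K_scaled (s\<^sup>2 / l) (x - v) * F v))"
      proof -
        have "K_scaled (s\<^sup>2 / l) (x - v) = sqrt l / s ^ ?d * (exp (- l * a\<^sup>2 / 4) / a ^ (?d - 1))"
          using K_scaled_eq[OF s l, of "x - v"] \<open>v \<noteq> x\<close> by (simp add: a_def norm_minus_commute)
        then have "C * (pi / 2) / sqrt l * (K_scaled (s\<^sup>2 / l) (x - v) * F v) = c * (pi / 2)"
          using l by (simp add: c_def mult_ac)
        then show ?thesis by (simp only: ennreal_mult''[of "pi / 2" c, symmetric] pi_ge_zero divide_nonneg_pos zero_less_numeral)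
      qed
      also have "\<dots> = ennreal (C * (pi / 2) / sqrt l) * (ennreal (K_scaled (s\<^sup>2 / l) (x - v)) * ennreal (F v))"
      proof -
        have "0 \<le> C * (pi / 2) / sqrt l" using l by (simp add: C_def)
        then show ?thesis by (simp only: ennreal_mult' ennreal_mult''[OF F(2)])
      qed
      finally show "(\<integral>\<^sup>+t. ?g t v \<partial>lborel) \<le> ennreal (C * (pi / 2) / sqrt l) * (ennreal (K_scaled (s\<^sup>2 / l) (x - v)) * ennreal (F v))" .
    qed
  qed
  also have "\<dots> = ennreal (C * (pi / 2) / sqrt l) * conv (K_scaled (s\<^sup>2 / l)) F x"
    unfolding conv_def
    by (rule nn_integral_cmult) (simp add: K_scaled_def K_def)
  finally show ?thesis unfolding C_def .
qed

section \<open>Wick contractions of symmetric tensors\<close>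

text \<open>Exchanging two summation variables and undoing it in v by symmetry permutes the slots of
  the other tensor. The transpositions (2 3) and (3 4) identify the three pairings.\<close>

lemma sum_pairings_4:
  fixes v :: "'d::finite \<Rightarrow> 'd \<Rightarrow> 'd \<Rightarrow> 'd \<Rightarrow> real"
  assumes v: "\<And>i j k l. v i k j l = v i j k l" "\<And>i j k l. v i j l k = v i j k l"
  shows "(\<Sum>i\<in>UNIV. \<Sum>j\<in>UNIV. \<Sum>k\<in>UNIV. \<Sum>l\<in>UNIV. v i j k l * (g i j * g k l + g i k * g j l + g i l * g j k))
    = 3 * (\<Sum>i\<in>UNIV. \<Sum>j\<in>UNIV. \<Sum>k\<in>UNIV. \<Sum>l\<in>UNIV. v i j k l * g i j * g k l)"
proof -
  define \<Phi> where "\<Phi> a = (\<Sum>i\<in>UNIV. \<Sum>j\<in>UNIV. \<Sum>k\<in>UNIV. \<Sum>l\<in>UNIV. v i j k l * a i j k l)" for a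
  have s23: "\<Phi> (\<lambda>i j k l. a i k j l) = \<Phi> a" for a
    unfolding \<Phi>_def by (subst sum.swap) (simp add: v)
  have s34: "\<Phi> (\<lambda>i j k l. a i j l k) = \<Phi> a" for a
    unfolding \<Phi>_def by (subst (4) sum.swap) (simp add: v)
  have "(\<Sum>i\<in>UNIV. \<Sum>j\<in>UNIV. \<Sum>k\<in>UNIV. \<Sum>l\<in>UNIV. v i j k l * (g i j * g k l + g i k * g j l + g i l * g j k))
    = \<Phi> (\<lambda>i j k l. g i j * g k l) + \<Phi> (\<lambda>i j k l. g i k * g j l) + \<Phi> (\<lambda>i j k l. g i l * g j k)"
    unfolding \<Phi>_def by (simp add: sum.distrib algebra_simps)
  also have "\<Phi> (\<lambda>i j k l. g i l * g j k) = \<Phi> (\<lambda>i j k l. g i k * g j l)"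
    by (rule s34)
  also have "\<Phi> (\<lambda>i j k l. g i k * g j l) = \<Phi> (\<lambda>i j k l. g i j * g k l)"
    by (rule s23)
  finally show ?thesis unfolding \<Phi>_def by (simp add: mult_ac)
qed

text \<open>In each of the three pairings the index of w meets one index of v and the other two
  indices of v meet each other; the symmetry of v makes the three equal.\<close>

lemma sum_pairings_31:
  fixes v :: "'d::finite \<Rightarrow> 'd \<Rightarrow> 'd \<Rightarrow> real"
  assumes v: "\<And>i j k. v j i k = v i j k" "\<And>i j k. v i k j = v i j k" and g: "\<And>i j. g j i = g i j"
  shows "(\<Sum>i\<in>UNIV. \<Sum>j\<in>UNIV. \<Sum>k\<in>UNIV. \<Sum>l\<in>UNIV. v i j k * w l * (g i j * g k l + g i k * g j l + g i l * g j k))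
    = 3 * (\<Sum>i\<in>UNIV. \<Sum>j\<in>UNIV. \<Sum>k\<in>UNIV. \<Sum>l\<in>UNIV. v j k l * g i j * g k l * w i)"
proof -
  define \<Phi> where "\<Phi> a = (\<Sum>i\<in>UNIV. \<Sum>j\<in>UNIV. \<Sum>k\<in>UNIV. v i j k * a i j k)" for a
  have s12: "\<Phi> (\<lambda>i j k. a j i k) = \<Phi> a" for a
    unfolding \<Phi>_def by (subst sum.swap) (simp add: v(1))
  have s23: "\<Phi> (\<lambda>i j k. a i k j) = \<Phi> a" for a
    unfolding \<Phi>_def by (rule sum.cong[OF refl], subst sum.swap, simp add: v(2))
  have add: "\<Phi> (\<lambda>i j k. a i j k + b i j k) = \<Phi> a + \<Phi> b" for a b
    unfolding \<Phi>_def by (simp add: sum.distrib distrib_left)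
  have eq: "\<Phi> (\<lambda>i j k. g i j * g k l + g i k * g j l + g i l * g j k) = 3 * \<Phi> (\<lambda>j k m. g l j * g k m)" for l
  proof -
    have "\<Phi> (\<lambda>i j k. g i j * g k l) = \<Phi> (\<lambda>i j k. g i k * g j l)" by (rule s23[symmetric])
    also have "\<dots> = \<Phi> (\<lambda>i j k. g j k * g i l)" by (rule s12[symmetric])
    finally have 1: "\<Phi> (\<lambda>i j k. g i j * g k l) = \<Phi> (\<lambda>j k m. g l j * g k m)"
      by (simp add: g[of l] mult.commute)
    have "\<Phi> (\<lambda>i j k. g i k * g j l) = \<Phi> (\<lambda>i j k. g j k * g i l)" by (rule s12[symmetric])
    then have 2: "\<Phi> (\<lambda>i j k. g i k * g j l) = \<Phi> (\<lambda>j k m. g l j * g k m)"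
      by (simp add: g[of l] mult.commute)
    have 3: "\<Phi> (\<lambda>i j k. g i l * g j k) = \<Phi> (\<lambda>j k m. g l j * g k m)"
      by (simp add: g[of l])
    show ?thesis unfolding add 1 2 3 by simp
  qed
  have "(\<Sum>i\<in>UNIV. \<Sum>j\<in>UNIV. \<Sum>k\<in>UNIV. \<Sum>l\<in>UNIV. v i j k * w l * (g i j * g k l + g i k * g j l + g i l * g j k))
    = (\<Sum>l\<in>UNIV. \<Sum>i\<in>UNIV. \<Sum>j\<in>UNIV. \<Sum>k\<in>UNIV. v i j k * w l * (g i j * g k l + g i k * g j l + g i l * g j k))"
    by (subst (3) sum.swap, subst (2) sum.swap, subst (1) sum.swap) (rule refl)
  also have "\<dots> = (\<Sum>l\<in>UNIV. w l * \<Phi> (\<lambda>i j k. g i j * g k l + g i k * g j l + g i l * g j k))"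
    unfolding \<Phi>_def by (simp add: sum_distrib_left mult_ac)
  also have "\<dots> = (\<Sum>l\<in>UNIV. w l * (3 * \<Phi> (\<lambda>j k m. g l j * g k m)))"
    unfolding eq ..
  finally show ?thesis unfolding \<Phi>_def by (simp add: sum_distrib_left mult_ac)
qed

text \<open>Of the 15 pairings of six indices, nine have one link between the two triples (3 * 3
  choices of the linked indices) and six have three links (3! matchings). Permutations within the
  triples act transitively on each class.\<close>

lemma sum_pairings_33:
  fixes v :: "'d::finite \<Rightarrow> 'd \<Rightarrow> 'd \<Rightarrow> real"
  assumes v: "\<And>i j k. v j i k = v i j k" "\<And>i j k. v i k j = v i j k" and g: "\<And>i j. g j i = g i j"
  shows "(\<Sum>i\<in>UNIV. \<Sum>j\<in>UNIV. \<Sum>k\<in>UNIV. \<Sum>l\<in>UNIV. \<Sum>m\<in>UNIV. \<Sum>n\<in>UNIV. v i j k * v l m n *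
     (g i j * (g k l * g m n + g k m * g l n + g k n * g l m)
    + g i k * (g j l * g m n + g j m * g l n + g j n * g l m)
    + g i l * (g j k * g m n + g j m * g k n + g j n * g k m)
    + g i m * (g j k * g l n + g j l * g k n + g j n * g k l)
    + g i n * (g j k * g l m + g j l * g k m + g j m * g k l)))
    = 9 * (\<Sum>i\<in>UNIV. \<Sum>j\<in>UNIV. \<Sum>k\<in>UNIV. \<Sum>l\<in>UNIV. \<Sum>m\<in>UNIV. \<Sum>n\<in>UNIV. v i j k * v l m n * g i j * g k l * g m n)
    + 6 * (\<Sum>i\<in>UNIV. \<Sum>j\<in>UNIV. \<Sum>k\<in>UNIV. \<Sum>l\<in>UNIV. \<Sum>m\<in>UNIV. \<Sum>n\<in>UNIV. v i j k * v l m n * g i l * g j m * g k n)"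
proof -
  define \<Phi> where "\<Phi> a = (\<Sum>i\<in>UNIV. \<Sum>j\<in>UNIV. \<Sum>k\<in>UNIV. \<Sum>l\<in>UNIV. \<Sum>m\<in>UNIV. \<Sum>n\<in>UNIV. v i j k * v l m n * a i j k l m n)" for a
  have s12: "\<Phi> (\<lambda>i j k l m n. a j i k l m n) = \<Phi> a" for a
    unfolding \<Phi>_def by (subst sum.swap) (simp add: v(1))
  have s23: "\<Phi> (\<lambda>i j k l m n. a i k j l m n) = \<Phi> a" for a
    unfolding \<Phi>_def by (rule sum.cong[OF refl], subst sum.swap, simp add: v(2))
  have s45: "\<Phi> (\<lambda>i j k l m n. a i j k m l n) = \<Phi> a" for a
    unfolding \<Phi>_def by (rule sum.cong[OF refl], rule sum.cong[OF refl], rule sum.cong[OF refl], subst sum.swap, simp add: v(1))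
  have s56: "\<Phi> (\<lambda>i j k l m n. a i j k l n m) = \<Phi> a" for a
    unfolding \<Phi>_def by (rule sum.cong[OF refl], rule sum.cong[OF refl], rule sum.cong[OF refl], rule sum.cong[OF refl], subst sum.swap, simp add: v(2))
  have add: "\<Phi> (\<lambda>i j k l m n. a i j k l m n + b i j k l m n) = \<Phi> a + \<Phi> b" for a b
    unfolding \<Phi>_def by (simp add: sum.distrib distrib_left)
  \<comment> \<open>Conjugation: (1 3) = (1 2)(2 3)(1 2), and likewise for (4 6) below.\<close>
  have s13: "\<Phi> (\<lambda>i j k l m n. a k j i l m n) = \<Phi> a" for a
    using s12[of "\<lambda>i j k l m n. a k i j l m n"] s23[of "\<lambda>i j k l m n. a j i k l m n"] s12[of a] by simp
  have s46: "\<Phi> (\<lambda>i j k l m n. a i j k n m l) = \<Phi> a" for a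
    using s45[of "\<lambda>i j k l m n. a i j k n l m"] s56[of "\<lambda>i j k l m n. a i j k m l n"] s45[of a] by simp
  let ?A = "\<lambda>i j k l m n. g i j * (g k l * g m n)"
  let ?B = "\<lambda>i j k l m n. g i l * (g j m * g k n)"
  have A: "\<Phi> (\<lambda>i j k l m n. g i j * (g k m * g l n)) = \<Phi> ?A"
    "\<Phi> (\<lambda>i j k l m n. g i j * (g k n * g l m)) = \<Phi> ?A"
    using s45[of ?A] s46[of ?A] by (simp_all add: g)
  have A2: "\<Phi> (\<lambda>i j k l m n. g i k * (g j l * g m n)) = \<Phi> ?A"
    "\<Phi> (\<lambda>i j k l m n. g i k * (g j m * g l n)) = \<Phi> ?A"
    "\<Phi> (\<lambda>i j k l m n. g i k * (g j n * g l m)) = \<Phi> ?A"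
    using s23[of ?A] s23[of "\<lambda>i j k l m n. g i j * (g k m * g l n)"] s23[of "\<lambda>i j k l m n. g i j * (g k n * g l m)"] A
    by simp_all
  have A3: "\<Phi> (\<lambda>i j k l m n. g i l * (g j k * g m n)) = \<Phi> ?A"
    "\<Phi> (\<lambda>i j k l m n. g i m * (g j k * g l n)) = \<Phi> ?A"
    "\<Phi> (\<lambda>i j k l m n. g i n * (g j k * g l m)) = \<Phi> ?A"
    using s13[of ?A] s13[of "\<lambda>i j k l m n. g i j * (g k m * g l n)"] s13[of "\<lambda>i j k l m n. g i j * (g k n * g l m)"] A
    by (simp_all add: g mult.left_commute)
  have B1: "\<Phi> (\<lambda>i j k l m n. g i l * (g j n * g k m)) = \<Phi> ?B"
    using s56[of ?B] by simp
  have B2: "\<Phi> (\<lambda>i j k l m n. g i m * (g j l * g k n)) = \<Phi> ?B"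
    using s45[of ?B] by simp
  have B3: "\<Phi> (\<lambda>i j k l m n. g i n * (g j m * g k l)) = \<Phi> ?B"
    using s46[of ?B] by simp
  have B4: "\<Phi> (\<lambda>i j k l m n. g i m * (g j n * g k l)) = \<Phi> ?B"
    using s45[of "\<lambda>i j k l m n. g i l * (g j n * g k m)"] B1 by simp
  have B5: "\<Phi> (\<lambda>i j k l m n. g i n * (g j l * g k m)) = \<Phi> ?B"
    using s46[of "\<lambda>i j k l m n. g i l * (g j n * g k m)"] B1 by simp
  have "\<Phi> (\<lambda>i j k l m n. g i j * (g k l * g m n + g k m * g l n + g k n * g l m)
    + g i k * (g j l * g m n + g j m * g l n + g j n * g l m)
    + g i l * (g j k * g m n + g j m * g k n + g j n * g k m)
    + g i m * (g j k * g l n + g j l * g k n + g j n * g k l)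
    + g i n * (g j k * g l m + g j l * g k m + g j m * g k l)) = 9 * \<Phi> ?A + 6 * \<Phi> ?B"
    unfolding distrib_left add A A2 A3 B1 B2 B3 B4 B5 by simp
  then show ?thesis unfolding \<Phi>_def by (simp add: mult_ac)
qed

text \<open>Asking for all monomial multiples makes the property pass from p to its products with
  coordinates.\<close>

definition gauss_integrable :: "real^'d::finite^'d \<Rightarrow> (real^'d \<Rightarrow> real) \<Rightarrow> bool" where
  "gauss_integrable A p \<longleftrightarrow> (\<forall>js. integrable lborel (\<lambda>y. quad_gauss A y * (p y * coord_prod js y)))"

text \<open>Stating integrability of polynomials through multipliers makes it closed under products.\<close>

definition gauss_multiplier :: "real^'d::finite^'d \<Rightarrow> (real^'d \<Rightarrow> real) \<Rightarrow> bool" where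
  "gauss_multiplier A f \<longleftrightarrow> (\<forall>p. gauss_integrable A p \<longrightarrow> gauss_integrable A (\<lambda>y. f y * p y))"

lemma gauss_multiplier_const: "gauss_multiplier A (\<lambda>_. c)"
  unfolding gauss_multiplier_def gauss_integrable_def by (simp add: mult.left_commute mult.assoc)

lemma gauss_multiplier_coord: "gauss_multiplier A (\<lambda>y. y $ i)"
  unfolding gauss_multiplier_def gauss_integrable_def
proof (intro allI impI)
  fix p js assume "\<forall>js. integrable lborel (\<lambda>y. quad_gauss A y * (p y * coord_prod js y))"
  then have "integrable lborel (\<lambda>y. quad_gauss A y * (p y * coord_prod (i # js) y))" by blast
  then show "integrable lborel (\<lambda>y. quad_gauss A y * (y $ i * p y * coord_prod js y))"
    by (simp add: coord_prod_def mult_ac)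
qed

lemma gauss_multiplier_add:
  "gauss_multiplier A f \<Longrightarrow> gauss_multiplier A h \<Longrightarrow> gauss_multiplier A (\<lambda>y. f y + h y)"
  unfolding gauss_multiplier_def gauss_integrable_def by (simp add: distrib_left distrib_right)

lemma gauss_multiplier_mult:
  "gauss_multiplier A f \<Longrightarrow> gauss_multiplier A h \<Longrightarrow> gauss_multiplier A (\<lambda>y. f y * h y)"
  unfolding gauss_multiplier_def by (simp add: mult.assoc)

lemma gauss_multiplier_diff:
  "gauss_multiplier A f \<Longrightarrow> gauss_multiplier A h \<Longrightarrow> gauss_multiplier A (\<lambda>y. f y - h y)"
  using gauss_multiplier_add[of A f "\<lambda>y. (-1) * h y"] gauss_multiplier_mult[OF gauss_multiplier_const[of A "-1"], of h]
  by simp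

lemma gauss_multiplier_uminus: "gauss_multiplier A f \<Longrightarrow> gauss_multiplier A (\<lambda>y. - f y)"
  using gauss_multiplier_diff[OF gauss_multiplier_const[of A 0], of f] by simp

lemma gauss_multiplier_power: "gauss_multiplier A f \<Longrightarrow> gauss_multiplier A (\<lambda>y. f y ^ n)"
  by (induction n) (auto intro: gauss_multiplier_const gauss_multiplier_mult)

lemma gauss_multiplier_divide: "gauss_multiplier A f \<Longrightarrow> gauss_multiplier A (\<lambda>y. f y / c)"
  using gauss_multiplier_mult[OF _ gauss_multiplier_const[of A "1 / c"], of f] by simp

lemma gauss_multiplier_sum:
  "(\<And>i. i \<in> I \<Longrightarrow> gauss_multiplier A (f i)) \<Longrightarrow> gauss_multiplier A (\<lambda>y. \<Sum>i\<in>I. f i y)"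
  by (induction I rule: infinite_finite_induct) (auto intro: gauss_multiplier_const gauss_multiplier_add)

lemma gauss_multiplier_dirD: "gauss_multiplier A (\<lambda>y. dirD k f y x)"
  by (induction k arbitrary: f)
     (auto intro!: gauss_multiplier_const gauss_multiplier_sum gauss_multiplier_mult gauss_multiplier_coord)

lemmas gauss_multiplier_intros = gauss_multiplier_const gauss_multiplier_add gauss_multiplier_diff
  gauss_multiplier_mult gauss_multiplier_uminus gauss_multiplier_power gauss_multiplier_divide gauss_multiplier_dirD

section \<open>Gaussian integrals of the expansion coefficients\<close>

lemma coord_prod_2: "y $ i * y $ j = coord_prod [i, j] y"
  and coord_prod_4: "y $ i * y $ j * y $ k * y $ l = coord_prod [i, j, k, l] y"
  by (simp_all add: coord_prod_def mult_ac)

lemma dirD_3_times_dirD_1: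
  assumes "Ck 3 u"
  shows "dirD 3 u y x * dirD 1 r y x =
    (\<Sum>i\<in>UNIV. \<Sum>j\<in>UNIV. \<Sum>k\<in>UNIV. \<Sum>l\<in>UNIV. (pd [i, j, k] u x * pd [l] r x) * coord_prod [i, j, k, l] y)"
  unfolding dirD_3[OF assms] dirD_1 sum_distrib_right unfolding sum_distrib_left
  by (intro sum.cong refl) (simp add: coord_prod_def)

lemma dirD_3_squared:
  assumes "Ck 3 u"
  shows "(dirD 3 u y x)\<^sup>2 =
    (\<Sum>i\<in>UNIV. \<Sum>j\<in>UNIV. \<Sum>k\<in>UNIV. \<Sum>l\<in>UNIV. \<Sum>m\<in>UNIV. \<Sum>n\<in>UNIV.
      (pd [i, j, k] u x * pd [l, m, n] u x) * coord_prod [i, j, k, l, m, n] y)"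
  unfolding power2_eq_square dirD_3[OF assms] sum_distrib_right unfolding sum_distrib_left
  by (intro sum.cong refl) (simp add: coord_prod_def)

text \<open>The arguments of \<open>phase_poly\<close> are the values at s = 0 of the derivatives of
  the phase, so u enters P 2 through D^3 u/6 and D^4 u/12. Since P 2 is a second derivative and not
  yet a Taylor coefficient, its integral carries the factor 2.\<close>

theorem gauss_phase_poly_integrals:
  fixes u r :: "real^'d::finite \<Rightarrow> real" and x :: "real^'d"
  assumes sym: "transpose A = A" and pos: "\<And>y. y \<noteq> 0 \<Longrightarrow> y \<bullet> (A *v y) > 0"
    and u: "Ck 4 u" and r: "Ck 2 r"
  defines "g \<equiv> (\<lambda>i j. matrix_inv A $ i $ j)" and "v \<equiv> (\<lambda>is. pd is u x)"
  defines "main1 \<equiv> 1/2 * (\<Sum>i\<in>UNIV. \<Sum>j\<in>UNIV. g i j * pd [i, j] r x)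
             - 1/2 * (\<Sum>i\<in>UNIV. \<Sum>j\<in>UNIV. \<Sum>k\<in>UNIV. \<Sum>l\<in>UNIV.
                 v [j, k, l] * g i j * g k l * pd [i] r x)
             + 1/8 * r x * (\<Sum>i\<in>UNIV. \<Sum>j\<in>UNIV. \<Sum>k\<in>UNIV. \<Sum>l\<in>UNIV. \<Sum>m\<in>UNIV. \<Sum>n\<in>UNIV.
                 v [i, j, k] * v [l, m, n] * g i j * g k l * g m n)
             + 1/12 * r x * (\<Sum>i\<in>UNIV. \<Sum>j\<in>UNIV. \<Sum>k\<in>UNIV. \<Sum>l\<in>UNIV. \<Sum>m\<in>UNIV. \<Sum>n\<in>UNIV.
                 v [i, j, k] * v [l, m, n] * g i l * g j m * g k n)
             - 1/8 * r x * (\<Sum>i\<in>UNIV. \<Sum>j\<in>UNIV. \<Sum>k\<in>UNIV. \<Sum>l\<in>UNIV.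
                 v [i, j, k, l] * g i j * g k l)"
  defines "P \<equiv> (\<lambda>m y. phase_poly m (\<lambda>k. dirD (k + 2) u y x / (real (k + 1) * real (k + 2))) (\<lambda>k. dirD k r y x))"
  shows "det A > 0"
    and "\<And>m. m < 4 \<Longrightarrow> integrable lborel (\<lambda>y. quad_gauss A y * P m y)"
    and "(\<integral>y. quad_gauss A y * P 0 y \<partial>lborel) = r x / sqrt (det A)"
    and "(\<integral>y. quad_gauss A y * P 2 y \<partial>lborel) = 2 * main1 / sqrt (det A)"
proof -
  note isserlis = isserlis[OF sym pos, folded g_def]
  obtain E where E: "E [] = 1" "\<And>i js. E (i # js) = wick_pairing g E i [] js"
    and int: "\<And>js. has_bochner_integral lborel (\<lambda>y. quad_gauss A y * coord_prod js y) (E js / sqrt (det A))"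
    using isserlis(1) by blast
  have dA: "det A > 0" by (rule isserlis(2))
  have gs: "g i j = g j i" for i j unfolding g_def by (rule isserlis(3))
  show "det A > 0" by (rule dA)
  have gi: "gauss_integrable A (\<lambda>_. 1)"
    unfolding gauss_integrable_def using int by (simp add: has_bochner_integral_iff)
  show "integrable lborel (\<lambda>y. quad_gauss A y * P m y)" if "m < 4" for m
  proof -
    have "m = 0 \<or> m = 1 \<or> m = 2 \<or> m = 3" using that by auto
    then have "gauss_multiplier A (P m)"
      unfolding P_def by (elim disjE; hypsubst) (unfold phase_poly_simps, (intro gauss_multiplier_intros)+)
    then have "gauss_integrable A (\<lambda>y. P m y * 1)"
      using gi unfolding gauss_multiplier_def by blast
    then show ?thesis
      unfolding gauss_integrable_def by (drule_tac spec[of _ "[]"]) (simp add: coord_prod_def)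
  qed
  have "P 0 y = r x" for y by (simp add: P_def phase_poly_simps)
  then show "(\<integral>y. quad_gauss A y * P 0 y \<partial>lborel) = r x / sqrt (det A)"
    using int[of "[]", THEN has_bochner_integral_integral_eq] by (simp add: coord_prod_def E)
  have cm: "has_bochner_integral lborel (\<lambda>y. quad_gauss A y * (c * F y)) (c * I)"
    if "has_bochner_integral lborel (\<lambda>y. quad_gauss A y * F y) I" for c F I
    using has_bochner_integral_mult_right[of c lborel "\<lambda>y. quad_gauss A y * F y" I] that
    by (simp add: mult.left_commute)
  have sm: "has_bochner_integral lborel (\<lambda>y. quad_gauss A y * (\<Sum>i\<in>UNIV. F i y)) (\<Sum>i\<in>UNIV. I i)"
    if "\<And>i. has_bochner_integral lborel (\<lambda>y. quad_gauss A y * F i y) (I i)" for F :: "'d \<Rightarrow> _" and I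
    unfolding sum_distrib_left by (rule has_bochner_integral_sum) (rule that)
  let ?N = "1 / sqrt (det A)"
  have E2: "E [i, j] = g i j" for i j by (simp add: E)
  have E4: "E [i, j, k, l] = g i j * g k l + g i k * g j l + g i l * g j k" for i j k l
    by (simp add: E add.assoc)
  have E6: "E [i, j, k, l, m, n] = g i j * (g k l * g m n + g k m * g l n + g k n * g l m)
    + g i k * (g j l * g m n + g j m * g l n + g j n * g l m)
    + g i l * (g j k * g m n + g j m * g k n + g j n * g k m)
    + g i m * (g j k * g l n + g j l * g k n + g j n * g k l)
    + g i n * (g j k * g l m + g j l * g k m + g j m * g k l)" for i j k l m n
    by (simp add: E add.assoc)
  have Ck3: "Ck 3 u" using u by (rule Ck_antimono) simp
  have v3: "v [j, i, k] = v [i, j, k]" "v [i, k, j] = v [i, j, k]" for i j k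
    unfolding v_def by (rule fun_cong[OF pd_cong_mset], simp, use Ck3 in \<open>simp add: numeral_3_eq_3 del: Ck.simps\<close>)+
  have v4: "v [i, k, j, l] = v [i, j, k, l]" "v [i, j, l, k] = v [i, j, k, l]" for i j k l
    unfolding v_def by (rule fun_cong[OF pd_cong_mset], simp, use u in \<open>simp add: eval_nat_numeral del: Ck.simps\<close>)+
  define S1 where "S1 = (\<Sum>i\<in>UNIV. \<Sum>j\<in>UNIV. g i j * pd [i, j] r x)"
  define S2 where "S2 = (\<Sum>i\<in>UNIV. \<Sum>j\<in>UNIV. \<Sum>k\<in>UNIV. \<Sum>l\<in>UNIV. v [j, k, l] * g i j * g k l * pd [i] r x)"
  define S3 where "S3 = (\<Sum>i\<in>UNIV. \<Sum>j\<in>UNIV. \<Sum>k\<in>UNIV. \<Sum>l\<in>UNIV. \<Sum>m\<in>UNIV. \<Sum>n\<in>UNIV.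
                 v [i, j, k] * v [l, m, n] * g i j * g k l * g m n)"
  define S4 where "S4 = (\<Sum>i\<in>UNIV. \<Sum>j\<in>UNIV. \<Sum>k\<in>UNIV. \<Sum>l\<in>UNIV. \<Sum>m\<in>UNIV. \<Sum>n\<in>UNIV.
                 v [i, j, k] * v [l, m, n] * g i l * g j m * g k n)"
  define S5 where "S5 = (\<Sum>i\<in>UNIV. \<Sum>j\<in>UNIV. \<Sum>k\<in>UNIV. \<Sum>l\<in>UNIV. v [i, j, k, l] * g i j * g k l)"
  have 1: "has_bochner_integral lborel (\<lambda>y. quad_gauss A y * dirD 2 r y x) (S1 * ?N)"
  proof -
    have "has_bochner_integral lborel (\<lambda>y. quad_gauss A y * dirD 2 r y x)
      (\<Sum>i\<in>UNIV. \<Sum>j\<in>UNIV. pd [i, j] r x * (E [i, j] / sqrt (det A)))"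
      unfolding dirD_2[OF r] coord_prod_2 by (intro sm cm int)
    then show ?thesis by (simp add: E2 S1_def sum_divide_distrib mult_ac)
  qed
  have 2: "has_bochner_integral lborel (\<lambda>y. quad_gauss A y * (dirD 3 u y x * dirD 1 r y x)) (3 * S2 * ?N)"
  proof -
    have "has_bochner_integral lborel (\<lambda>y. quad_gauss A y * (dirD 3 u y x * dirD 1 r y x))
      (\<Sum>i\<in>UNIV. \<Sum>j\<in>UNIV. \<Sum>k\<in>UNIV. \<Sum>l\<in>UNIV. (v [i, j, k] * pd [l] r x) * (E [i, j, k, l] / sqrt (det A)))"
      unfolding dirD_3_times_dirD_1[OF Ck3] v_def by (intro sm cm int)
    also have "(\<Sum>i\<in>UNIV. \<Sum>j\<in>UNIV. \<Sum>k\<in>UNIV. \<Sum>l\<in>UNIV. (v [i, j, k] * pd [l] r x) * (E [i, j, k, l] / sqrt (det A)))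
      = (\<Sum>i\<in>UNIV. \<Sum>j\<in>UNIV. \<Sum>k\<in>UNIV. \<Sum>l\<in>UNIV. (v [i, j, k] * pd [l] r x) * E [i, j, k, l]) / sqrt (det A)"
      by (simp only: sum_divide_distrib times_divide_eq_right)
    finally show ?thesis
      unfolding E4 S2_def using sum_pairings_31[of "\<lambda>i j k. v [i, j, k]" g "\<lambda>l. pd [l] r x", OF v3 gs] by simp
  qed
  have 3: "has_bochner_integral lborel (\<lambda>y. quad_gauss A y * (dirD 3 u y x)\<^sup>2) ((9 * S3 + 6 * S4) * ?N)"
  proof -
    have "has_bochner_integral lborel (\<lambda>y. quad_gauss A y * (dirD 3 u y x)\<^sup>2)
      (\<Sum>i\<in>UNIV. \<Sum>j\<in>UNIV. \<Sum>k\<in>UNIV. \<Sum>l\<in>UNIV. \<Sum>m\<in>UNIV. \<Sum>n\<in>UNIV. (v [i, j, k] * v [l, m, n]) * (E [i, j, k, l, m, n] / sqrt (det A)))"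
      unfolding dirD_3_squared[OF Ck3] v_def by (intro sm cm int)
    also have "(\<Sum>i\<in>UNIV. \<Sum>j\<in>UNIV. \<Sum>k\<in>UNIV. \<Sum>l\<in>UNIV. \<Sum>m\<in>UNIV. \<Sum>n\<in>UNIV. (v [i, j, k] * v [l, m, n]) * (E [i, j, k, l, m, n] / sqrt (det A)))
      = (\<Sum>i\<in>UNIV. \<Sum>j\<in>UNIV. \<Sum>k\<in>UNIV. \<Sum>l\<in>UNIV. \<Sum>m\<in>UNIV. \<Sum>n\<in>UNIV. (v [i, j, k] * v [l, m, n]) * E [i, j, k, l, m, n]) / sqrt (det A)"
      by (simp only: sum_divide_distrib times_divide_eq_right)
    finally show ?thesis
      unfolding E6 S3_def S4_def using sum_pairings_33[of "\<lambda>i j k. v [i, j, k]" g, OF v3 gs] by simp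
  qed
  have 4: "has_bochner_integral lborel (\<lambda>y. quad_gauss A y * dirD 4 u y x) (3 * S5 * ?N)"
  proof -
    have "has_bochner_integral lborel (\<lambda>y. quad_gauss A y * dirD 4 u y x)
      (\<Sum>i\<in>UNIV. \<Sum>j\<in>UNIV. \<Sum>k\<in>UNIV. \<Sum>l\<in>UNIV. v [i, j, k, l] * (E [i, j, k, l] / sqrt (det A)))"
      unfolding dirD_4[OF u] coord_prod_4 v_def by (intro sm cm int)
    also have "(\<Sum>i\<in>UNIV. \<Sum>j\<in>UNIV. \<Sum>k\<in>UNIV. \<Sum>l\<in>UNIV. v [i, j, k, l] * (E [i, j, k, l] / sqrt (det A)))
      = (\<Sum>i\<in>UNIV. \<Sum>j\<in>UNIV. \<Sum>k\<in>UNIV. \<Sum>l\<in>UNIV. v [i, j, k, l] * E [i, j, k, l]) / sqrt (det A)"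
      by (simp only: sum_divide_distrib times_divide_eq_right)
    finally show ?thesis
      unfolding E4 S5_def using sum_pairings_4[of "\<lambda>i j k l. v [i, j, k, l]" g, OF v4] by simp
  qed
  have P2: "quad_gauss A y * P 2 y = quad_gauss A y * dirD 2 r y x - quad_gauss A y * (1/3 * (dirD 3 u y x * dirD 1 r y x))
     + quad_gauss A y * (r x / 36 * (dirD 3 u y x)\<^sup>2) - quad_gauss A y * (r x / 12 * dirD 4 u y x)" for y
  proof -
    have eq: "P 2 y = dirD 2 r y x - 2 * (dirD 3 u y x / 6) * dirD 1 r y x + ((dirD 3 u y x / 6)\<^sup>2 - dirD 4 u y x / 12) * r x"
    proof -
      have n: "(1::nat) + 2 = 3" "(2::nat) + 2 = 4" by simp_all
      show ?thesis unfolding P_def phase_poly_simps n by (simp del: dirD.simps(2))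
    qed
    show ?thesis unfolding eq by (simp add: power2_eq_square algebra_simps del: dirD.simps)
  qed
  \<comment> \<open>S1 to S5 acquire the weights 1, -1, 1/4, 1/6, -1/4 (the last three times r x),
    twice the coefficients in \<open>main1\<close>: the 3, 9, 6 and 3 count equivalent
    pairings.\<close>
  have "has_bochner_integral lborel (\<lambda>y. quad_gauss A y * P 2 y)
     (S1 * ?N - 1/3 * (3 * S2 * ?N) + r x / 36 * ((9 * S3 + 6 * S4) * ?N) - r x / 12 * (3 * S5 * ?N))"
    unfolding P2 by (intro has_bochner_integral_add has_bochner_integral_diff cm 1 2 3 4)
  then have "(\<integral>y. quad_gauss A y * P 2 y \<partial>lborel) = S1 * ?N - 1/3 * (3 * S2 * ?N) + r x / 36 * ((9 * S3 + 6 * S4) * ?N) - r x / 12 * (3 * S5 * ?N)"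
    by (rule has_bochner_integral_integral_eq)
  also have "\<dots> = 2 * main1 * ?N"
    unfolding main1_def S1_def[symmetric] S2_def[symmetric] S3_def[symmetric] S4_def[symmetric] S5_def[symmetric]
    by (simp add: algebra_simps add_divide_distrib diff_divide_distrib)
  finally show "(\<integral>y. quad_gauss A y * P 2 y \<partial>lborel) = 2 * main1 / sqrt (det A)" by simp
qed

section \<open>The rescaled integrand\<close>

lemma has_bochner_integral_dilation:
  fixes h :: "real^'d::finite \<Rightarrow> real"
  assumes [measurable]: "h \<in> borel_measurable borel" and c: "c > 0"
    and "has_bochner_integral lborel (\<lambda>y. h (x + c *\<^sub>R y)) I"
  shows "has_bochner_integral lborel h (c ^ CARD('d) * I)"
proof -
  have lb: "(lborel :: (real^'d) measure) = density (distr lborel borel (\<lambda>y. x + c *\<^sub>R y)) (\<lambda>_. ennreal (c ^ CARD('d)))"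
    using lborel_affine[of c x] c by simp
  have "has_bochner_integral (density (distr lborel borel (\<lambda>y. x + c *\<^sub>R y)) (\<lambda>_. ennreal (c ^ CARD('d)))) h (c ^ CARD('d) * I)"
    by (rule has_bochner_integral_density)
       (use assms in \<open>auto intro!: has_bochner_integral_distr has_bochner_integral_mult_right\<close>)
  then show ?thesis unfolding lb[symmetric] .
qed

definition phase :: "(real^'d \<Rightarrow> real) \<Rightarrow> real^'d \<Rightarrow> real^'d \<Rightarrow> nat \<Rightarrow> real \<Rightarrow> real" where
  "phase u x y k = hat_integral k (\<lambda>s. dirD (k + 2) u y (x + s *\<^sub>R y))"

lemma DERIV_phase:
  assumes "Ck 6 u" "k < 4"
  shows "(phase u x y k has_real_derivative phase u x y (Suc k) s) (at s)"
proof -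
  have C: "Ck (Suc (k + 2)) u" using assms by (intro Ck_antimono[OF assms(1)]) auto
  have "continuous_on UNIV (\<lambda>s. dirD (Suc (k + 2)) u y (x + s *\<^sub>R y))"
    by (rule continuous_on_dirD[OF C]) (intro continuous_intros)+
  from DERIV_hat_integral[OF DERIV_dirD[OF C] this] show ?thesis
    unfolding phase_def by simp
qed

lemma phase_at_0: "phase u x y k 0 = dirD (k + 2) u y x / (real (k + 1) * real (k + 2))"
  unfolding phase_def by (simp add: hat_integral_0)

lemma phase_eq:
  fixes u :: "real^'d \<Rightarrow> real"
  assumes u: "Ck 2 u" and x: "u x = 0" "\<And>z. u z \<ge> 0"
  shows "s\<^sup>2 * phase u x y 0 s = u (x + s *\<^sub>R y)"
proof -
  have D0: "((\<lambda>s. dirD 0 u y (x + s *\<^sub>R y)) has_real_derivative dirD 1 u y (x + s *\<^sub>R y)) (at s)" for s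
    using DERIV_dirD[of 0 u y x s] Ck_antimono[OF u, of "Suc 0"] by (simp del: dirD.simps Ck.simps)
  have D1: "((\<lambda>s. dirD 1 u y (x + s *\<^sub>R y)) has_real_derivative dirD 2 u y (x + s *\<^sub>R y)) (at s)" for s
    using DERIV_dirD[of 1 u y x s] u by (simp add: numeral_2_eq_2 del: dirD.simps Ck.simps)
  \<comment> \<open>u has a minimum at x, so its derivative along every line through x vanishes
    there.\<close>
  have "dirD 1 u y (x + 0 *\<^sub>R y) = 0"
    by (rule DERIV_local_min[OF D0, of 1]) (use x in auto)
  then show ?thesis
    unfolding phase_def add_0 using taylor_hat_integral[OF D0 D1, of s] x(1)
    by (simp del: dirD.simps(2))
qed

text \<open>For nonzero s this is the growth hypothesis divided by s^2; s = 0 follows by continuity.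
  The case s = 0 also yields the positive definiteness of the Hessian.\<close>

lemma phase_ge:
  fixes u :: "real^'d \<Rightarrow> real"
  assumes u: "Ck 6 u" and x: "u x = 0" "\<And>z. u z \<ge> l / 2 * (norm (z - x))\<^sup>2" and l: "l > 0"
  shows "l / 2 * (norm y)\<^sup>2 \<le> phase u x y 0 s"
proof -
  have u0: "u z \<ge> 0" for z
  proof -
    have "0 \<le> l / 2 * (norm (z - x))\<^sup>2" using l by simp
    then show ?thesis using x(2)[of z] by (rule order_trans)
  qed
  have u2: "Ck 2 u" using u by (rule Ck_antimono) simp
  have ge: "l / 2 * (norm y)\<^sup>2 \<le> phase u x y 0 s" if "s \<noteq> 0" for s
  proof -
    have "s\<^sup>2 * (l / 2 * (norm y)\<^sup>2) \<le> s\<^sup>2 * phase u x y 0 s"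
      unfolding phase_eq[OF u2 x(1) u0] using x(2)[of "x + s *\<^sub>R y"] by (simp add: power_mult_distrib mult_ac)
    then show ?thesis using that by (simp add: mult_le_cancel_left_pos)
  qed
  show ?thesis
  proof (cases "s = 0")
    case True
    have "isCont (phase u x y 0) 0" using DERIV_phase[OF u, of 0] by (intro DERIV_isCont) auto
    then have "(phase u x y 0 \<longlongrightarrow> phase u x y 0 0) (at 0)" by (simp add: isCont_def)
    moreover have "\<forall>\<^sub>F s in at 0. l / 2 * (norm y)\<^sup>2 \<le> phase u x y 0 s"
      by (rule eventually_at_topological[THEN iffD2]) (use ge in auto)
    ultimately show ?thesis unfolding True by (rule tendsto_lowerbound) simp
  qed (rule ge)
qed

text \<open>If u and its gradient vanish at x, this is for m <= 4 the m-th s-derivative of exp (- u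
  (x + s y)/s^2) r (x + s y), extended to s = 0.\<close>

definition profile :: "(real^'d \<Rightarrow> real) \<Rightarrow> (real^'d \<Rightarrow> real) \<Rightarrow> real^'d \<Rightarrow> nat \<Rightarrow> real \<Rightarrow> real^'d \<Rightarrow> real" where
  "profile u r x m s y = exp (- phase u x y 0 s) *
     phase_poly m (\<lambda>k. phase u x y k s) (\<lambda>k. dirD k r y (x + s *\<^sub>R y))"

lemma DERIV_profile:
  assumes "Ck 6 u" "Ck 4 r" "m < 4"
  shows "((\<lambda>s. profile u r x m s y) has_real_derivative profile u r x (Suc m) s y) (at s)"
  unfolding profile_def
  using assms
  by (intro DERIV_exp_phase_poly DERIV_phase DERIV_dirD Ck_antimono[OF assms(2)]) auto

text \<open>The orders of the factors in every monomial add up to m, so the signs multiply to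
  (-1)^m. Applied to y -> -y: the k-th phase derivative at 0 is homogeneous of degree k + 2 in y,
  hence of parity (-1)^k.\<close>

lemma phase_poly_uminus:
  assumes "m < 4"
  shows "phase_poly m (\<lambda>k. (-1) ^ k * p k) (\<lambda>k. (-1) ^ k * r k) = (-1) ^ m * phase_poly m p r"
proof -
  have "m = 0 \<or> m = 1 \<or> m = 2 \<or> m = 3" using assms by auto
  then show ?thesis
    by (elim disjE; hypsubst) (unfold phase_poly_simps, simp_all add: algebra_simps power3_eq_cube)
qed

lemma profile_0_uminus:
  assumes "m < 4"
  shows "profile u r x m 0 (- y) = (-1) ^ m * profile u r x m 0 y"
proof -
  have "phase u x (- y) k 0 = (-1) ^ k * phase u x y k 0" for k
    unfolding phase_at_0 dirD_uminus by simp
  then show ?thesis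
    unfolding profile_def using phase_poly_uminus[OF assms] by (simp add: dirD_uminus)
qed

lemma integral_odd_eq_0:
  fixes h :: "real^'d::finite \<Rightarrow> real"
  assumes [measurable]: "h \<in> borel_measurable borel" and odd: "\<And>y. h (- y) = - h y"
  shows "(\<integral>y. h y \<partial>lborel) = 0"
proof -
  have "(lborel :: (real^'d) measure) = distr lborel borel uminus"
    using lborel_affine[of "-1" "0 :: real^'d"] by (simp add: density_1)
  then have "(\<integral>y. h y \<partial>lborel) = (\<integral>y. h y \<partial>distr lborel borel uminus)" by simp
  also have "\<dots> = (\<integral>y. h (- y) \<partial>lborel)" by (rule integral_distr) auto
  also have "\<dots> = - (\<integral>y. h y \<partial>lborel)" by (simp add: odd)
  finally show ?thesis by simp
qed

text \<open>Only phase derivatives of orders 1 to 4 occur as factors, and these are averages of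
  derivatives of u of orders 3 to 6, all bounded by M. The powers of d count the terms of the
  directional derivatives.\<close>

lemma abs_profile_4_le:
  fixes u r :: "real^'d::finite \<Rightarrow> real"
  assumes u: "Ck 6 u" and r: "Ck 4 r" and x: "u x = 0" "\<And>z. u z \<ge> l / 2 * (norm (z - x))\<^sup>2" and l: "l > 0"
    and M: "1 \<le> M" "\<And>k z. 3 \<le> k \<Longrightarrow> k \<le> 6 \<Longrightarrow> D_abs k u z \<le> M"
  shows "\<bar>profile u r x 4 s y\<bar> \<le> 52 * (real CARD('d) ^ 6 * M) ^ 4 * real CARD('d) ^ 4 *
     (radial_weight l (norm y) * D_abs_le 4 r (x + s *\<^sub>R y))"
proof -
  let ?d = "real CARD('d)" and ?n = "norm y"
  let ?B = "?d ^ 6 * M" and ?F = "?d ^ 4 * D_abs_le 4 r (x + s *\<^sub>R y)"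
  have d: "1 \<le> ?d" by (simp add: Suc_leI)
  have p: "\<bar>phase u x y k s\<bar> \<le> ?B * ?n ^ (k + 2)" if k: "1 \<le> k" "k \<le> 4" for k
  proof -
    have C: "Ck (k + 2) u" using k by (intro Ck_antimono[OF u]) auto
    have "\<bar>phase u x y k s\<bar> \<le> (?d * ?n) ^ (k + 2) * M"
      unfolding phase_def
    proof (rule abs_hat_integral_le)
      show "continuous_on UNIV (\<lambda>s. dirD (k + 2) u y (x + s *\<^sub>R y))"
        by (rule continuous_on_dirD[OF C]) (intro continuous_intros)+
      fix s
      have "\<bar>dirD (k + 2) u y (x + s *\<^sub>R y)\<bar> \<le> (?d * ?n) ^ (k + 2) * D_abs (k + 2) u (x + s *\<^sub>R y)"
        by (rule abs_dirD_le_D_abs[OF C])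
      also have "\<dots> \<le> (?d * ?n) ^ (k + 2) * M"
        using k by (intro mult_left_mono M) auto
      finally show "\<bar>dirD (k + 2) u y (x + s *\<^sub>R y)\<bar> \<le> (?d * ?n) ^ (k + 2) * M" .
    qed
    also have "\<dots> = ?d ^ (k + 2) * (M * ?n ^ (k + 2))" by (simp only: power_mult_distrib mult_ac)
    also have "\<dots> \<le> ?d ^ 6 * (M * ?n ^ (k + 2))"
      using k d M(1) by (intro mult_right_mono power_increasing) auto
    finally show ?thesis by (simp only: mult_ac)
  qed
  have rho: "\<bar>dirD k r y (x + s *\<^sub>R y)\<bar> \<le> ?F * ?n ^ k" if k: "k \<le> 4" for k
  proof -
    have "\<bar>dirD k r y (x + s *\<^sub>R y)\<bar> \<le> (?d * ?n) ^ k * D_abs k r (x + s *\<^sub>R y)"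
      by (rule abs_dirD_le_D_abs[OF Ck_antimono[OF r k]])
    also have "\<dots> \<le> (?d * ?n) ^ k * D_abs_le 4 r (x + s *\<^sub>R y)"
      by (intro mult_left_mono D_abs_le_D_abs_le k) auto
    also have "\<dots> = ?d ^ k * (D_abs_le 4 r (x + s *\<^sub>R y) * ?n ^ k)" by (simp only: power_mult_distrib mult_ac)
    also have "\<dots> \<le> ?d ^ 4 * (D_abs_le 4 r (x + s *\<^sub>R y) * ?n ^ k)"
      using k d by (intro mult_right_mono power_increasing) (auto simp: D_abs_le_nonneg)
    finally show ?thesis by (simp only: mult_ac)
  qed
  have B: "1 \<le> ?B" using d M(1) mult_mono[of 1 "?d ^ 6" 1 M] by (simp add: one_le_power)
  have F: "0 \<le> ?F" by (simp add: D_abs_le_nonneg)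
  have "\<bar>phase_poly 4 (\<lambda>k. phase u x y k s) (\<lambda>k. dirD k r y (x + s *\<^sub>R y))\<bar> \<le> 52 * (?B ^ 4 * (?n ^ 4 * (1 + ?n) ^ 8) * ?F)"
    by (rule abs_phase_poly_4_le[OF p rho B _ F]) auto
  moreover have "exp (- phase u x y 0 s) \<le> exp (- l * ?n\<^sup>2 / 2)"
    using phase_ge[OF u x l, of y s] by simp
  ultimately have "\<bar>profile u r x 4 s y\<bar> \<le> exp (- l * ?n\<^sup>2 / 2) * (52 * (?B ^ 4 * (?n ^ 4 * (1 + ?n) ^ 8) * ?F))"
    unfolding profile_def abs_mult by (intro mult_mono) auto
  then show ?thesis by (simp add: radial_weight_def mult_ac)
qed

section \<open>Integral of the remainder and the expansion\<close>

definition profile_remainder :: "(real^'d \<Rightarrow> real) \<Rightarrow> (real^'d \<Rightarrow> real) \<Rightarrow> real^'d \<Rightarrow> real \<Rightarrow> real^'d \<Rightarrow> real" where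
  "profile_remainder u r x s y = profile u r x 0 s y - (\<Sum>m<4. s ^ m / fact m * profile u r x m 0 y)"

lemma nn_integral_profile_remainder_le:
  fixes u r :: "real^'d::finite \<Rightarrow> real"
  assumes u: "Ck 6 u" and r: "Ck 4 r" and x: "u x = 0" "\<And>z. u z \<ge> l / 2 * (norm (z - x))\<^sup>2" and l: "l > 0"
    and M: "1 \<le> M" "\<And>k z. 3 \<le> k \<Longrightarrow> k \<le> 6 \<Longrightarrow> D_abs k u z \<le> M" and s: "s > 0"
  shows "(\<integral>\<^sup>+y. ennreal \<bar>profile_remainder u r x s y\<bar> \<partial>lborel) \<le>
    ennreal (s ^ 4 * (52 * (real CARD('d) ^ 6 * M) ^ 4 * real CARD('d) ^ 4 * (exp ((real (CARD('d) + 14))\<^sup>2 / l) * (pi / 2) / sqrt l)))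
      * conv (K_scaled (s\<^sup>2 / l)) (D_abs_le 4 r) x"
proof -
  define c where "c = 52 * (real CARD('d) ^ 6 * M) ^ 4 * real CARD('d) ^ 4"
  have c: "0 \<le> c" using M(1) by (simp add: c_def)
  let ?D = "D_abs_le 4 r"
  let ?w = "\<lambda>y t. radial_weight l (norm y) * ?D (x + (t * s) *\<^sub>R y)"
  have cD: "continuous_on UNIV ?D" by (rule continuous_on_D_abs_le[OF r])
  have [measurable]: "?D \<in> borel_measurable borel" using cD by (intro borel_measurable_continuous_onI)
  have [measurable]: "radial_weight l \<in> borel_measurable borel"
    unfolding radial_weight_def by measurable
  let ?I = "\<lambda>y. \<integral>\<^sup>+t. ennreal (?w y t) * indicator {0..1} t \<partial>lborel"
  have "ennreal \<bar>profile_remainder u r x s y\<bar> \<le> ennreal (s ^ 4 * c) * ?I y" for y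
  proof -
    have "ennreal \<bar>profile_remainder u r x s y\<bar> \<le> ennreal (s ^ 4) * (\<integral>\<^sup>+t. ennreal (c * ?w y t) * indicator {0..1} t \<partial>lborel)"
      unfolding profile_remainder_def
    proof (rule taylor4_bound[where G = "\<lambda>m s. profile u r x m s y"])
      show "((\<lambda>s. profile u r x m s y) has_real_derivative profile u r x (Suc m) s y) (at s)" if "m < 4" for m s
        by (rule DERIV_profile[OF u r that])
      show "\<bar>profile u r x 4 (t * s) y\<bar> \<le> c * ?w y t" for t
        unfolding c_def by (rule abs_profile_4_le[OF u r x l M])
      show "continuous_on {0..1} (\<lambda>t. c * ?w y t)"
        by (intro continuous_intros continuous_on_compose2[OF cD]) auto
    qed
    also have "(\<integral>\<^sup>+t. ennreal (c * ?w y t) * indicator {0..1} t \<partial>lborel) = (\<integral>\<^sup>+t. ennreal c * (ennreal (?w y t) * indicator {0..1} t) \<partial>lborel)"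
      using c by (simp add: ennreal_mult' mult.assoc)
    also have "\<dots> = ennreal c * ?I y"
      by (rule nn_integral_cmult) measurable
    finally show ?thesis using c by (simp add: ennreal_mult mult.assoc)
  qed
  then have "(\<integral>\<^sup>+y. ennreal \<bar>profile_remainder u r x s y\<bar> \<partial>lborel) \<le> (\<integral>\<^sup>+y. ennreal (s ^ 4 * c) * ?I y \<partial>lborel)"
    by (intro nn_integral_mono)
  also have "\<dots> = ennreal (s ^ 4 * c) * (\<integral>\<^sup>+y. ?I y \<partial>lborel)"
    by (rule nn_integral_cmult) measurable
  also have "\<dots> \<le> ennreal (s ^ 4 * c) * (ennreal (exp ((real (CARD('d) + 14))\<^sup>2 / l) * (pi / 2) / sqrt l) * conv (K_scaled (s\<^sup>2 / l)) ?D x)"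
    by (intro mult_left_mono dilation_average_le_conv cD s l) (auto simp: D_abs_le_nonneg)
  also have "\<dots> = ennreal (s ^ 4 * (c * (exp ((real (CARD('d) + 14))\<^sup>2 / l) * (pi / 2) / sqrt l))) * conv (K_scaled (s\<^sup>2 / l)) ?D x"
  proof -
    have "0 \<le> exp ((real (CARD('d) + 14))\<^sup>2 / l) * (pi / 2) / sqrt l" using l by simp
    from ennreal_mult''[OF this, of "s ^ 4 * c"] show ?thesis by (simp only: mult.assoc)
  qed
  finally show ?thesis unfolding c_def .
qed

lemma profile_0_eq_gauss:
  assumes "Ck 2 u"
  shows "profile u r x m 0 y = (2 * pi) powr (real CARD('d) / 2) * (quad_gauss (hessian u x) (y :: real^'d::finite) *
    phase_poly m (\<lambda>k. dirD (k + 2) u y x / (real (k + 1) * real (k + 2))) (\<lambda>k. dirD k r y x))"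
proof -
  have "phase u x y 0 0 = y \<bullet> (hessian u x *v y) / 2"
    unfolding phase_at_0 add_0 dirD_2_hessian[OF assms] by simp
  then show ?thesis
    unfolding profile_def by (simp add: quad_gauss_def phase_at_0)
qed

theorem laplace_expansion:
  fixes u r :: "real^'d::finite \<Rightarrow> real" and x :: "real^'d" and \<epsilon> l M :: real
  assumes u: "Ck 6 u" and r: "Ck 4 r" and x: "u x = 0" "\<And>z. u z \<ge> l / 2 * (norm (z - x))\<^sup>2" and l: "l > 0"
    and M: "1 \<le> M" "\<And>k z. 3 \<le> k \<Longrightarrow> k \<le> 6 \<Longrightarrow> D_abs k u z \<le> M" and \<epsilon>: "\<epsilon> > 0"
  defines "A \<equiv> hessian u x"
  defines "g \<equiv> (\<lambda>i j. matrix_inv A $ i $ j)" and "v \<equiv> (\<lambda>is. pd is u x)"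
  defines "main1 \<equiv> 1/2 * (\<Sum>i\<in>UNIV. \<Sum>j\<in>UNIV. g i j * pd [i, j] r x)
             - 1/2 * (\<Sum>i\<in>UNIV. \<Sum>j\<in>UNIV. \<Sum>k\<in>UNIV. \<Sum>l\<in>UNIV.
                 v [j, k, l] * g i j * g k l * pd [i] r x)
             + 1/8 * r x * (\<Sum>i\<in>UNIV. \<Sum>j\<in>UNIV. \<Sum>k\<in>UNIV. \<Sum>l\<in>UNIV. \<Sum>m\<in>UNIV. \<Sum>n\<in>UNIV.
                 v [i, j, k] * v [l, m, n] * g i j * g k l * g m n)
             + 1/12 * r x * (\<Sum>i\<in>UNIV. \<Sum>j\<in>UNIV. \<Sum>k\<in>UNIV. \<Sum>l\<in>UNIV. \<Sum>m\<in>UNIV. \<Sum>n\<in>UNIV.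
                 v [i, j, k] * v [l, m, n] * g i l * g j m * g k n)
             - 1/8 * r x * (\<Sum>i\<in>UNIV. \<Sum>j\<in>UNIV. \<Sum>k\<in>UNIV. \<Sum>l\<in>UNIV.
                 v [i, j, k, l] * g i j * g k l)"
  defines "W \<equiv> conv (K_scaled (\<epsilon> / l)) (D_abs_le 4 r) x"
  defines "c \<equiv> 52 * (real CARD('d) ^ 6 * M) ^ 4 * real CARD('d) ^ 4 * (exp ((real (CARD('d) + 14))\<^sup>2 / l) * (pi / 2) / sqrt l)"
  assumes W: "W < \<infinity>"
  shows "integrable lborel (laplace_integrand u r \<epsilon>)"
    and "ennreal \<bar>(integral\<^sup>L lborel (laplace_integrand u r \<epsilon>) - 1 / sqrt (det A) * (r x + \<epsilon> * main1)) / \<epsilon>\<^sup>2\<bar>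
      \<le> ennreal (c / (2 * pi) powr (real CARD('d) / 2)) * W"
proof -
  define s where "s = sqrt \<epsilon>"
  have s: "s > 0" "s\<^sup>2 = \<epsilon>" using \<epsilon> by (simp_all add: s_def)
  define Z where "Z = (2 * pi) powr (real CARD('d) / 2)"
  have Z: "Z > 0" by (simp add: Z_def)
  have c: "0 \<le> c" using M(1) l by (simp add: c_def)
  have u2: "Ck 2 u" and u4: "Ck 4 u" and r2: "Ck 2 r"
    using Ck_antimono[OF u, of 2] Ck_antimono[OF u, of 4] Ck_antimono[OF r, of 2] by auto
  have u0: "u z \<ge> 0" for z
  proof -
    have "0 \<le> l / 2 * (norm (z - x))\<^sup>2" using l by simp
    then show ?thesis using x(2)[of z] by (rule order_trans)
  qed
  have sym: "transpose A = A" unfolding A_def by (rule transpose_hessian[OF u2])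
  have pos: "y \<bullet> (A *v y) > 0" if "y \<noteq> 0" for y
  proof -
    have "0 < l / 2 * (norm y)\<^sup>2" using that l by simp
    also have "\<dots> \<le> phase u x y 0 0" by (rule phase_ge[OF u x l])
    finally show ?thesis
      unfolding phase_at_0 add_0 dirD_2_hessian[OF u2] A_def[symmetric] by simp
  qed
  note gauss = gauss_phase_poly_integrals(2-4)[where x = x, OF sym pos u4 r2]
  have P: "profile u r x m 0 = (\<lambda>y. Z * (quad_gauss A y *
     phase_poly m (\<lambda>k. dirD (k + 2) u y x / (real (k + 1) * real (k + 2))) (\<lambda>k. dirD k r y x)))" for m
    unfolding A_def Z_def using profile_0_eq_gauss[OF u2] by blast
  have iP: "integrable lborel (profile u r x m 0)" if "m < 4" for m
    unfolding P by (rule integrable_mult_right, rule gauss(1)[OF _ that])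
  have I0: "(\<integral>y. profile u r x 0 0 y \<partial>lborel) = Z * (r x / sqrt (det A))"
    unfolding P integral_mult_right_zero by (subst gauss(2)) auto
  have I2: "(\<integral>y. profile u r x 2 0 y \<partial>lborel) = Z * (2 * main1 / sqrt (det A))"
    unfolding P integral_mult_right_zero main1_def g_def v_def by (subst gauss(3)) auto
  \<comment> \<open>These are the terms in s and s^3; their vanishing leaves an expansion in powers
    of \<epsilon> = s^2 with error of order s^4.\<close>
  have Iodd: "(\<integral>y. profile u r x m 0 y \<partial>lborel) = 0" if "m < 4" "odd m" for m
    using borel_measurable_integrable[OF iP[OF that(1)]] profile_0_uminus[OF that(1), of u r x] that(2)
    by (intro integral_odd_eq_0) auto
  let ?S = "\<lambda>y. \<Sum>m<4. s ^ m / fact m * profile u r x m 0 y"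
  have iS: "integrable lborel ?S"
    by (intro Bochner_Integration.integrable_sum integrable_mult_right iP) auto
  have IS: "(\<integral>y. ?S y \<partial>lborel) = Z / sqrt (det A) * (r x + \<epsilon> * main1)"
  proof -
    have "(\<integral>y. ?S y \<partial>lborel) = (\<Sum>m<4. s ^ m / fact m * (\<integral>y. profile u r x m 0 y \<partial>lborel))"
      by (subst Bochner_Integration.integral_sum) (auto intro!: integrable_mult_right iP)
    also have "\<dots> = (\<integral>y. profile u r x 0 0 y \<partial>lborel) + s\<^sup>2 / 2 * (\<integral>y. profile u r x 2 0 y \<partial>lborel)"
    proof -
      have "(\<integral>y. profile u r x 1 0 y \<partial>lborel) = 0" "(\<integral>y. profile u r x 3 0 y \<partial>lborel) = 0"
        by (rule Iodd; simp)+
      then show ?thesis by (simp add: numeral_eq_Suc)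
    qed
    finally show ?thesis unfolding I0 I2 s(2) by (simp add: algebra_simps add_divide_distrib)
  qed
  have cr: "continuous_on UNIV r" and cu: "continuous_on UNIV u"
    using Ck_imp_continuous r u by blast+
  have p0: "profile u r x 0 s y = exp (- u (x + s *\<^sub>R y) / \<epsilon>) * r (x + s *\<^sub>R y)" for y
  proof -
    have "phase u x y 0 s = u (x + s *\<^sub>R y) / \<epsilon>"
      using phase_eq[OF u2 x(1) u0, of s y] s \<epsilon> by (simp add: field_simps)
    then show ?thesis by (simp add: profile_def phase_poly_simps)
  qed
  have [measurable]: "r \<in> borel_measurable borel" "u \<in> borel_measurable borel"
    using cr cu by (auto intro: borel_measurable_continuous_onI)
  have mp: "profile u r x 0 s \<in> borel_measurable borel"
    unfolding p0 by measurable
  have rem_le: "(\<integral>\<^sup>+y. ennreal \<bar>profile_remainder u r x s y\<bar> \<partial>lborel) \<le> ennreal (s ^ 4 * c) * W"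
    using nn_integral_profile_remainder_le[OF u r x l M s(1)] unfolding c_def W_def s(2) .
  have mrem: "profile_remainder u r x s \<in> borel_measurable lborel"
    unfolding profile_remainder_def
    using mp borel_measurable_integrable[OF iS] by (intro borel_measurable_diff) auto
  \<comment> \<open>The finite convolution enters here. Together with the integrable Taylor
    polynomial it gives integrability of the integrand itself, without any growth condition on
    r.\<close>
  have irem: "integrable lborel (profile_remainder u r x s)"
  proof (rule integrableI_bounded[OF mrem])
    have "ennreal (s ^ 4 * c) * W < \<infinity>"
      using W by (simp add: ennreal_mult_less_top)
    with rem_le have "(\<integral>\<^sup>+y. ennreal \<bar>profile_remainder u r x s y\<bar> \<partial>lborel) < \<infinity>"
      by (rule le_less_trans)
    then show "(\<integral>\<^sup>+y. ennreal (norm (profile_remainder u r x s y)) \<partial>lborel) < \<infinity>" by simp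
  qed
  let ?J = "\<integral>y. profile_remainder u r x s y \<partial>lborel"
  have "has_bochner_integral lborel (\<lambda>y. profile_remainder u r x s y + ?S y) (?J + Z / sqrt (det A) * (r x + \<epsilon> * main1))"
    using irem iS IS by (intro has_bochner_integral_add) (auto simp: has_bochner_integral_iff)
  then have "has_bochner_integral lborel (profile u r x 0 s) (?J + Z / sqrt (det A) * (r x + \<epsilon> * main1))"
    by (simp add: profile_remainder_def)
  then have "has_bochner_integral lborel (\<lambda>y. 1 / (Z * s ^ CARD('d)) * profile u r x 0 s y)
      (1 / (Z * s ^ CARD('d)) * (?J + Z / sqrt (det A) * (r x + \<epsilon> * main1)))"
    by (intro has_bochner_integral_mult_right)
  \<comment> \<open>The normalization (2 pi \<epsilon>)^(d/2) is Z s^d, and its s^d cancels the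
    Jacobian of y -> x + s y.\<close>
  moreover have "1 / (Z * s ^ CARD('d)) * profile u r x 0 s y = laplace_integrand u r \<epsilon> (x + s *\<^sub>R y)" for y
  proof -
    have "\<epsilon> powr (real CARD('d) / 2) = (s powr 2) powr (real CARD('d) / 2)"
      using s by (simp add: powr_numeral)
    also have "\<dots> = s ^ CARD('d)" using s by (simp only: powr_powr) (simp add: powr_realpow)
    finally have "(2 * pi * \<epsilon>) powr (real CARD('d) / 2) = Z * s ^ CARD('d)"
      using \<epsilon> by (simp add: Z_def powr_mult)
    then show ?thesis by (simp add: laplace_integrand_def p0)
  qed
  moreover have "laplace_integrand u r \<epsilon> \<in> borel_measurable borel"
    unfolding laplace_integrand_def by measurable
  ultimately have L: "has_bochner_integral lborel (laplace_integrand u r \<epsilon>)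
      (s ^ CARD('d) * (1 / (Z * s ^ CARD('d)) * (?J + Z / sqrt (det A) * (r x + \<epsilon> * main1))))"
    by (intro has_bochner_integral_dilation[OF _ s(1), of _ x]) auto
  then show "integrable lborel (laplace_integrand u r \<epsilon>)" by (simp add: has_bochner_integral_iff)
  have "integral\<^sup>L lborel (laplace_integrand u r \<epsilon>) = ?J / Z + 1 / sqrt (det A) * (r x + \<epsilon> * main1)"
  proof -
    have cancel: "s ^ CARD('d) * (1 / (Z * s ^ CARD('d)) * y) = y / Z" for y
      using s(1) by simp
    show ?thesis
      unfolding has_bochner_integral_integral_eq[OF L] cancel using Z by (simp add: add_divide_distrib)
  qed
  then have R: "(integral\<^sup>L lborel (laplace_integrand u r \<epsilon>) - 1 / sqrt (det A) * (r x + \<epsilon> * main1)) / \<epsilon>\<^sup>2 = 1 / (Z * \<epsilon>\<^sup>2) * ?J"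
    by simp
  have "ennreal \<bar>1 / (Z * \<epsilon>\<^sup>2) * ?J\<bar> = ennreal (1 / (Z * \<epsilon>\<^sup>2)) * ennreal (norm ?J)"
    using Z by (simp add: abs_mult ennreal_mult'[symmetric])
  also have "\<dots> \<le> ennreal (1 / (Z * \<epsilon>\<^sup>2)) * (\<integral>\<^sup>+y. ennreal \<bar>profile_remainder u r x s y\<bar> \<partial>lborel)"
    using integral_norm_bound_ennreal[OF irem] by (intro mult_left_mono) auto
  also have "\<dots> \<le> ennreal (1 / (Z * \<epsilon>\<^sup>2)) * (ennreal (s ^ 4 * c) * W)"
    by (intro mult_left_mono rem_le) auto
  also have "\<dots> = ennreal (1 / (Z * \<epsilon>\<^sup>2) * (s ^ 4 * c)) * W"
  proof -
    have "0 \<le> s ^ 4 * c" using c by simp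
    from ennreal_mult''[OF this, of "1 / (Z * \<epsilon>\<^sup>2)"] show ?thesis by (simp only: mult.assoc)
  qed
  also have "1 / (Z * \<epsilon>\<^sup>2) * (s ^ 4 * c) = c / Z"
  proof -
    have "s ^ 4 = \<epsilon>\<^sup>2" unfolding s(2)[symmetric] by (simp flip: power_mult)
    then show ?thesis using \<epsilon> by simp
  qed
  finally show "ennreal \<bar>(integral\<^sup>L lborel (laplace_integrand u r \<epsilon>) - 1 / sqrt (det A) * (r x + \<epsilon> * main1)) / \<epsilon>\<^sup>2\<bar>
      \<le> ennreal (c / (2 * pi) powr (real CARD('d) / 2)) * W"
    unfolding R Z_def .
qed

theorem theorem4p1:
  shows "\<exists>C :: real \<Rightarrow> real \<Rightarrow> real \<Rightarrow> real \<Rightarrow> real \<Rightarrow> real.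
    \<forall>(u :: real ^ 'd \<Rightarrow> real) (r :: real ^ 'd \<Rightarrow> real) (lam :: real) (xs :: real ^ 'd).
      Ck 6 u \<longrightarrow>
      (\<forall>k\<in>{3..6}. Linf_norm (D_abs k u) < \<infinity>) \<longrightarrow>
      lam > 0 \<longrightarrow>
      u xs = 0 \<longrightarrow>
      (\<forall>x. u x \<ge> lam / 2 * (norm (x - xs))\<^sup>2) \<longrightarrow>
      Ck 4 r \<longrightarrow>
      (let M = (\<lambda>k. enn2real (Linf_norm (D_abs k u)));
           c = C lam (M 3) (M 4) (M 5) (M 6);
           g = (\<lambda>i j. matrix_inv (hessian u xs) $ i $ j);
           v = (\<lambda>is. pd is u xs);
           main1 =
               1/2 * (\<Sum>i\<in>UNIV. \<Sum>j\<in>UNIV. g i j * pd [i, j] r xs)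
             - 1/2 * (\<Sum>i\<in>UNIV. \<Sum>j\<in>UNIV. \<Sum>k\<in>UNIV. \<Sum>l\<in>UNIV.
                 v [j, k, l] * g i j * g k l * pd [i] r xs)
             + 1/8 * r xs * (\<Sum>i\<in>UNIV. \<Sum>j\<in>UNIV. \<Sum>k\<in>UNIV. \<Sum>l\<in>UNIV. \<Sum>m\<in>UNIV. \<Sum>n\<in>UNIV.
                 v [i, j, k] * v [l, m, n] * g i j * g k l * g m n)
             + 1/12 * r xs * (\<Sum>i\<in>UNIV. \<Sum>j\<in>UNIV. \<Sum>k\<in>UNIV. \<Sum>l\<in>UNIV. \<Sum>m\<in>UNIV. \<Sum>n\<in>UNIV.
                 v [i, j, k] * v [l, m, n] * g i l * g j m * g k n)
             - 1/8 * r xs * (\<Sum>i\<in>UNIV. \<Sum>j\<in>UNIV. \<Sum>k\<in>UNIV. \<Sum>l\<in>UNIV.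
                 v [i, j, k, l] * g i j * g k l)
       in c > 0 \<and>
          (\<exists>R :: real \<Rightarrow> real. \<forall>\<epsilon>>0.
             (conv (K_scaled (\<epsilon> / lam)) (D_abs_le 4 r) xs < \<infinity> \<longrightarrow>
                integrable lborel (laplace_integrand u r \<epsilon>)) \<and>
             integral\<^sup>L lborel (laplace_integrand u r \<epsilon>) =
               1 / sqrt (det (hessian u xs)) * (r xs + \<epsilon> * main1) + \<epsilon>\<^sup>2 * R \<epsilon> \<and>
             ennreal \<bar>R \<epsilon>\<bar> \<le>
               ennreal c * (ennreal (D_abs_le 2 r xs)
                            + conv (K_scaled (\<epsilon> / lam)) (D_abs_le 4 r) xs)))"
proof -
  let ?Z = "(2 * pi) powr (real CARD('d) / 2)"
  \<comment> \<open>The argument 1 + m3 + m4 + m5 + m6 dominates each norm, and the 1 makes it at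
    least 1, as the comparison of powers of B requires. C is fixed before u and r, so it depends on
    them only through its arguments.\<close>
  define C where "C l m3 m4 m5 m6 =
    52 * (real CARD('d) ^ 6 * (1 + m3 + m4 + m5 + m6)) ^ 4 * real CARD('d) ^ 4
      * (exp ((real (CARD('d) + 14))\<^sup>2 / l) * (pi / 2) / sqrt l) / ?Z" for l m3 m4 m5 m6 :: real
  show ?thesis
  proof (intro exI[of _ C] allI impI, unfold Let_def)
    fix u r :: "real^'d \<Rightarrow> real" and lam :: real and xs :: "real^'d"
    assume u: "Ck 6 u" and fin: "\<forall>k\<in>{3..6}. Linf_norm (D_abs k u) < \<infinity>" and l: "lam > 0"
      and x: "u xs = 0" "\<forall>x. u x \<ge> lam / 2 * (norm (x - xs))\<^sup>2" and r: "Ck 4 r"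
    let ?m = "\<lambda>k. enn2real (Linf_norm (D_abs k u))"
    define M where "M = 1 + ?m 3 + ?m 4 + ?m 5 + ?m 6"
    have M1: "1 \<le> M" by (simp add: M_def)
    have M: "D_abs k u z \<le> M" if "3 \<le> k" "k \<le> 6" for k z
    proof -
      have "D_abs k u z \<le> ?m k"
        using that fin by (intro D_abs_le_Linf_norm Ck_antimono[OF u]) auto
      also have "?m k \<le> M"
      proof -
        have "k = 3 \<or> k = 4 \<or> k = 5 \<or> k = 6" using that by auto
        then show ?thesis
          by (elim disjE) (simp_all add: M_def add_nonneg_nonneg)
      qed
      finally show ?thesis .
    qed
    let ?c = "C lam (?m 3) (?m 4) (?m 5) (?m 6)"
    have c: "?c > 0"
      using M1 l unfolding C_def M_def[symmetric] by simp
    note expansion = laplace_expansion[OF u r x(1) x(2)[rule_format] l M1 M]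
    let ?main = "1/2 * (\<Sum>i\<in>UNIV. \<Sum>j\<in>UNIV. matrix_inv (hessian u xs) $ i $ j * pd [i, j] r xs)
             - 1/2 * (\<Sum>i\<in>UNIV. \<Sum>j\<in>UNIV. \<Sum>k\<in>UNIV. \<Sum>l\<in>UNIV.
                 pd [j, k, l] u xs * matrix_inv (hessian u xs) $ i $ j * matrix_inv (hessian u xs) $ k $ l * pd [i] r xs)
             + 1/8 * r xs * (\<Sum>i\<in>UNIV. \<Sum>j\<in>UNIV. \<Sum>k\<in>UNIV. \<Sum>l\<in>UNIV. \<Sum>m\<in>UNIV. \<Sum>n\<in>UNIV.
                 pd [i, j, k] u xs * pd [l, m, n] u xs * matrix_inv (hessian u xs) $ i $ j * matrix_inv (hessian u xs) $ k $ l * matrix_inv (hessian u xs) $ m $ n)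
             + 1/12 * r xs * (\<Sum>i\<in>UNIV. \<Sum>j\<in>UNIV. \<Sum>k\<in>UNIV. \<Sum>l\<in>UNIV. \<Sum>m\<in>UNIV. \<Sum>n\<in>UNIV.
                 pd [i, j, k] u xs * pd [l, m, n] u xs * matrix_inv (hessian u xs) $ i $ l * matrix_inv (hessian u xs) $ j $ m * matrix_inv (hessian u xs) $ k $ n)
             - 1/8 * r xs * (\<Sum>i\<in>UNIV. \<Sum>j\<in>UNIV. \<Sum>k\<in>UNIV. \<Sum>l\<in>UNIV.
                 pd [i, j, k, l] u xs * matrix_inv (hessian u xs) $ i $ j * matrix_inv (hessian u xs) $ k $ l)"
    \<comment> \<open>Solving the expansion for R makes the identity hold for every \<epsilon>, even
      where the integral has its default value 0; the content lies in the bound.\<close>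
    define R where "R \<epsilon> = (integral\<^sup>L lborel (laplace_integrand u r \<epsilon>)
        - 1 / sqrt (det (hessian u xs)) * (r xs + \<epsilon> * ?main)) / \<epsilon>\<^sup>2" for \<epsilon>
    show "0 < ?c \<and> (\<exists>R. \<forall>\<epsilon>>0.
             (conv (K_scaled (\<epsilon> / lam)) (D_abs_le 4 r) xs < \<infinity> \<longrightarrow>
                integrable lborel (laplace_integrand u r \<epsilon>)) \<and>
             integral\<^sup>L lborel (laplace_integrand u r \<epsilon>) =
               1 / sqrt (det (hessian u xs)) * (r xs + \<epsilon> * (?main)) + \<epsilon>\<^sup>2 * R \<epsilon> \<and>
             ennreal \<bar>R \<epsilon>\<bar> \<le>
               ennreal ?c * (ennreal (D_abs_le 2 r xs)
                            + conv (K_scaled (\<epsilon> / lam)) (D_abs_le 4 r) xs))"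
    proof (intro conjI c exI[of _ R] allI impI)
      fix \<epsilon> :: real assume \<epsilon>: "\<epsilon> > 0"
      let ?W = "conv (K_scaled (\<epsilon> / lam)) (D_abs_le 4 r) xs"
      show "integrable lborel (laplace_integrand u r \<epsilon>)" if "?W < \<infinity>"
        by (rule expansion(1)[OF _ _ \<epsilon> that])
      show "integral\<^sup>L lborel (laplace_integrand u r \<epsilon>) =
               1 / sqrt (det (hessian u xs)) * (r xs + \<epsilon> * (?main)) + \<epsilon>\<^sup>2 * R \<epsilon>"
        using \<epsilon> by (simp only: R_def) simp
      show "ennreal \<bar>R \<epsilon>\<bar> \<le> ennreal ?c * (ennreal (D_abs_le 2 r xs) + ?W)"
      proof (cases "?W < \<infinity>")
        case True
        have "ennreal \<bar>R \<epsilon>\<bar> \<le> ennreal ?c * ?W"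
          unfolding R_def C_def M_def[symmetric] by (rule expansion(2)[OF _ _ \<epsilon> True])
        also have "\<dots> \<le> ennreal ?c * (ennreal (D_abs_le 2 r xs) + ?W)"
          by (intro mult_left_mono) (auto intro: add_increasing)
        finally show ?thesis .
      next
        \<comment> \<open>With an infinite convolution and a positive constant the right side is
          infinite.\<close>
        case False
        then have "?W = \<infinity>" by (simp add: less_top[symmetric])
        then show ?thesis using c by (simp add: ennreal_mult_top)
      qed
    qed
  qed
qed

end
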